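(* Let $\gamma$ and $\psi$ satisfy assumptions (a.1)–(a.5) below. For $f\in C_0^\infty(\mathbb{R})$ define \[ T_1 f(x)=\lim_{\varepsilon\to0^+}\int_\varepsilon^1 e^{i\gamma(t)}f(x-t)\,\frac{dt}{t}. \] Then $T_1$ is of weak type $(1,1)$: there is a constant $A$ such that for all $f\in C_0^\infty(\mathbb{R})$ and all $\alpha>0$, \[ |\{x\in\mathbb{R}:|T_1f(x)|>\alpha\}|\le \frac{A}{\alpha}\|f\|_{L^1(\mathbb{R})}. \]
   Context: Standing assumptions: $\gamma\in C^3((0,1])$ is real-valued with $\lim_{t\to0^+}|\gamma(t)|=\infty$, and $\psi\in C^2([0,1])$ is positive on $(0,1]$ with $\lim_{t\to0^+}\psi(t)=0$. There are constants $t_0,s_0,C>0$ such that: (a.1) $\gamma,\psi,\gamma',\gamma'',\psi'$ are all monotone; moreover $\gamma'(t)>0$ and $\gamma'$ is decreasing on $(0,1]$. (Hence $\gamma'$ has an inverse $\gamma'^{-1}(s)$ for $s\ge\gamma'(1)$.) (a.2) For $0<t<t_0$: $\left|\frac{\psi'(t)}{\psi(t)}\right|\le\frac12\left|\frac{\gamma'''(t)}{\gamma''(t)}\right|$. (a.3) For $s>s_0$: $|\gamma''(\gamma'^{-1}(2s))|\le C|\gamma''(\gamma'^{-1}(s))|$. (a.4) There exist $\epsilon>0$ and $A>1+\epsilon$ such that $\gamma'(t)\ge A\gamma'((1+\epsilon)t)$ for $0<t<t_0$. (a.5) There exists $1/2<\lambda<1$ such that $|\gamma''(t)|\le C\gamma'(t)^{2\lambda}$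 for $0<t<t_0$. *)

theory Defs
  imports "HOL-Analysis.Analysis"
begin

definition vderiv_iter :: "nat \<Rightarrow> (real \<Rightarrow> complex) \<Rightarrow> real \<Rightarrow> complex" where
  "vderiv_iter k f = ((\<lambda>g y. vector_derivative g (at y)) ^^ k) f"

definition smooth_compact_support :: "(real \<Rightarrow> complex) \<Rightarrow> bool" where
  "smooth_compact_support f \<longleftrightarrow>
     (\<forall>k x. vderiv_iter k f differentiable (at x)) \<and> compact (closure {x. f x \<noteq> 0})"

definition monotone_either :: "real set \<Rightarrow> (real \<Rightarrow> real) \<Rightarrow> bool" where
  "monotone_either S f \<longleftrightarrow>
     (\<forall>s\<in>S. \<forall>t\<in>S. s \<le> t \<longrightarrow> f s \<le> f t) \<or> (\<forall>s\<in>S. \<forall>t\<in>S. s \<le> t \<longrightarrow> f t \<le> f s)"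

definition T1_trunc :: "(real \<Rightarrow> real) \<Rightarrow> (real \<Rightarrow> complex) \<Rightarrow> real \<Rightarrow> real \<Rightarrow> complex" where
  "T1_trunc \<gamma> f x \<epsilon> =
     integral {\<epsilon>..1} (\<lambda>t. exp (\<i> * complex_of_real (\<gamma> t)) * f (x - t) / complex_of_real t)"

definition T1 :: "(real \<Rightarrow> real) \<Rightarrow> (real \<Rightarrow> complex) \<Rightarrow> real \<Rightarrow> complex" where
  "T1 \<gamma> f x = Lim (at_right 0) (T1_trunc \<gamma> f x)"

end

theory Submission
  imports Defs
begin

text \<open>The argument follows Fefferman's treatment of strongly singular convolutions, without the Fourier
  transform. Write \<open>K\<close> for the kernel \<open>e\<^sup>i\<^sup>\<gamma>\<^sup>(\<^sup>t\<^sup>)/t\<close> cut off near \<open>0\<close>. Van der Corput's lemma bounds the correlations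
  \<open>\<integral> K(x) cnj(K(x+z)) dx\<close> by a decreasing weight \<open>W(z)\<close>, comparable to \<open>1/\<tau>\<close> where \<open>\<gamma>'(\<tau>) = 1/z\<close>. Since \<open>t \<gamma>'(t)\<close>
  grows like a negative power of \<open>t\<close> by (a.4), \<open>W\<close> is integrable. Let \<open>E\<close> contain the set where the maximal function of \<open>f\<close> exceeds \<open>\<alpha>\<close>,
  and let \<open>D(y)\<close> be the distance of \<open>y\<close> to the complement of \<open>E\<close>. Spreading the mass of \<open>f\<close> at \<open>y\<close> over an interval of length
  \<open>1/\<gamma>'(D(y))\<close> changes \<open>K * f\<close> outside \<open>E\<close> by an integrable error, because \<open>K\<close> is smooth at that scale at distance
  \<open>D(y)\<close>. The spread function has potential \<open>O(\<alpha>)\<close> with respect to \<open>W\<close>, so its image has square norm \<open>O(\<alpha> \<parallel>f\<parallel>\<^sub>1)\<close>.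
  All bounds are uniform in the cut-off.\<close>

section \<open>Oscillatory integrals\<close>

text \<open>The kernel oscillates at frequency \<open>\<gamma>' t\<close>, far above
  \<open>1/t\<close> near 0, so shifts by the distance \<open>D\<close> itself are too long for its
  smoothness estimate, as they would be in a Calderon-Zygmund decomposition. Point masses, on the
  other hand, cannot be treated in L2 at all: the squared norm of the truncated kernel grows like
  the reciprocal of the cut-off. The length \<open>1 / g D\<close> meets both demands. It is one
  wavelength at distance \<open>D\<close>, and over it \<open>W\<close> still averages to O(1/D),
  while the mass of \<open>f\<close> within a distance comparable to \<open>D\<close> is O(\<alpha>
  D); the product is O(\<alpha>). No cubes and no cancellation of means occur: the distance function
  alone governs the spreading. The spread mass is kept as a family of translates indexed by pairs
  \<open>(y, u)\<close> with \<open>u\<close> in [0,1], so it needs no density, even at points that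
  are not moved. The exponent is \<open>a = log q A > 1\<close>, where \<open>q\<close> is the
  dilation factor and \<open>A\<close> the constant of (a.4). That \<open>a\<close> exceeds 1 makes
  the van der Corput majorant integrable at 0, makes \<open>W\<close> integrable, and makes the
  limit defining \<open>T1\<close> exist.\<close>

lemma van_der_Corput:
  fixes \<Phi> \<phi> \<phi>' h h' B B' :: "real \<Rightarrow> real"
  assumes pr: "p \<le> r"
    and d\<Phi>: "\<And>t. t \<in> {p..r} \<Longrightarrow> (\<Phi> has_real_derivative \<phi> t) (at t within {p..r})"
    and d\<phi>: "\<And>t. t \<in> {p..r} \<Longrightarrow> (\<phi> has_real_derivative \<phi>' t) (at t within {p..r})"
    and dh: "\<And>t. t \<in> {p..r} \<Longrightarrow> (h has_real_derivative h' t) (at t within {p..r})"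
    and dB: "\<And>t. t \<in> {p..r} \<Longrightarrow> (B has_real_derivative B' t) (at t within {p..r})"
    and c\<phi>': "continuous_on {p..r} \<phi>'" and ch1: "continuous_on {p..r} h'"
    and pos: "\<And>t. t \<in> {p..r} \<Longrightarrow> \<phi> t > 0" and neg: "\<And>t. t \<in> {p..r} \<Longrightarrow> \<phi>' t \<le> 0"
    and hpos: "\<And>t. t \<in> {p..r} \<Longrightarrow> h t \<ge> 0" and h1neg: "\<And>t. t \<in> {p..r} \<Longrightarrow> h' t \<le> 0"
    and B: "\<And>t. t \<in> {p..r} \<Longrightarrow> - h' t / \<phi> t \<le> B' t"
  shows "cmod (integral {p..r} (\<lambda>t. exp (\<i> * complex_of_real (\<Phi> t)) * complex_of_real (h t)))
          \<le> 2 * (h r / \<phi> r) + 2 * (B r - B p)"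
proof -
  \<comment> \<open>Integration by parts against \<open>Q = h / \<phi>\<close>. Since
    \<open>h\<close> decreases while \<open>1 / \<phi>\<close> increases, \<open>Q\<close> need not
    be monotone; the increments of \<open>B\<close> dominate the part of its variation that has the
    wrong sign.\<close>
  define e where "e t = exp (\<i> * complex_of_real (\<Phi> t))" for t
  define Q where "Q t = h t / \<phi> t" for t
  define Q1 where "Q1 t = (h' t * \<phi> t - h t * \<phi>' t) / (\<phi> t * \<phi> t)" for t
  have ne: "e t = cis (\<Phi> t)" for t
    by (simp add: e_def cis_conv_exp)
  have dQ: "(Q has_real_derivative Q1 t) (at t within {p..r})" if "t \<in> {p..r}" for t
    unfolding Q_def Q1_def using pos[OF that] by (intro DERIV_divide dh d\<phi> that) auto
  have de: "(e has_vector_derivative (\<i> * complex_of_real (\<phi> t) * e t)) (at t within {p..r})"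
    if "t \<in> {p..r}" for t
  proof -
    have 1: "((\<lambda>t. \<i> * complex_of_real (\<Phi> t)) has_vector_derivative \<i> * complex_of_real (\<phi> t)) (at t within {p..r})"
      using d\<Phi>[OF that]
      by (intro has_vector_derivative_mult_right has_vector_derivative_of_real)
         (simp add: has_real_derivative_iff_has_vector_derivative)
    have "(exp has_field_derivative e t) (at (\<i> * complex_of_real (\<Phi> t)) within (\<lambda>t. \<i> * complex_of_real (\<Phi> t)) ` {p..r})"
      unfolding e_def by (rule DERIV_subset[OF DERIV_exp]) simp
    from field_vector_diff_chain_within[OF 1 this] show ?thesis
      by (simp add: e_def[abs_def] o_def)
  qed
  have c\<Phi>: "continuous_on {p..r} \<Phi>" and c\<phi>: "continuous_on {p..r} \<phi>" and ch: "continuous_on {p..r} h"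
    using d\<Phi> d\<phi> dh by (metis DERIV_continuous continuous_on_eq_continuous_within)+
  have ce: "continuous_on {p..r} e" unfolding e_def by (intro continuous_intros c\<Phi>)
  have cQ1: "continuous_on {p..r} Q1"
    unfolding Q1_def using pos by (intro continuous_intros c\<phi> ch c\<phi>' ch1) force
  define V where "V t = - \<i> * e t * complex_of_real (Q t)" for t
  have dV: "(V has_vector_derivative (e t * complex_of_real (h t) - \<i> * (e t * complex_of_real (Q1 t)))) (at t within {p..r})"
    if t: "t \<in> {p..r}" for t
  proof -
    have 1: "((\<lambda>t. complex_of_real (Q t)) has_vector_derivative complex_of_real (Q1 t)) (at t within {p..r})"
      using dQ[OF t] by (intro has_vector_derivative_of_real) (simp add: has_real_derivative_iff_has_vector_derivative)
    have "((\<lambda>t. - \<i> * (e t * complex_of_real (Q t))) has_vector_derivative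
          - \<i> * (e t * complex_of_real (Q1 t) + (\<i> * complex_of_real (\<phi> t) * e t) * complex_of_real (Q t))) (at t within {p..r})"
      by (intro has_vector_derivative_mult_right has_vector_derivative_mult de 1 t)
    moreover have "complex_of_real (\<phi> t) * complex_of_real (Q t) = complex_of_real (h t)"
      using pos[OF t] unfolding Q_def by simp
    then have "- \<i> * (e t * complex_of_real (Q1 t) + (\<i> * complex_of_real (\<phi> t) * e t) * complex_of_real (Q t))
        = e t * complex_of_real (h t) - \<i> * (e t * complex_of_real (Q1 t))"
      by (simp add: algebra_simps)
    ultimately show ?thesis unfolding V_def by (simp add: mult.assoc)
  qed
  have iV: "((\<lambda>t. e t * complex_of_real (h t) - \<i> * (e t * complex_of_real (Q1 t))) has_integral (V r - V p)) {p..r}"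
    using dV by (intro fundamental_theorem_of_calculus pr) auto
  have i1: "(\<lambda>t. e t * complex_of_real (Q1 t)) integrable_on {p..r}"
    by (intro integrable_continuous_interval continuous_intros ce cQ1)
  define J where "J = integral {p..r} (\<lambda>t. e t * complex_of_real (Q1 t))"
  have "((\<lambda>t. \<i> * (e t * complex_of_real (Q1 t))) has_integral \<i> * J) {p..r}"
    unfolding J_def using i1 by (intro has_integral_mult_right) (simp add: has_integral_integral)
  from has_integral_add[OF iV this]
  have eq: "integral {p..r} (\<lambda>t. e t * complex_of_real (h t)) = V r - V p + \<i> * J"
    by (auto intro: integral_unique)
  have iQ: "((\<lambda>t. Q1 t + 2 * B' t) has_integral (Q r + 2 * B r) - (Q p + 2 * B p)) {p..r}"
    using dQ dB
    by (intro fundamental_theorem_of_calculus pr)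
       (auto simp flip: has_real_derivative_iff_has_vector_derivative intro!: derivative_eq_intros)
  have "cmod J \<le> integral {p..r} (\<lambda>t. Q1 t + 2 * B' t)"
    unfolding J_def
  proof (rule integral_norm_bound_integral[OF i1])
    show "(\<lambda>t. Q1 t + 2 * B' t) integrable_on {p..r}" using iQ by blast
    fix t assume t: "t \<in> {p..r}"
    have *: "Q1 t = h' t / \<phi> t + - h t * \<phi>' t / (\<phi> t * \<phi> t)"
      unfolding Q1_def using pos[OF t] by (simp add: field_simps)
    have "- h t * \<phi>' t / (\<phi> t * \<phi> t) \<ge> 0"
      using hpos[OF t] neg[OF t] pos[OF t] by (simp add: mult_nonneg_nonpos divide_nonpos_pos)
    moreover have "h' t / \<phi> t \<le> 0" using h1neg[OF t] pos[OF t] by (simp add: divide_nonpos_pos)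
    ultimately have "\<bar>Q1 t\<bar> \<le> Q1 t + 2 * B' t"
      using * B[OF t] unfolding abs_le_iff by (simp only: minus_divide_left[symmetric]) linarith
    moreover have "cmod (e t * complex_of_real (Q1 t)) = \<bar>Q1 t\<bar>"
      by (simp only: norm_mult ne norm_cis norm_of_real mult_1)
    ultimately show "cmod (e t * complex_of_real (Q1 t)) \<le> Q1 t + 2 * B' t"
      by (simp only:)
  qed
  also have "\<dots> = (Q r + 2 * B r) - (Q p + 2 * B p)" using iQ by (rule integral_unique)
  finally have J: "cmod J \<le> (Q r + 2 * B r) - (Q p + 2 * B p)" .
  have "Q p \<ge> 0" "Q r \<ge> 0" unfolding Q_def using pr
    by (auto intro!: divide_nonneg_pos hpos pos)
  then have Vn: "cmod (V r) = Q r" "cmod (V p) = Q p" by (auto simp: V_def ne norm_mult)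
  have "cmod (V r - V p + \<i> * J) \<le> cmod (V r) + cmod (V p) + cmod J"
    using norm_triangle_ineq[of "V r - V p" "\<i> * J"] norm_triangle_ineq4[of "V r" "V p"]
    by (simp add: norm_mult)
  \<comment> \<open>The value \<open>Q p\<close> cancels here. The left endpoint will be the
    cut-off, so this is what allows bounds uniform in it.\<close>
  also have "\<dots> \<le> Q r + Q p + ((Q r + 2 * B r) - (Q p + 2 * B p))"
    unfolding Vn by (intro add_left_mono J)
  also have "\<dots> = 2 * Q r + 2 * (B r - B p)" by (simp add: algebra_simps)
  finally have "cmod (V r - V p + \<i> * J) \<le> 2 * Q r + 2 * (B r - B p)" .
  then show ?thesis unfolding eq[symmetric] by (simp add: e_def Q_def)
qed

text \<open>\<open>g\<close> and \<open>g2\<close> are the first two derivatives of the phase.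
  \<open>growth\<close> is (a.4) iterated over all scales. \<open>gap\<close> bounds from below the
  derivative of \<open>\<gamma> t - \<gamma> (t + z)\<close>, the phase of a correlation.
  \<open>tg\<close> is a normalisation, reached by shrinking \<open>b\<close>, that makes the
  wavelength \<open>1 / g t\<close> at most \<open>t\<close>.\<close>

locale singular_phase =
  fixes \<gamma> g g2 :: "real \<Rightarrow> real" and a b c0 c1 :: real
  assumes b: "0 < b" "b < 1" and a: "1 < a" and c0: "0 < c0" and c1: "0 < c1"
    and d\<gamma>: "\<And>t. 0 < t \<Longrightarrow> t \<le> b \<Longrightarrow> (\<gamma> has_real_derivative g t) (at t)"
    and dg: "\<And>t. 0 < t \<Longrightarrow> t \<le> b \<Longrightarrow> (g has_real_derivative g2 t) (at t)"
    and cg2: "continuous_on {0<..b} g2"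
    and g2_mono: "\<And>s t. 0 < s \<Longrightarrow> s \<le> t \<Longrightarrow> t \<le> b \<Longrightarrow> g2 s \<le> g2 t"
    and g_pos: "\<And>t. 0 < t \<Longrightarrow> t \<le> b \<Longrightarrow> 0 < g t"
    and g_anti: "\<And>s t. 0 < s \<Longrightarrow> s \<le> t \<Longrightarrow> t \<le> b \<Longrightarrow> g t \<le> g s"
    and growth: "\<And>u t. 0 < u \<Longrightarrow> u \<le> t \<Longrightarrow> t \<le> b \<Longrightarrow> c0 * (t / u) powr a * g t \<le> g u"
    and gap: "\<And>t z. 0 < t \<Longrightarrow> 0 < z \<Longrightarrow> t + z \<le> b \<Longrightarrow> c1 * g t * z / (t + z) \<le> g t - g (t + z)"
    and tg: "\<And>t. 0 < t \<Longrightarrow> t \<le> b \<Longrightarrow> 1 \<le> t * g t"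
begin

lemma c0_le_1: "c0 \<le> 1"
  using growth[of b b] g_pos[of b] b by simp

lemma cont_\<gamma>: "continuous_on {0<..b} \<gamma>"
  using d\<gamma> by (meson DERIV_isCont continuous_at_imp_continuous_on greaterThanAtMost_iff)

lemma cont_g: "continuous_on {0<..b} g"
  using dg by (meson DERIV_isCont continuous_at_imp_continuous_on greaterThanAtMost_iff)

text \<open>The growth hypothesis turns \<open>1 / g\<close> into a power, whose antiderivative is available.\<close>

lemma inverse_g_le:
  assumes "0 < u" "u \<le> t" "t \<le> b"
  shows "1 / g u \<le> (u / t) powr a / (c0 * g t)"
proof -
  have p: "0 < c0 * (t / u) powr a * g t" using assms c0 g_pos[of t] by simp
  have "1 / g u \<le> 1 / (c0 * (t / u) powr a * g t)"
    using growth[OF assms] p by (intro divide_left_mono) (auto intro!: mult_pos_pos g_pos assms order_trans[OF assms(2,3)])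
  also have "\<dots> = (u / t) powr a / (c0 * g t)"
    using assms by (simp add: powr_divide field_simps)
  finally show ?thesis .
qed

text \<open>Lowering the exponent in \<open>growth\<close> from \<open>a\<close> to 1 costs nothing
  but the constant \<open>c0\<close>. This replaces monotonicity of \<open>t * g t\<close>, which is
  not assumed.\<close>

lemma tg_quasi_anti:
  assumes "0 < u" "u \<le> t" "t \<le> b"
  shows "c0 * (t * g t) \<le> u * g u"
proof -
  have "t / u \<le> (t / u) powr a"
    using powr_mono[of 1 a "t / u"] a assms by simp
  then have "c0 * (t / u) * g t \<le> c0 * (t / u) powr a * g t"
    using c0 g_pos[of t] assms by (intro mult_right_mono mult_left_mono) auto
  also have "\<dots> \<le> g u" by (rule growth[OF assms])
  finally show ?thesis using assms by (simp add: field_simps)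
qed

text \<open>The derivative of the amplitude is of size \<open>1 / (t^2 * (t + z))\<close>, and
  \<open>gap\<close> has the denominator \<open>t + z\<close>, so the shift cancels in the quotient.
  What is left, \<open>1 / (z * t^2 * g t)\<close>, is by \<open>growth\<close> at most a multiple
  of \<open>t powr (a - 2)\<close>, which is integrable at 0.\<close>

lemma oscillation_correlation_aux:
  assumes p: "0 < p" "p \<le> m" and z: "0 < z" "m + z \<le> b"
  shows "cmod (integral {p..m} (\<lambda>t. exp (\<i> * complex_of_real (\<gamma> t - \<gamma> (t + z))) * complex_of_real (1 / (t * (t + z)))))
     \<le> (2 / c1 + 4 / (c1 * c0 * (a - 1))) / (z * m * g m)"
proof -
  define M where "M = 2 / (c1 * z * c0 * g m * m powr a)"
  define h1 where "h1 t = - (2 * t + z) / (t * (t + z))^2" for t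
  have m: "0 < m" "m \<le> b" using p z by auto
  have M0: "0 < M" unfolding M_def using c0 c1 z g_pos[OF m] m by simp
  have gpos: "0 < g t - g (t + z)" if "t \<in> {p..m}" for t
  proof -
    have "0 < c1 * g t * z / (t + z)" using that p z c1 g_pos[of t] by auto
    with gap[of t z] that p z show ?thesis by auto
  qed
  have "cmod (integral {p..m} (\<lambda>t. exp (\<i> * complex_of_real (\<gamma> t - \<gamma> (t + z))) * complex_of_real (1 / (t * (t + z)))))
    \<le> 2 * ((1 / (m * (m + z))) / (g m - g (m + z)))
       + 2 * (M * m powr (a - 1) / (a - 1) - M * p powr (a - 1) / (a - 1))"
  proof (rule van_der_Corput[where \<phi>="\<lambda>t. g t - g (t + z)" and \<phi>'="\<lambda>t. g2 t - g2 (t + z)" and h'=h1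
        and B' = "\<lambda>t. M * t powr (a - 2)"])
    show "p \<le> m" by fact
    fix t assume t: "t \<in> {p..m}"
    then have t0: "0 < t" "t \<le> b" "t + z \<le> b" using p z by auto
    have shift: "((\<lambda>t. f (t + z)) has_real_derivative f' (t + z)) (at t within {p..m})"
      if "\<And>t. 0 < t \<Longrightarrow> t \<le> b \<Longrightarrow> (f has_real_derivative f' t) (at t)" for f f'
      using DERIV_shift[of f "f' (t + z)" t z] that[of "t + z"] t0 z by (auto intro: has_field_derivative_at_within)
    show "((\<lambda>t. \<gamma> t - \<gamma> (t + z)) has_real_derivative g t - g (t + z)) (at t within {p..m})"
      using d\<gamma>[OF t0(1,2)] by (intro DERIV_diff shift d\<gamma>) (auto intro: has_field_derivative_at_within)
    show "((\<lambda>t. g t - g (t + z)) has_real_derivative g2 t - g2 (t + z)) (at t within {p..m})"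
      using dg[OF t0(1,2)] by (intro DERIV_diff shift dg) (auto intro: has_field_derivative_at_within)
    show "((\<lambda>t. 1 / (t * (t + z))) has_real_derivative h1 t) (at t within {p..m})"
    proof -
      have "((\<lambda>t. t * (t + z)) has_real_derivative 2 * t + z) (at t within {p..m})"
        by (auto intro!: derivative_eq_intros)
      then have "((\<lambda>t. 1 / (t * (t + z))) has_real_derivative
          (0 * (t * (t + z)) - 1 * (2 * t + z)) / ((t * (t + z)) * (t * (t + z)))) (at t within {p..m})"
        by (intro DERIV_divide DERIV_const) (use t0 z in auto)
      then show ?thesis unfolding h1_def power2_eq_square by simp
    qed
    show "((\<lambda>t. M * t powr (a - 1) / (a - 1)) has_real_derivative M * t powr (a - 2)) (at t within {p..m})"
      using t0 a by (auto intro!: derivative_eq_intros has_field_derivative_powr)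
    show "0 < g t - g (t + z)" using gpos[OF t] .
    show "g2 t - g2 (t + z) \<le> 0" using g2_mono[of t "t + z"] t0 z by simp
    show "0 \<le> 1 / (t * (t + z))" "h1 t \<le> 0" using t0 z by (auto simp: h1_def divide_nonpos_nonneg)
    have "- h1 t / (g t - g (t + z)) \<le> - h1 t / (c1 * g t * z / (t + z))"
      using gap[of t z] t0 z c1 g_pos[of t] gpos[OF t]
      by (intro divide_left_mono mult_pos_pos divide_pos_pos) (auto simp: h1_def divide_nonpos_nonneg)
    also have "\<dots> = (2 * t + z) / (t + z) * (1 / (c1 * z * t^2) * (1 / g t))"
    proof -
      have "- (- N / (t * w)^2) / (c1 * g t * z / w) = N / w * (1 / (c1 * z * t^2) * (1 / g t))"
        if "0 < w" for N w
        using t0 z c1 g_pos[of t] that by (simp add: power2_eq_square)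
      from this[of "t + z" "2 * t + z"] show ?thesis unfolding h1_def using t0 z by simp
    qed
    also have "\<dots> \<le> 2 * (1 / (c1 * z * t^2) * ((t / m) powr a / (c0 * g m)))"
      using t0 z c1 c0 g_pos[of t] g_pos[OF m] t m
      by (intro mult_mono inverse_g_le) (auto simp: divide_le_eq)
    also have "\<dots> = M * t powr (a - 2)"
      using t0 m by (simp add: M_def powr_divide powr_diff powr_numeral field_simps)
    finally show "- h1 t / (g t - g (t + z)) \<le> M * t powr (a - 2)" .
  next
    show "continuous_on {p..m} (\<lambda>t. g2 t - g2 (t + z))"
      using p z by (intro continuous_intros continuous_on_subset[OF cg2]
          continuous_on_compose2[OF cg2, where f="\<lambda>t. t + z"]) auto
    show "continuous_on {p..m} h1"
      unfolding h1_def using p z by (intro continuous_intros) auto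
  qed
  also have "\<dots> \<le> 2 / (c1 * z * m * g m) + 4 / (c1 * c0 * (a - 1) * z * m * g m)"
  proof (rule add_mono)
    have "1 / (m * (m + z)) / (g m - g (m + z)) \<le> 1 / (m * (m + z)) / (c1 * g m * z / (m + z))"
      using gap[of m z] m z c1 g_pos[OF m] gpos[of m] p
      by (intro divide_left_mono mult_pos_pos divide_pos_pos) auto
    also have "\<dots> = 1 / (c1 * z * m * g m)"
    proof -
      have "1 / (m * w) / (c1 * g m * z / w) = 1 / (c1 * z * m * g m)" if "0 < w" for w
        using that by (simp add: mult_ac)
      then show ?thesis using m z by simp
    qed
    finally show "2 * (1 / (m * (m + z)) / (g m - g (m + z))) \<le> 2 / (c1 * z * m * g m)" by simp
    have "2 * (M * m powr (a - 1) / (a - 1) - M * p powr (a - 1) / (a - 1)) \<le> 2 * (M * m powr (a - 1) / (a - 1))"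
      using M0 a by simp
    also have "\<dots> = 4 / (c1 * c0 * (a - 1) * z * m * g m)"
      using m unfolding M_def by (simp add: powr_diff field_simps)
    finally show "2 * (M * m powr (a - 1) / (a - 1) - M * p powr (a - 1) / (a - 1)) \<le> 4 / (c1 * c0 * (a - 1) * z * m * g m)" .
  qed
  also have "\<dots> = (2 / c1 + 4 / (c1 * c0 * (a - 1))) / (z * m * g m)"
    using m z c0 c1 a g_pos[OF m] by (simp add: field_simps)
  finally show ?thesis .
qed

definition C_corr :: real where
  "C_corr = (2 / c1 + 4 / (c1 * c0 * (a - 1))) / c0 + 1"

lemma C_corr_pos: "C_corr \<ge> 1"
  unfolding C_corr_def using c0 c1 a by (simp add: add_nonneg_nonneg)

text \<open>The parameter \<open>r\<close> is free; the optimal choice is the solution of \<open>z * g r = 1\<close>.\<close>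

lemma oscillation_correlation:
  assumes p: "0 < p" "p \<le> R" and z: "0 < z" "R + z \<le> b" and r: "0 < r" "r \<le> b"
  shows "cmod (integral {p..R} (\<lambda>t. exp (\<i> * complex_of_real (\<gamma> t - \<gamma> (t + z))) * complex_of_real (1 / (t * (t + z)))))
     \<le> C_corr * ((1 / r) * (1 + 1 / (z * g r)))"
proof -
  define f where "f t = exp (\<i> * complex_of_real (\<gamma> t - \<gamma> (t + z))) * complex_of_real (1 / (t * (t + z)))" for t
  define c2 where "c2 = 2 / c1 + 4 / (c1 * c0 * (a - 1))"
  have c2: "c2 > 0" unfolding c2_def using c0 c1 a by (simp add: add_pos_pos)
  have cf: "continuous_on {p..R} f" unfolding f_def using p z
    by (intro continuous_intros continuous_on_subset[OF cont_\<gamma>]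
          continuous_on_compose2[OF cont_\<gamma>, where f="\<lambda>t. t + z"]) auto
  have fi: "f integrable_on {u..v}" if "p \<le> u" "v \<le> R" for u v
    using that by (intro integrable_continuous_interval continuous_on_subset[OF cf]) auto
  have tail: "cmod (integral {u..R} f) \<le> 1 / u" if u: "p \<le> u" "u \<le> R" for u
  proof -
    have i: "((\<lambda>t. 1 / t^2) has_integral (- 1 / R - (- 1 / u))) {u..R}"
      using u p by (intro fundamental_theorem_of_calculus)
        (auto simp flip: has_real_derivative_iff_has_vector_derivative intro!: derivative_eq_intros simp: power2_eq_square)
    have "cmod (integral {u..R} f) \<le> integral {u..R} (\<lambda>t. 1 / t^2)"
    proof (rule integral_norm_bound_integral)
      show "f integrable_on {u..R}" using fi u by auto
      show "(\<lambda>t. 1 / t^2) integrable_on {u..R}" using i by blast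
      fix t assume "t \<in> {u..R}"
      then have "0 < t" using u p by auto
      then show "cmod (f t) \<le> 1 / t^2" using z
        by (auto simp: f_def norm_mult norm_divide power2_eq_square intro!: divide_left_mono mult_left_mono
             simp flip: of_real_add of_real_mult)
    qed
    also have "\<dots> = 1 / u - 1 / R" using i by (simp add: integral_unique)
    also have "\<dots> \<le> 1 / u" using p by simp
    finally show ?thesis .
  qed
  have nn: "0 \<le> 1 / (z * g r)" using z g_pos[OF r] by simp
  \<comment> \<open>Oscillation is used below \<open>m\<close> and absolute values above it, where
    the amplitude is at most \<open>1 / t^2\<close>. As \<open>r\<close> is unrelated to
    \<open>{p..R}\<close>, either piece may be empty.\<close>
  define m where "m = min r R"
  have "cmod (integral {p..R} f) \<le> c2 / c0 / (z * r * g r) + 1 / r"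
  proof (cases "m \<le> p")
    case True
    show ?thesis
    proof (cases "R = p")
      case True
      then show ?thesis using c2 c0 z r g_pos[OF r] by (simp add: add_nonneg_nonneg)
    next
      case False
      then have "r \<le> p" using True p unfolding m_def by auto
      then have "cmod (integral {p..R} f) \<le> 1 / r"
        using tail[of p] p r by (meson frac_le order_refl order_trans zero_le_one)
      moreover have "0 \<le> c2 / c0 / (z * r * g r)" using c2 c0 z r g_pos[OF r] by simp
      ultimately show ?thesis by linarith
    qed
  next
    case False
    then have m: "p \<le> m" "m \<le> R" "m \<le> r" "0 < m" unfolding m_def using p by auto
    have split: "integral {p..R} f = integral {p..m} f + integral {m..R} f"
      using Henstock_Kurzweil_Integration.integral_combine[OF m(1,2) fi[OF order_refl order_refl]] by simp
    have "cmod (integral {p..m} f) \<le> c2 / (z * m * g m)"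
      unfolding f_def c2_def using p m z by (intro oscillation_correlation_aux) auto
    \<comment> \<open>Quasi-monotonicity of \<open>t * g t\<close> trades the split point
      \<open>m\<close> for the free parameter \<open>r\<close>.\<close>
    also have "\<dots> \<le> c2 / (z * (c0 * (r * g r)))"
      using tg_quasi_anti[of m r] m r z c0 c2 g_pos[OF r] g_pos[of m]
      by (auto intro!: divide_left_mono mult_left_mono mult_pos_pos simp: mult.assoc)
    finally have 1: "cmod (integral {p..m} f) \<le> c2 / c0 / (z * r * g r)"
      by (simp add: mult.left_commute mult.assoc mult.commute)
    have 2: "cmod (integral {m..R} f) \<le> 1 / r"
    proof (cases "r \<le> R")
      case True
      then show ?thesis using tail[of m] m unfolding m_def by (auto simp: min_def)
    next
      case False
      then have "m = R" unfolding m_def by auto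
      then show ?thesis using r by simp
    qed
    show ?thesis unfolding split using 1 2 norm_triangle_ineq[of "integral {p..m} f" "integral {m..R} f"] by linarith
  qed
  also have "\<dots> = c2 / c0 * ((1 / r) * (1 / (z * g r))) + 1 / r" by simp
  also have "\<dots> \<le> C_corr * ((1 / r) * (1 / (z * g r))) + C_corr * (1 / r)"
    using C_corr_pos c2 r nn
    by (intro add_mono mult_right_mono) (auto simp: C_corr_def c2_def divide_right_mono)
  also have "\<dots> = C_corr * ((1 / r) * (1 + 1 / (z * g r)))" by (simp only: distrib_left mult_1_right)
  finally show ?thesis unfolding f_def .
qed

end

section \<open>Decreasing weights\<close>

lemma borel_measurable_antimono_ennreal:
  fixes f :: "real \<Rightarrow> ennreal"
  assumes "antimono f"
  shows "f \<in> borel_measurable borel"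
proof (rule borel_measurableI_greater)
  fix y
  have "f -` {y<..} \<in> sets borel"
    using assms by (intro real_interval_borel_measurable)
      (auto simp: is_interval_1 antimono_def intro: less_le_trans)
  then show "{x \<in> space borel. y < f x} \<in> sets borel" by (simp add: vimage_def)
qed

text \<open>Among windows on the half line, a decreasing weight puts the most mass on the one that
  starts at 0. The parts of the window on either side of 0 are moved there separately, the negative
  one after reflection; hence the factor 2.\<close>

lemma nn_integral_antimono_shift_le:
  fixes w :: "real \<Rightarrow> ennreal"
  assumes w: "antimono w" and s: "0 \<le> s"
  shows "(\<integral>\<^sup>+v. w \<bar>v\<bar> * indicator {d..d + s} v \<partial>lborel) \<le> 2 * (\<integral>\<^sup>+v. w v * indicator {0..s} v \<partial>lborel)"
proof -
  have [measurable]: "w \<in> borel_measurable borel" by (rule borel_measurable_antimono_ennreal[OF w])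
  have half: "(\<integral>\<^sup>+v. w v * indicator {max 0 d..d + s} v \<partial>lborel) \<le> (\<integral>\<^sup>+v. w v * indicator {0..s} v \<partial>lborel)" for d
  proof -
    have "(\<integral>\<^sup>+v. w v * indicator {max 0 d..d + s} v \<partial>lborel)
        = (\<integral>\<^sup>+v. w (max 0 d + 1 * v) * indicator {max 0 d..d + s} (max 0 d + 1 * v) \<partial>lborel)"
      by (subst nn_integral_real_affine[where c=1 and t="max 0 d"]) auto
    also have "\<dots> \<le> (\<integral>\<^sup>+v. w v * indicator {0..s} v \<partial>lborel)"
      using w by (intro nn_integral_mono) (auto simp: indicator_def antimono_def)
    finally show ?thesis .
  qed
  have "(\<integral>\<^sup>+v. w \<bar>v\<bar> * indicator {d..d + s} v \<partial>lborel)
     \<le> (\<integral>\<^sup>+v. w v * indicator {max 0 d..d + s} v + w (-v) * indicator {max 0 (-d-s)..(-d-s) + s} (-v) \<partial>lborel)"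
    by (intro nn_integral_mono) (auto simp: indicator_def)
  also have "\<dots> = (\<integral>\<^sup>+v. w v * indicator {max 0 d..d + s} v \<partial>lborel)
      + (\<integral>\<^sup>+v. w (-v) * indicator {max 0 (-d-s)..(-d-s) + s} (-v) \<partial>lborel)"
    by (intro nn_integral_add) auto
  also have "(\<integral>\<^sup>+v. w (-v) * indicator {max 0 (-d-s)..(-d-s) + s} (-v) \<partial>lborel)
      = (\<integral>\<^sup>+v. w v * indicator {max 0 (-d-s)..(-d-s) + s} v \<partial>lborel)"
    by (subst (2) nn_integral_real_affine[where c="-1" and t=0]) auto
  also have "(\<integral>\<^sup>+v. w v * indicator {max 0 d..d + s} v \<partial>lborel) + \<dots>
     \<le> (\<integral>\<^sup>+v. w v * indicator {0..s} v \<partial>lborel) + (\<integral>\<^sup>+v. w v * indicator {0..s} v \<partial>lborel)"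
    by (intro add_mono half)
  finally show ?thesis by (simp add: mult_2)
qed

lemma nn_integral_average_antimono_le:
  fixes w :: "real \<Rightarrow> ennreal"
  assumes w: "antimono w" and s: "0 < s"
  shows "(\<integral>\<^sup>+u. w \<bar>d + s * u\<bar> * indicator {0..1} u \<partial>lborel)
     \<le> ennreal (2 / s) * (\<integral>\<^sup>+v. w v * indicator {0..s} v \<partial>lborel)"
proof -
  have [measurable]: "w \<in> borel_measurable borel" by (rule borel_measurable_antimono_ennreal[OF w])
  have "(\<integral>\<^sup>+v. w \<bar>v\<bar> * indicator {d..d + s} v \<partial>lborel)
     = ennreal s * (\<integral>\<^sup>+u. w \<bar>d + s * u\<bar> * indicator {d..d + s} (d + s * u) \<partial>lborel)"
    using s by (subst nn_integral_real_affine[where c=s and t=d]) auto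
  also have "(\<integral>\<^sup>+u. w \<bar>d + s * u\<bar> * indicator {d..d + s} (d + s * u) \<partial>lborel)
     = (\<integral>\<^sup>+u. w \<bar>d + s * u\<bar> * indicator {0..1} u \<partial>lborel)"
    using s by (intro nn_integral_cong) (auto simp: indicator_def zero_le_mult_iff mult_le_cancel_left1)
  finally have "(\<integral>\<^sup>+u. w \<bar>d + s * u\<bar> * indicator {0..1} u \<partial>lborel)
      = ennreal (1 / s) * (\<integral>\<^sup>+v. w \<bar>v\<bar> * indicator {d..d + s} v \<partial>lborel)"
    using s by (simp add: mult.assoc[symmetric] ennreal_mult[symmetric])
  also have "\<dots> \<le> ennreal (1 / s) * (2 * (\<integral>\<^sup>+v. w v * indicator {0..s} v \<partial>lborel))"
    using s by (intro mult_left_mono nn_integral_antimono_shift_le w) auto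
  also have "\<dots> = ennreal (2 / s) * (\<integral>\<^sup>+v. w v * indicator {0..s} v \<partial>lborel)"
  proof -
    have "ennreal (1 / s) * 2 = ennreal (2 / s)"
      using s ennreal_mult'[of 2 "1 / s"] by (simp add: mult.commute)
    then show ?thesis by (simp add: mult.assoc[symmetric])
  qed
  finally show ?thesis .
qed

text \<open>Linear growth of the mass of balls lets one integrate a radially decreasing weight: the weight at
  distance \<open>\<rho>\<close> is dominated by its average over \<open>[\<rho>/2, \<rho>]\<close>.\<close>

lemma nn_integral_antimono_weight_le:
  fixes w :: "real \<Rightarrow> ennreal" and F :: "real \<Rightarrow> ennreal"
  assumes w: "antimono w" and F[measurable]: "F \<in> borel_measurable borel" and \<kappa>: "0 \<le> \<kappa>"
    and mass: "\<And>r. 0 < r \<Longrightarrow> \<delta> \<le> r \<Longrightarrow> (\<integral>\<^sup>+y. F y * indicator (cball x r) y \<partial>lborel) \<le> ennreal (\<kappa> * r)"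
  shows "(\<integral>\<^sup>+y. F y * (if \<delta> \<le> \<bar>x - y\<bar> \<and> y \<noteq> x then w (\<bar>x - y\<bar> / 2) else 0) \<partial>lborel)
     \<le> ennreal (8 * \<kappa>) * (\<integral>\<^sup>+r. w r * indicator {0..} r \<partial>lborel)"
proof -
  have [measurable]: "w \<in> borel_measurable borel" by (rule borel_measurable_antimono_ennreal[OF w])
  \<comment> \<open>\<open>k\<close> selects \<open>r\<close> between a quarter and a half of the
    distance from \<open>x\<close> to \<open>y\<close>. With \<open>\<rho>\<close> half that
    distance this is \<open>[\<rho>/2, \<rho>]\<close>, of length \<open>\<rho>/2\<close>, so the
    factor \<open>2 / r\<close> brings the integral over \<open>r\<close> up to at least
    \<open>w \<rho>\<close>.\<close>
  define k where "k y r = (if 0 < r \<and> \<delta> \<le> \<bar>x - y\<bar> \<and> 2 * r \<le> \<bar>x - y\<bar> \<and> \<bar>x - y\<bar> \<le> 4 * r then 1 else 0 :: ennreal)" for y r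
  have km[measurable]: "(\<lambda>(y, r). k y r) \<in> borel_measurable (borel \<Otimes>\<^sub>M borel)"
    unfolding k_def by measurable
  have pt: "(if \<delta> \<le> \<bar>x - y\<bar> \<and> y \<noteq> x then w (\<bar>x - y\<bar> / 2) else 0) \<le> (\<integral>\<^sup>+r. w r * ennreal (2 / r) * k y r \<partial>lborel)" for y
  proof (cases "\<delta> \<le> \<bar>x - y\<bar> \<and> y \<noteq> x")
    case True
    define \<rho> where "\<rho> = \<bar>x - y\<bar> / 2"
    have \<rho>: "0 < \<rho>" using True unfolding \<rho>_def by auto
    have "w \<rho> = w \<rho> * ennreal (2 / \<rho>) * emeasure lborel {\<rho>/2..\<rho>}"
      using \<rho> by (simp add: mult.assoc ennreal_mult[symmetric])
    also have "\<dots> = (\<integral>\<^sup>+r. (w \<rho> * ennreal (2 / \<rho>)) * indicator {\<rho>/2..\<rho>} r \<partial>lborel)"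
      by (subst nn_integral_cmult_indicator) auto
    also have "\<dots> \<le> (\<integral>\<^sup>+r. w r * ennreal (2 / r) * k y r \<partial>lborel)"
    proof (rule nn_integral_mono)
      fix r
      show "w \<rho> * ennreal (2 / \<rho>) * indicator {\<rho>/2..\<rho>} r \<le> w r * ennreal (2 / r) * k y r"
      proof (cases "r \<in> {\<rho>/2..\<rho>}")
        case r: True
        then have "k y r = 1" using True \<rho> unfolding k_def by (auto simp: \<rho>_def)
        moreover have "w \<rho> \<le> w r" using w r by (auto simp: antimono_def)
        moreover have "ennreal (2 / \<rho>) \<le> ennreal (2 / r)" using r \<rho> by (intro ennreal_leI divide_left_mono) auto
        ultimately show ?thesis using r by (auto intro: mult_mono)
      qed auto
    qed
    finally show ?thesis using True by (simp add: \<rho>_def)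
  qed auto
  have "(\<integral>\<^sup>+y. F y * (if \<delta> \<le> \<bar>x - y\<bar> \<and> y \<noteq> x then w (\<bar>x - y\<bar> / 2) else 0) \<partial>lborel)
     \<le> (\<integral>\<^sup>+y. F y * (\<integral>\<^sup>+r. w r * ennreal (2 / r) * k y r \<partial>lborel) \<partial>lborel)"
    by (intro nn_integral_mono mult_left_mono pt) auto
  also have "\<dots> = (\<integral>\<^sup>+y. (\<integral>\<^sup>+r. F y * (w r * ennreal (2 / r) * k y r) \<partial>lborel) \<partial>lborel)"
    by (subst nn_integral_cmult) auto
  also have "\<dots> = (\<integral>\<^sup>+r. (\<integral>\<^sup>+y. F y * (w r * ennreal (2 / r) * k y r) \<partial>lborel) \<partial>lborel)"
    by (intro lborel_pair.Fubini') measurable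
  also have "\<dots> = (\<integral>\<^sup>+r. w r * ennreal (2 / r) * (\<integral>\<^sup>+y. F y * k y r \<partial>lborel) \<partial>lborel)"
    by (subst nn_integral_cmult[symmetric]) (auto simp: mult_ac)
  also have "\<dots> \<le> (\<integral>\<^sup>+r. ennreal (8 * \<kappa>) * (w r * indicator {0..} r) \<partial>lborel)"
  proof (rule nn_integral_mono)
    fix r :: real
    show "w r * ennreal (2 / r) * (\<integral>\<^sup>+y. F y * k y r \<partial>lborel) \<le> ennreal (8 * \<kappa>) * (w r * indicator {0..} r)"
    \<comment> \<open>For fixed \<open>r\<close> the selected \<open>y\<close> lie in the ball of
      radius \<open>4 * r\<close>, and there are none unless \<open>\<delta> \<le> 4 * r\<close>. So
      the mass bound is available whenever it is wanted, and \<open>2 / r\<close> times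
      \<open>\<kappa> * (4 * r)\<close> is \<open>8 * \<kappa>\<close>.\<close>
    proof (cases "0 < r \<and> \<delta> \<le> 4 * r")
      case True
      have "(\<integral>\<^sup>+y. F y * k y r \<partial>lborel) \<le> (\<integral>\<^sup>+y. F y * indicator (cball x (4 * r)) y \<partial>lborel)"
        by (intro nn_integral_mono mult_left_mono) (auto simp: k_def indicator_def dist_real_def)
      also have "\<dots> \<le> ennreal (\<kappa> * (4 * r))" using True by (intro mass) auto
      finally have "w r * ennreal (2 / r) * (\<integral>\<^sup>+y. F y * k y r \<partial>lborel) \<le> w r * ennreal (2 / r) * ennreal (\<kappa> * (4 * r))"
        by (intro mult_left_mono) auto
      also have "\<dots> = w r * ennreal (8 * \<kappa>)"
        using True \<kappa> by (simp add: mult.assoc ennreal_mult[symmetric])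
      finally show ?thesis using True by (simp add: mult.commute)
    next
      case False
      then have "k y r = 0" for y unfolding k_def by auto
      then show ?thesis by simp
    qed
  qed
  also have "\<dots> = ennreal (8 * \<kappa>) * (\<integral>\<^sup>+r. w r * indicator {0..} r \<partial>lborel)"
    by (intro nn_integral_cmult) auto
  finally show ?thesis .
qed

section \<open>The correlation weight and its averages\<close>

context singular_phase begin

text \<open>The infimum over \<open>r\<close> avoids inverting \<open>g\<close> and makes
  monotonicity immediate. The value \<open>top\<close> at 0 reflects that the self-correlation has
  no bound uniform in the cut-off; beyond \<open>b\<close> the supports of the two translates are
  disjoint.\<close>

definition W :: "real \<Rightarrow> ennreal" where
  "W z = (if z \<le> 0 then top else if z \<le> b then
     (INF r\<in>{0<..b}. ennreal (C_corr * ((1 / r) * (1 + 1 / (z * g r))))) else 0)"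

lemma W_antimono: "antimono W"
proof (rule antimonoI)
  fix x y :: real assume xy: "x \<le> y"
  show "W y \<le> W x"
  proof (cases "0 < x \<and> y \<le> b")
    case True
    have "(INF r\<in>{0<..b}. ennreal (C_corr * ((1 / r) * (1 + 1 / (y * g r)))))
        \<le> (INF r\<in>{0<..b}. ennreal (C_corr * ((1 / r) * (1 + 1 / (x * g r)))))"
    proof (intro INF_mono bexI ennreal_leI)
      fix r assume "r \<in> {0<..b}"
      then have r: "0 < r" "0 < g r" using g_pos by auto
      have "1 / (y * g r) \<le> 1 / (x * g r)"
        using True xy r by (intro divide_left_mono mult_right_mono mult_pos_pos) auto
      then show "C_corr * ((1 / r) * (1 + 1 / (y * g r))) \<le> C_corr * ((1 / r) * (1 + 1 / (x * g r)))"
        using r C_corr_pos by (intro mult_left_mono add_left_mono) auto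
    qed
    then show ?thesis using True xy unfolding W_def by auto
  next
    case False
    then show ?thesis using xy by (auto simp: W_def)
  qed
qed

lemma W_le:
  assumes "0 < z" "0 < r" "r \<le> b"
  shows "W z \<le> ennreal (C_corr * ((1 / r) * (1 + 1 / (z * g r))))"
  using assms unfolding W_def by (auto intro: INF_lower)

lemma inverse_g_le_self:
  assumes "0 < D" "D \<le> b" shows "0 < 1 / g D" "1 / g D \<le> D"
  using tg[OF assms] g_pos[OF assms] by (auto simp: field_simps)

text \<open>Every competitor \<open>r\<close> in the infimum is bounded below at
  \<open>z = 1 / g D\<close>: for \<open>r \<le> D\<close> by the term \<open>1 / r\<close>, for
  \<open>r > D\<close> by the other term, through \<open>tg_quasi_anti\<close>.\<close>

lemma W_ge:
  assumes D: "0 < D" "D \<le> b" and z: "z \<le> 1 / g D"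
  shows "ennreal (c0 / D) \<le> W z"
proof -
  have "ennreal (c0 / D) \<le> W (1 / g D)"
  proof -
    have "ennreal (c0 / D) \<le> ennreal (C_corr * ((1 / r) * (1 + 1 / (1 / g D * g r))))" if r: "r \<in> {0<..b}" for r
    proof (rule ennreal_leI)
      have r': "0 < r" "r \<le> b" using r by auto
      have "c0 / D \<le> (1 / r) * (1 + g D / g r)"
      proof (cases "r \<le> D")
        case True
        have "c0 / D \<le> 1 / D" using c0_le_1 D by (simp add: divide_right_mono)
        also have "\<dots> \<le> 1 / r" using True r' by (simp add: frac_le)
        also have "\<dots> \<le> (1 / r) * (1 + g D / g r)"
          using r' g_pos[OF D] g_pos[OF r'] by (simp add: field_simps)
        finally show ?thesis .
      next
        case False
        have "c0 * (r * g r) \<le> D * g D" by (rule tg_quasi_anti) (use False D r' in auto)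
        then have "c0 / D \<le> (1 / r) * (g D / g r)"
          using D r' g_pos[OF D] g_pos[OF r'] by (simp add: field_simps)
        also have "\<dots> \<le> (1 / r) * (1 + g D / g r)" using r' by (intro mult_left_mono) auto
        finally show ?thesis .
      qed
      also have "\<dots> = 1 * ((1 / r) * (1 + 1 / (1 / g D * g r)))" by simp
      also have "\<dots> \<le> C_corr * ((1 / r) * (1 + 1 / (1 / g D * g r)))"
        using C_corr_pos r' g_pos[OF D] g_pos[OF r'] by (intro mult_right_mono) auto
      finally show "c0 / D \<le> C_corr * ((1 / r) * (1 + 1 / (1 / g D * g r)))" .
    qed
    moreover have "\<not> 1 / g D \<le> 0" "1 / g D \<le> b" using inverse_g_le_self[OF D] D by auto
    ultimately show ?thesis unfolding W_def by (simp only: if_False if_True) (auto intro!: INF_greatest)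
  qed
  also have "\<dots> \<le> W z" using W_antimono z by (simp add: antimono_def)
  finally show ?thesis .
qed

definition C_W :: real where "C_W = C_corr * (1 + 1 / c0) * (a / (a - 1))"

lemma C_W_pos: "0 < C_W"
  unfolding C_W_def using C_corr_pos c0 a by (simp add: add_pos_pos)

text \<open>The competitor \<open>r = D * (z * g D) powr (1 / a)\<close> is chosen so that
  \<open>growth\<close>, applied between \<open>r\<close> and \<open>D\<close>, yields
  \<open>g r \<ge> c0 / z\<close>; then the oscillatory term is at most \<open>1 / c0\<close> times
  \<open>1 / r\<close>.\<close>

lemma W_le_powr:
  assumes D: "0 < D" "D \<le> b" and z: "0 < z" "z \<le> 1 / g D"
  shows "W z \<le> ennreal (C_corr * (1 + 1 / c0) / D * (z * g D) powr (- 1 / a))"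
proof -
  define y where "y = z * g D"
  have y: "0 < y" "y \<le> 1" using z D g_pos[OF D] unfolding y_def by (auto simp: field_simps)
  define r where "r = D * y powr (1 / a)"
  have "y powr (1 / a) \<le> 1" using y a by (simp add: powr_le1)
  then have r: "0 < r" "r \<le> D" using D y unfolding r_def by (auto simp: mult_le_cancel_left1)
  have "c0 * (D / r) powr a * g D \<le> g r" using r D by (intro growth) auto
  moreover have "(D / r) powr a = 1 / y"
    using y D a unfolding r_def by (simp add: powr_divide powr_powr)
  ultimately have "c0 / z \<le> g r" using g_pos[OF D] z unfolding y_def by (simp add: field_simps)
  then have "1 / (z * g r) \<le> 1 / c0"
    using c0 z by (intro divide_left_mono) (auto simp: field_simps intro!: mult_pos_pos g_pos r order_trans[OF r(2) D(2)])
  then have "C_corr * ((1 / r) * (1 + 1 / (z * g r))) \<le> C_corr * ((1 / r) * (1 + 1 / c0))"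
    using C_corr_pos r by (intro mult_left_mono add_left_mono) auto
  also have "\<dots> = C_corr * (1 + 1 / c0) / D * y powr (- 1 / a)"
    unfolding r_def by (simp add: powr_minus field_simps)
  finally show ?thesis using W_le[OF z(1) r(1)] r D unfolding y_def
    by (meson ennreal_leI order_trans)
qed

text \<open>The exponent \<open>- 1 / a\<close> is above -1, so integrating the power law costs only
  the factor \<open>a / (a - 1)\<close> in \<open>C_W\<close>. Together with \<open>W_ge\<close>
  this says that the mean of \<open>W\<close> over the interval is comparable to its smallest value
  there.\<close>

lemma nn_integral_W_le:
  assumes D: "0 < D" "D \<le> b"
  shows "(\<integral>\<^sup>+z. W z * indicator {0..1 / g D} z \<partial>lborel) \<le> ennreal (C_W * (1 / g D) / D)"
proof -
  define s where "s = 1 / g D"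
  have s: "0 < s" using inverse_g_le_self[OF D] unfolding s_def by auto
  define M where "M = C_corr * (1 + 1 / c0) / D * g D powr (- 1 / a)"
  have "((\<lambda>z. z powr (- 1 / a)) has_integral (s powr (- 1 / a + 1) / (- 1 / a + 1))) {0..s}"
    using a s by (intro has_integral_powr_from_0) (auto simp: field_simps)
  then have "((\<lambda>z. M * z powr (- 1 / a)) has_integral M * (s powr (- 1 / a + 1) / (- 1 / a + 1))) {0..s}"
    by (rule has_integral_mult_right)
  moreover have "M * (s powr (- 1 / a + 1) / (- 1 / a + 1)) = C_W * s / D"
  proof -
    have "g D powr (- 1 / a) * s powr (- 1 / a + 1) = s"
    proof -
      have "s = g D powr (- 1)" using g_pos[OF D] by (simp add: s_def powr_minus_divide)
      then show ?thesis by (simp only: powr_powr powr_add[symmetric]) simp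
    qed
    moreover have "- 1 / a + 1 = (a - 1) / a" using a by (simp add: field_simps)
    ultimately show ?thesis unfolding M_def C_W_def by (simp add: mult_ac)
  qed
  ultimately have i: "((\<lambda>z. M * z powr (- 1 / a)) has_integral C_W * s / D) {0..s}" by simp
  have "(\<integral>\<^sup>+z. W z * indicator {0..s} z \<partial>lborel)
      \<le> (\<integral>\<^sup>+z. ennreal (M * z powr (- 1 / a)) * indicator {0..s} z \<partial>lborel)"
  proof (rule nn_integral_mono_AE)
    \<comment> \<open>The point 0 has to be discarded: there \<open>W\<close> is \<open>top\<close>,
      whereas \<open>0 powr (- 1 / a)\<close> is 0.\<close>
    have "AE z in lborel. z \<noteq> (0::real)" by (rule AE_lborel_singleton)
    then show "AE z in lborel. W z * indicator {0..s} z \<le> ennreal (M * z powr (- 1 / a)) * indicator {0..s} z"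
    proof eventually_elim
      case (elim z)
      show ?case
      proof (cases "z \<in> {0..s}")
        case True
        then have z: "0 < z" "z \<le> 1 / g D" using elim unfolding s_def by auto
        show ?thesis using W_le_powr[OF D z] True z g_pos[OF D]
          by (simp add: M_def powr_mult mult_ac)
      qed auto
    qed
  qed
  also have "\<dots> = ennreal (C_W * s / D)"
    using C_corr_pos c0 D by (intro nn_integral_has_integral_lebesgue' i) (auto simp: M_def)
  finally show ?thesis unfolding s_def .
qed

definition C_tot :: real where "C_tot = C_W + 2 * C_corr"

lemma nn_integral_W_total: "(\<integral>\<^sup>+z. W z * indicator {0..} z \<partial>lborel) \<le> ennreal C_tot"
proof -
  have [measurable]: "W \<in> borel_measurable borel" by (rule borel_measurable_antimono_ennreal[OF W_antimono])
  \<comment> \<open>Up to \<open>s\<close> the previous bound applies with \<open>D = b\<close>.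
    Beyond it the competitor \<open>r = b\<close> gives the constant \<open>2 * C_corr / b\<close>
    on an interval of length \<open>b\<close>.\<close>
  define s where "s = 1 / g b"
  have s: "0 < s" "s \<le> b" using inverse_g_le_self[OF b(1)] unfolding s_def by auto
  have "(\<integral>\<^sup>+z. W z * indicator {0..} z \<partial>lborel)
     \<le> (\<integral>\<^sup>+z. W z * indicator {0..s} z + ennreal (2 * C_corr / b) * indicator {0..b} z \<partial>lborel)"
  proof (rule nn_integral_mono)
    fix z
    have "W z \<le> ennreal (2 * C_corr / b)" if "s < z"
    proof -
      have "W z \<le> W s" using W_antimono that by (simp add: antimono_def)
      also have "\<dots> \<le> ennreal (C_corr * ((1 / b) * (1 + 1 / (s * g b))))" using s b by (intro W_le) auto
      also have "C_corr * ((1 / b) * (1 + 1 / (s * g b))) = 2 * C_corr / b"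
        unfolding s_def using g_pos[OF b(1)] by simp
      finally show ?thesis .
    qed
    moreover have "W z = 0" if "b < z" using that b unfolding W_def by auto
    ultimately show "W z * indicator {0..} z \<le> W z * indicator {0..s} z + ennreal (2 * C_corr / b) * indicator {0..b} z"
      using s by (cases "z \<le> s"; cases "z \<le> b") (auto simp: indicator_def)
  qed
  also have "\<dots> = (\<integral>\<^sup>+z. W z * indicator {0..s} z \<partial>lborel) + ennreal (2 * C_corr / b) * emeasure lborel {0..b}"
    by (subst nn_integral_add) (auto simp: nn_integral_cmult_indicator)
  also have "\<dots> \<le> ennreal C_W + ennreal (2 * C_corr)"
  proof (rule add_mono)
    have "C_W * s / b \<le> C_W" using C_W_pos s b by (simp add: field_simps)
    then show "(\<integral>\<^sup>+z. W z * indicator {0..s} z \<partial>lborel) \<le> ennreal C_W"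
      using nn_integral_W_le[OF b(1)] unfolding s_def by (meson ennreal_leI order_refl order_trans)
    show "ennreal (2 * C_corr / b) * emeasure lborel {0..b} \<le> ennreal (2 * C_corr)"
      using b C_corr_pos by (simp add: ennreal_mult[symmetric])
  qed
  also have "\<dots> = ennreal C_tot" using C_W_pos C_corr_pos by (simp add: C_tot_def)
  finally show ?thesis .
qed

lemma average_W_le:
  assumes D: "0 < D" "D \<le> b"
  shows "(\<integral>\<^sup>+u. W \<bar>d + 1 / g D * u\<bar> * indicator {0..1} u \<partial>lborel) \<le> ennreal (2 * C_W / D)"
proof -
  have s: "0 < 1 / g D" using inverse_g_le_self[OF D] by auto
  have "(\<integral>\<^sup>+u. W \<bar>d + 1 / g D * u\<bar> * indicator {0..1} u \<partial>lborel)
     \<le> ennreal (2 / (1 / g D)) * (\<integral>\<^sup>+v. W v * indicator {0..1 / g D} v \<partial>lborel)"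
    by (rule nn_integral_average_antimono_le[OF W_antimono s])
  also have "\<dots> \<le> ennreal (2 / (1 / g D)) * ennreal (C_W * (1 / g D) / D)"
    by (intro mult_left_mono nn_integral_W_le D) auto
  also have "\<dots> = ennreal (2 * C_W / D)"
    using g_pos[OF D] D C_W_pos by (subst ennreal_mult[symmetric]) auto
  finally show ?thesis .
qed

text \<open>The value 0 at \<open>D = 0\<close> leaves such points where they are, so one formula
  covers moved and unmoved mass. Points with \<open>D > b\<close> will carry no mass.\<close>

definition step :: "real \<Rightarrow> real" where
  "step D = (if 0 < D \<and> D \<le> b then 1 / g D else 0)"

lemma step_bounds: "0 \<le> step D" "0 \<le> D \<Longrightarrow> step D \<le> D"
proof -
  show "0 \<le> step D"
    using g_pos[of D] by (simp add: step_def less_imp_le)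
  show "step D \<le> D" if "0 \<le> D"
  proof (cases "0 < D \<and> D \<le> b")
    case True
    then show ?thesis using inverse_g_le_self(2)[of D] by (simp add: step_def)
  next
    case False
    then show ?thesis using that unfolding step_def by (simp only: if_False)
  qed
qed

lemma step_measurable [measurable]: "step \<in> borel_measurable borel"
proof -
  have "(\<lambda>D. indicator {0<..b} D *\<^sub>R (1 / g D)) \<in> borel_measurable borel"
    using g_pos by (intro borel_measurable_continuous_on_indicator continuous_intros cont_g) force+
  also have "(\<lambda>D. indicator {0<..b} D *\<^sub>R (1 / g D)) = step"
    by (auto simp: step_def fun_eq_iff indicator_def)
  finally show ?thesis .
qed

definition C_avg :: real where "C_avg = 1 + 2 * C_W / c0"

text \<open>If \<open>\<bar>d\<bar>\<close> is at least twice the spreading length, no shift brings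
  the argument below \<open>\<bar>d\<bar> / 2\<close>. Otherwise \<open>\<bar>d\<bar> / 2\<close> is
  shorter than \<open>1 / g D\<close>, so \<open>W_ge\<close> gives at least \<open>c0 / D\<close>
  on the right, against an average of at most \<open>2 * C_W / D\<close>.\<close>

lemma average_W_le_W:
  assumes D: "0 \<le> D" "D \<le> b"
  shows "(\<integral>\<^sup>+u. W \<bar>d + step D * u\<bar> * indicator {0..1} u \<partial>lborel) \<le> ennreal C_avg * W (\<bar>d\<bar> / 2)"
proof -
  have C: "1 \<le> C_avg" "2 * C_W / c0 \<le> C_avg" unfolding C_avg_def using C_W_pos c0 by auto
  have triv: ?thesis if "\<And>u. u \<in> {0..1} \<Longrightarrow> \<bar>d\<bar> / 2 \<le> \<bar>d + step D * u\<bar>"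
  proof -
    have "(\<integral>\<^sup>+u. W \<bar>d + step D * u\<bar> * indicator {0..1} u \<partial>lborel) \<le> (\<integral>\<^sup>+u. W (\<bar>d\<bar> / 2) * indicator {0..1} (u::real) \<partial>lborel)"
      using W_antimono that by (intro nn_integral_mono) (auto simp: indicator_def antimono_def)
    also have "\<dots> = 1 * W (\<bar>d\<bar> / 2)" by (simp add: nn_integral_cmult_indicator)
    also have "\<dots> \<le> ennreal C_avg * W (\<bar>d\<bar> / 2)"
      using C by (intro mult_right_mono) (auto simp: ennreal_1[symmetric] simp del: ennreal_1 intro!: ennreal_leI)
    finally show ?thesis .
  qed
  show ?thesis
  proof (cases "D = 0")
    case True
    then show ?thesis by (intro triv) (auto simp: step_def)
  next
    case False
    then have D': "0 < D" "D \<le> b" using D by auto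
    then have s: "step D = 1 / g D" "0 < step D" using inverse_g_le_self(1)[OF D'] D' by (simp_all add: step_def)
    show ?thesis
    proof (cases "2 * step D \<le> \<bar>d\<bar>")
      case True
      show ?thesis
      proof (rule triv)
        fix u :: real assume "u \<in> {0..1}"
        then have "0 \<le> step D * u" "step D * u \<le> step D"
          using s(2) by (simp_all only: atLeastAtMost_iff mult_nonneg_nonneg less_imp_le mult_left_le)
        then show "\<bar>d\<bar> / 2 \<le> \<bar>d + step D * u\<bar>" using True by linarith
      qed
    next
      case False
      have "(\<integral>\<^sup>+u. W \<bar>d + step D * u\<bar> * indicator {0..1} u \<partial>lborel) \<le> ennreal (2 * C_W / D)"
        unfolding s(1) by (rule average_W_le[OF D'])
      also have "\<dots> = ennreal (2 * C_W / c0) * ennreal (c0 / D)"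
        using C_W_pos c0 D' by (simp add: ennreal_mult[symmetric])
      also have "\<dots> \<le> ennreal C_avg * W (\<bar>d\<bar> / 2)"
        using C False s by (intro mult_mono ennreal_leI W_ge D') auto
      finally show ?thesis .
    qed
  qed
qed

end

section \<open>The truncated kernel\<close>

context singular_phase begin

text \<open>Cut off at \<open>b\<close> as well as at \<open>\<epsilon>\<close>, because the phase
  is controlled only up to \<open>b\<close>. The piece of the original kernel on
  \<open>(b, 1]\<close> is bounded and is treated later by absolute values.\<close>

definition kern :: "real \<Rightarrow> real \<Rightarrow> complex" where
  "kern \<epsilon> t = (if \<epsilon> \<le> t \<and> t \<le> b then exp (\<i> * complex_of_real (\<gamma> t)) / complex_of_real t else 0)"

lemma cmod_kern: "0 < \<epsilon> \<Longrightarrow> cmod (kern \<epsilon> t) = (if \<epsilon> \<le> t \<and> t \<le> b then 1 / t else 0)"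
  by (auto simp: kern_def norm_divide)

lemma cmod_kern_le: "0 < \<epsilon> \<Longrightarrow> cmod (kern \<epsilon> t) \<le> 1 / \<epsilon>"
  by (auto simp: cmod_kern frac_le)

lemma kern_measurable [measurable]:
  assumes "0 < \<epsilon>" shows "kern \<epsilon> \<in> borel_measurable borel"
proof -
  have "(\<lambda>t. indicator {\<epsilon>..b} t *\<^sub>R (exp (\<i> * complex_of_real (\<gamma> t)) / complex_of_real t)) \<in> borel_measurable borel"
    using assms by (intro borel_measurable_continuous_on_indicator continuous_intros continuous_on_subset[OF cont_\<gamma>]) auto
  also have "(\<lambda>t. indicator {\<epsilon>..b} t *\<^sub>R (exp (\<i> * complex_of_real (\<gamma> t)) / complex_of_real t)) = kern \<epsilon>"
    by (auto simp: kern_def fun_eq_iff indicator_def)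
  finally show ?thesis .
qed

lemma nn_integral_kern_le:
  assumes "0 < \<epsilon>" shows "(\<integral>\<^sup>+t. ennreal (cmod (kern \<epsilon> t)) \<partial>lborel) \<le> ennreal (b / \<epsilon>)"
proof -
  have "(\<integral>\<^sup>+t. ennreal (cmod (kern \<epsilon> t)) \<partial>lborel) \<le> (\<integral>\<^sup>+t. ennreal (1 / \<epsilon>) * indicator {0..b} t \<partial>lborel)"
    using assms by (intro nn_integral_mono) (auto simp: cmod_kern indicator_def frac_le intro!: ennreal_leI)
  also have "\<dots> = ennreal (b / \<epsilon>)"
    using b assms by (simp add: nn_integral_cmult_indicator ennreal_mult[symmetric])
  finally show ?thesis .
qed

text \<open>The two supports overlap exactly on \<open>{\<epsilon>..b - z}\<close>, where the
  oscillatory estimate holds for every \<open>r\<close>; passing to the infimum over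
  \<open>r\<close> gives \<open>W\<close>.\<close>

lemma kern_correlation:
  assumes \<epsilon>: "0 < \<epsilon>" and z: "0 < z"
  shows "ennreal (cmod (\<integral>x. kern \<epsilon> x * cnj (kern \<epsilon> (x + z)) \<partial>lborel)) \<le> W z"
proof -
  define f where "f t = exp (\<i> * complex_of_real (\<gamma> t - \<gamma> (t + z))) * complex_of_real (1 / (t * (t + z)))" for t
  have eq: "kern \<epsilon> x * cnj (kern \<epsilon> (x + z)) = indicator {\<epsilon>..b - z} x *\<^sub>R f x" for x
    unfolding kern_def f_def cis_conv_exp[symmetric]
    using \<epsilon> z by (auto simp: indicator_def cis_cnj cis_mult)
  show ?thesis
  proof (cases "\<epsilon> \<le> b - z")
    case True
    have "continuous_on {\<epsilon>..b - z} f" unfolding f_def using \<epsilon> z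
      by (intro continuous_intros continuous_on_subset[OF cont_\<gamma>]
          continuous_on_compose2[OF cont_\<gamma>, where f="\<lambda>t. t + z"]) auto
    then have "(\<integral>x. indicator {\<epsilon>..b - z} x *\<^sub>R f x \<partial>lborel) = integral {\<epsilon>..b - z} f"
      using set_borel_integral_eq_integral(2)[OF borel_integrable_atLeastAtMost']
      unfolding set_lebesgue_integral_def by blast
    then have "cmod (\<integral>x. kern \<epsilon> x * cnj (kern \<epsilon> (x + z)) \<partial>lborel) \<le> C_corr * ((1 / r) * (1 + 1 / (z * g r)))"
      if "r \<in> {0<..b}" for r
      unfolding eq f_def using \<epsilon> z True that by (simp only:) (rule oscillation_correlation, auto)
    moreover have "\<not> z \<le> 0" "z \<le> b" using z \<epsilon> True by auto
    ultimately show ?thesis unfolding W_def by (simp only: if_False if_True) (auto intro!: INF_greatest ennreal_leI)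
  next
    case False
    then have "indicator {\<epsilon>..b - z} x = (0::real)" for x by (auto simp: indicator_def)
    then show ?thesis unfolding eq by simp
  qed
qed

lemma kern_translates_inner:
  assumes \<epsilon>: "0 < \<epsilon>"
  shows "ennreal (cmod (\<integral>x. kern \<epsilon> (x - p) * cnj (kern \<epsilon> (x - q)) \<partial>lborel)) \<le> W \<bar>p - q\<bar>"
proof -
  have main: "ennreal (cmod (\<integral>x. kern \<epsilon> (x - p) * cnj (kern \<epsilon> (x - q)) \<partial>lborel)) \<le> W (p - q)" if "q < p" for p q
  proof -
    have "(\<integral>x. kern \<epsilon> (x - p) * cnj (kern \<epsilon> (x - q)) \<partial>lborel) = (\<integral>x. kern \<epsilon> x * cnj (kern \<epsilon> (x + (p - q))) \<partial>lborel)"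
      by (subst lborel_integral_real_affine[where c=1 and t=p]) (auto simp: algebra_simps)
    then show ?thesis using kern_correlation[OF \<epsilon>, of "p - q"] that by simp
  qed
  consider "p = q" | "q < p" | "p < q" by linarith
  then show ?thesis
  proof cases
    case 1
    \<comment> \<open>The diagonal case holds trivially because \<open>W 0 = top\<close>; the
      spreading makes the diagonal harmless later.\<close>
    then show ?thesis by (simp add: W_def)
  next
    case 2
    then show ?thesis using main[of q p] by simp
  next
    case 3
    have "(\<integral>x. kern \<epsilon> (x - p) * cnj (kern \<epsilon> (x - q)) \<partial>lborel)
       = cnj (\<integral>x. kern \<epsilon> (x - q) * cnj (kern \<epsilon> (x - p)) \<partial>lborel)"
      by (simp add: mult.commute flip: Bochner_Integration.integral_cnj)
    then show ?thesis using main[OF 3] 3 by simp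
  qed
qed

definition C_smooth :: real where "C_smooth = 3 + 1 / c0"

text \<open>The derivative of the kernel on \<open>{u..u + v}\<close> is at most
  \<open>g u / u + 1 / u^2\<close>. Multiplied by \<open>v \<le> 1 / g D\<close>, the first term
  becomes \<open>D / u^2\<close> times the quotient of \<open>u * g u\<close> by
  \<open>D * g D\<close>, which \<open>tg_quasi_anti\<close> bounds; the second is covered by
  \<open>1 / g D \<le> D\<close>.\<close>

lemma kern_increment_le:
  assumes \<epsilon>: "0 < \<epsilon>" and D: "0 < D" "D \<le> u" and v: "0 \<le> v" "v \<le> 1 / g D" and uv: "\<epsilon> \<le> u" "u + v \<le> b"
  shows "cmod (kern \<epsilon> (u + v) - kern \<epsilon> u) \<le> (1 + 1 / c0) * D / u^2"
proof -
  have u: "0 < u" "u \<le> b" using D uv v by auto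
  have Db: "D \<le> b" using D u by auto
  define k where "k t = exp (\<i> * complex_of_real (\<gamma> t)) / complex_of_real t" for t
  have der: "(k has_vector_derivative (exp (\<i> * complex_of_real (\<gamma> t)) * (\<i> * complex_of_real (g t)) / complex_of_real t
      - exp (\<i> * complex_of_real (\<gamma> t)) / (complex_of_real t)^2)) (at t within {u..u + v})" (is "(k has_vector_derivative ?k' t) _")
    if t: "t \<in> {u..u + v}" for t
  proof -
    have t0: "0 < t" "t \<le> b" using t u uv by auto
    have 1: "((\<lambda>t. \<i> * complex_of_real (\<gamma> t)) has_vector_derivative \<i> * complex_of_real (g t)) (at t within {u..u + v})"
      using has_field_derivative_at_within[OF d\<gamma>[OF t0]]
      by (intro has_vector_derivative_mult_right has_vector_derivative_of_real)
         (simp add: has_real_derivative_iff_has_vector_derivative)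
    have 2: "((\<lambda>t. exp (\<i> * complex_of_real (\<gamma> t))) has_vector_derivative
        \<i> * complex_of_real (g t) * exp (\<i> * complex_of_real (\<gamma> t))) (at t within {u..u + v})"
      using field_vector_diff_chain_within[OF 1 DERIV_subset[OF DERIV_exp]] by (simp add: o_def)
    have "((\<lambda>t. 1 / t) has_real_derivative - (1 / t^2)) (at t within {u..u + v})"
      using t0 by (auto intro!: derivative_eq_intros simp: power2_eq_square)
    then have 3: "((\<lambda>t. complex_of_real (1 / t)) has_vector_derivative complex_of_real (- (1 / t^2))) (at t within {u..u + v})"
      by (intro has_vector_derivative_of_real) (simp add: has_real_derivative_iff_has_vector_derivative)
    show ?thesis
      using has_vector_derivative_mult[OF 2 3] unfolding k_def
      by (simp add: field_simps power2_eq_square)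
  qed
  have bound: "norm (?k' t) \<le> g u / u + 1 / u^2" if t: "t \<in> {u..u + v}" for t
  proof -
    have t0: "0 < t" "u \<le> t" "t \<le> b" using t u uv by auto
    have "norm (?k' t) \<le> g t / t + 1 / t^2"
      using t0 g_pos[of t] by (intro order_trans[OF norm_triangle_ineq4]) (simp add: norm_mult norm_divide norm_power)
    also have "\<dots> \<le> g u / u + 1 / u^2"
      using t0 u g_pos[of t] g_anti[of u t] by (intro add_mono frac_le power_mono) auto
    finally show ?thesis .
  qed
  have "(?k' has_integral (k (u + v) - k u)) {u..u + v}"
    using der v by (intro fundamental_theorem_of_calculus) auto
  then have "norm (k (u + v) - k u) \<le> (g u / u + 1 / u^2) * measure lborel {u..u + v}"
    using bound u g_pos[OF u] by (intro has_integral_bound_real[where S="{}"]) (auto simp: less_imp_le)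
  then have "norm (k (u + v) - k u) \<le> (g u / u + 1 / u^2) * v" using v by simp
  also have "\<dots> \<le> (g u / u + 1 / u^2) * (1 / g D)"
    using v u g_pos[OF u] by (intro mult_left_mono) auto
  also have "\<dots> = (u * g u) / (D * g D) * (D / u^2) + (1 / g D) / u^2"
    using D u g_pos[OF D(1) Db] by (simp add: field_simps power2_eq_square)
  also have "\<dots> \<le> 1 / c0 * (D / u^2) + D / u^2"
  proof (intro add_mono mult_right_mono divide_right_mono)
    show "(u * g u) / (D * g D) \<le> 1 / c0"
      using tg_quasi_anti[OF D(1,2) u(2)] c0 D g_pos[OF D(1) Db] by (simp add: field_simps)
    show "1 / g D \<le> D" using inverse_g_le_self[OF D(1) Db] by auto
  qed (use D in auto)
  also have "\<dots> = (1 + 1 / c0) * D / u^2" by (simp add: algebra_simps add_divide_distrib)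
  finally show ?thesis using uv v by (simp add: kern_def k_def)
qed

text \<open>A Hormander condition in which the admissible shift is only \<open>1 / g D\<close>. The
  interior increments integrate to \<open>1 + 1 / c0\<close>. The jumps of the kernel at
  \<open>\<epsilon>\<close> and at \<open>b\<close> contribute 1 each, being of height at most
  \<open>1 / D\<close> on a set of width \<open>v \<le> D\<close>; this explains the 3 in
  \<open>C_smooth\<close>.\<close>

lemma kern_smoothness:
  assumes \<epsilon>: "0 < \<epsilon>" and D: "0 < D" "D \<le> b" and v: "0 \<le> v" "v \<le> 1 / g D"
  shows "(\<integral>\<^sup>+u. ennreal (cmod (kern \<epsilon> (u + v) - kern \<epsilon> u)) * indicator {u. D \<le> \<bar>u\<bar>} u \<partial>lborel) \<le> ennreal C_smooth"
proof -
  have vD: "v \<le> D" using v inverse_g_le_self[OF D] by simp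
  have i1: "(\<integral>\<^sup>+u. ennreal ((1 + 1 / c0) * D / u^2) * indicator {D..} u \<partial>lborel) = ennreal (0 - (- ((1 + 1 / c0) * D / D)))"
  proof (rule nn_integral_FTC_atLeast[where F="\<lambda>u. - ((1 + 1 / c0) * D / u)"])
    show "((\<lambda>u. - ((1 + 1 / c0) * D / u)) \<longlongrightarrow> 0) at_top"
      using tendsto_minus[OF tendsto_divide_0[OF tendsto_const filterlim_at_top_imp_at_infinity[OF filterlim_ident]],
        of "(1 + 1 / c0) * D"] by simp
    fix u assume "D \<le> u"
    then show "((\<lambda>u. - ((1 + 1 / c0) * D / u)) has_real_derivative (1 + 1 / c0) * D / u^2) (at u)"
      using D by (auto intro!: derivative_eq_intros simp: power2_eq_square)
    show "0 \<le> (1 + 1 / c0) * D / u^2" using c0 D by simp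
  qed simp
  have L1: "P \<le> X \<Longrightarrow> P \<le> X + (Y + Z)" and L2: "P \<le> Y \<Longrightarrow> P \<le> X + (Y + Z)" and L3: "P \<le> Z \<Longrightarrow> P \<le> X + (Y + Z)"
    for P X Y Z :: ennreal
    by (simp_all add: add_increasing add_increasing2)
  have i2: "(\<integral>\<^sup>+u. ennreal (1 / D) * indicator {e - v..e} u \<partial>lborel) \<le> ennreal 1" for e
    using v D vD by (simp add: nn_integral_cmult_indicator ennreal_mult[symmetric] del: ennreal_1)
  have "(\<integral>\<^sup>+u. ennreal (cmod (kern \<epsilon> (u + v) - kern \<epsilon> u)) * indicator {u. D \<le> \<bar>u\<bar>} u \<partial>lborel)
     \<le> (\<integral>\<^sup>+u. ennreal ((1 + 1 / c0) * D / u^2) * indicator {D..} u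
            + (ennreal (1 / D) * indicator {\<epsilon> - v..\<epsilon>} u + ennreal (1 / D) * indicator {b - v..b} u) \<partial>lborel)"
  proof (rule nn_integral_mono)
    fix u
    show "ennreal (cmod (kern \<epsilon> (u + v) - kern \<epsilon> u)) * indicator {u. D \<le> \<bar>u\<bar>} u
       \<le> ennreal ((1 + 1 / c0) * D / u^2) * indicator {D..} u
            + (ennreal (1 / D) * indicator {\<epsilon> - v..\<epsilon>} u + ennreal (1 / D) * indicator {b - v..b} u)"
    proof (cases "D \<le> \<bar>u\<bar>")
      case True
      show ?thesis
      proof (cases "0 \<le> u")
        case False
        then have "kern \<epsilon> (u + v) = 0" "kern \<epsilon> u = 0" using True vD \<epsilon> by (auto simp: kern_def)
        then show ?thesis by simp
      next
        case u0: True
        then have Du: "D \<le> u" using True by auto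
        consider "\<epsilon> \<le> u" "u + v \<le> b" | "u < \<epsilon>" | "\<epsilon> \<le> u" "b < u + v" by linarith
        then show ?thesis
        proof cases
          case 1
          have "ennreal (cmod (kern \<epsilon> (u + v) - kern \<epsilon> u)) \<le> ennreal ((1 + 1 / c0) * D / u^2)"
            using kern_increment_le[OF \<epsilon> D(1) Du v 1] by (rule ennreal_leI)
          then show ?thesis using True Du by (intro L1) simp
        next
          case 2
          then have "kern \<epsilon> u = 0" by (simp add: kern_def)
          moreover have "cmod (kern \<epsilon> (u + v)) \<le> 1 / D * indicator {\<epsilon> - v..\<epsilon>} u"
            using 2 Du v D \<epsilon> by (auto simp: cmod_kern indicator_def frac_le)
          ultimately have "ennreal (cmod (kern \<epsilon> (u + v) - kern \<epsilon> u)) \<le> ennreal (1 / D * indicator {\<epsilon> - v..\<epsilon>} u)"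
            by (intro ennreal_leI) simp
          also have "\<dots> = ennreal (1 / D) * indicator {\<epsilon> - v..\<epsilon>} u"
            by (simp add: indicator_def)
          finally show ?thesis using True by (intro L2) simp
        next
          case 3
          then have "kern \<epsilon> (u + v) = 0" by (simp add: kern_def)
          moreover have "cmod (kern \<epsilon> u) \<le> 1 / D * indicator {b - v..b} u"
            using 3 Du v D \<epsilon> by (auto simp: cmod_kern indicator_def frac_le)
          ultimately have "ennreal (cmod (kern \<epsilon> (u + v) - kern \<epsilon> u)) \<le> ennreal (1 / D * indicator {b - v..b} u)"
            by (intro ennreal_leI) simp
          also have "\<dots> = ennreal (1 / D) * indicator {b - v..b} u"
            by (simp add: indicator_def)
          finally show ?thesis using True by (intro L3) simp
        qed
      qed
    qed auto
  qed
  also have "\<dots> = (\<integral>\<^sup>+u. ennreal ((1 + 1 / c0) * D / u^2) * indicator {D..} u \<partial>lborel)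
      + ((\<integral>\<^sup>+u. ennreal (1 / D) * indicator {\<epsilon> - v..\<epsilon>} u \<partial>lborel) + (\<integral>\<^sup>+u. ennreal (1 / D) * indicator {b - v..b} u \<partial>lborel))"
    by (subst nn_integral_add, simp, simp, subst nn_integral_add) simp_all
  also have "\<dots> \<le> ennreal (1 + 1 / c0) + (ennreal 1 + ennreal 1)"
    unfolding i1 using D by (intro add_mono i2) (auto intro!: ennreal_leI)
  also have "\<dots> = ennreal C_smooth"
  proof -
    have "ennreal ((1 + 1 / c0) + (1 + 1)) = ennreal (1 + 1 / c0) + ennreal (1 + 1)"
      using c0 by (intro ennreal_plus) auto
    moreover have "ennreal (1 + 1) = ennreal 1 + ennreal 1" by (intro ennreal_plus) auto
    ultimately show ?thesis by (simp add: C_smooth_def del: ennreal_1)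
  qed
  finally show ?thesis .
qed

end

section \<open>Superpositions of translates and the maximal function\<close>

lemma nn_integral_lborel_translate:
  fixes h :: "real \<Rightarrow> ennreal"
  assumes [measurable]: "h \<in> borel_measurable borel"
  shows "(\<integral>\<^sup>+x. h (x - p) \<partial>lborel) = (\<integral>\<^sup>+x. h x \<partial>lborel)"
  by (subst (2) nn_integral_real_affine[where c=1 and t="-p"]) auto

lemma norm_lebesgue_integral_le:
  fixes f :: "'a \<Rightarrow> 'b::{banach, second_countable_topology}"
  assumes "integrable M f" "integrable M g" "\<And>x. norm (f x) \<le> g x"
  shows "norm (integral\<^sup>L M f) \<le> integral\<^sup>L M g"
  by (rule order_trans[OF integral_norm_bound integral_mono]) (use assms in auto)

text \<open>Expanding the square and integrating in \<open>x\<close> first leaves a double integral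
  of correlations, which a bound on the potential of \<open>F\<close> with respect to
  \<open>w\<close> turns into \<open>B\<close> times the L1 norm. The finite mass of
  \<open>K\<close> and its bound \<open>M\<close> justify the interchanges and do not enter the
  conclusion.\<close>

lemma nn_integral_superposition_L2:
  fixes K :: "real \<Rightarrow> complex" and \<phi> :: "'a \<Rightarrow> real" and F :: "'a \<Rightarrow> complex"
    and w :: "real \<Rightarrow> real \<Rightarrow> ennreal"
  assumes N: "sigma_finite_measure N" and K[measurable]: "K \<in> borel_measurable borel"
    and \<phi>[measurable]: "\<phi> \<in> borel_measurable N" and F: "integrable N F"
    and Kint: "(\<integral>\<^sup>+x. ennreal (cmod (K x)) \<partial>lborel) < \<infinity>" and Kbd: "\<And>x. cmod (K x) \<le> M"
    and inner: "\<And>p q. ennreal (cmod (\<integral>x. K (x - p) * cnj (K (x - q)) \<partial>lborel)) \<le> w p q"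
    and B: "0 \<le> B" "\<And>\<eta>. (\<integral>\<^sup>+\<eta>'. ennreal (cmod (F \<eta>')) * w (\<phi> \<eta>) (\<phi> \<eta>') \<partial>N) \<le> ennreal B"
  shows "(\<integral>\<^sup>+x. ennreal ((cmod (\<integral>\<eta>. F \<eta> * K (x - \<phi> \<eta>) \<partial>N))^2) \<partial>lborel) \<le> ennreal (B * (\<integral>\<eta>. cmod (F \<eta>) \<partial>N))"
proof -
  interpret N: sigma_finite_measure N by fact
  interpret NL: pair_sigma_finite N lborel ..
  have [measurable]: "F \<in> borel_measurable N" using F by auto
  have [measurable]: "cnj \<in> borel_measurable borel"
    by (intro borel_measurable_continuous_onI continuous_intros)
  define G where "G x = (\<integral>\<eta>. F \<eta> * K (x - \<phi> \<eta>) \<partial>N)" for x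
  have [measurable]: "G \<in> borel_measurable borel" unfolding G_def
    by (intro N.borel_measurable_lebesgue_integral) measurable
  define S where "S = (\<integral>\<eta>. cmod (F \<eta>) \<partial>N)"
  have S: "0 \<le> S" unfolding S_def by simp
  have M: "0 \<le> M" using Kbd[of 0] norm_ge_zero[of "K 0"] by linarith
  \<comment> \<open>A crude bound that serves convergence: with \<open>G\<close> bounded, the
    product \<open>F * K * cnj G\<close> is jointly integrable, and hence \<open>G\<close> is square
    integrable before any quantitative estimate.\<close>
  have Gbd: "cmod (G x) \<le> M * S" for x
  proof -
    have i: "integrable N (\<lambda>\<eta>. M * cmod (F \<eta>))" using F by auto
    have "cmod (G x) \<le> (\<integral>\<eta>. M * cmod (F \<eta>) \<partial>N)"
      unfolding G_def
    proof (rule norm_lebesgue_integral_le[OF _ i])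
      show le: "cmod (F \<eta> * K (x - \<phi> \<eta>)) \<le> M * cmod (F \<eta>)" for \<eta>
        using Kbd[of "x - \<phi> \<eta>"] by (simp add: norm_mult mult.commute[of M] mult_left_mono)
      show "integrable N (\<lambda>\<eta>. F \<eta> * K (x - \<phi> \<eta>))"
        using le M by (intro Bochner_Integration.integrable_bound[OF i]) auto
    qed
    then show ?thesis unfolding S_def by simp
  qed
  have FK: "integrable (N \<Otimes>\<^sub>M lborel) (\<lambda>(\<eta>, x). F \<eta> * K (x - \<phi> \<eta>))"
  proof (rule integrableI_bounded)
    have "(\<integral>\<^sup>+p. ennreal (norm (case p of (\<eta>, x) \<Rightarrow> F \<eta> * K (x - \<phi> \<eta>))) \<partial>(N \<Otimes>\<^sub>M lborel))
       = (\<integral>\<^sup>+\<eta>. (\<integral>\<^sup>+x. ennreal (cmod (F \<eta>)) * ennreal (cmod (K (x - \<phi> \<eta>))) \<partial>lborel) \<partial>N)"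
      by (subst lborel.nn_integral_fst[symmetric]) (auto simp: norm_mult ennreal_mult)
    also have "\<dots> = (\<integral>\<^sup>+\<eta>. ennreal (cmod (F \<eta>)) * (\<integral>\<^sup>+x. ennreal (cmod (K x)) \<partial>lborel) \<partial>N)"
      by (subst nn_integral_cmult)
         (auto simp: nn_integral_lborel_translate[where h="\<lambda>x. ennreal (cmod (K x))"])
    also have "\<dots> = (\<integral>\<^sup>+\<eta>. ennreal (cmod (F \<eta>)) \<partial>N) * (\<integral>\<^sup>+x. ennreal (cmod (K x)) \<partial>lborel)"
      by (subst nn_integral_multc) auto
    also have "\<dots> < \<infinity>"
      using Kint F by (auto simp: integrable_iff_bounded ennreal_mult_less_top)
    finally show "(\<integral>\<^sup>+p. ennreal (norm (case p of (\<eta>, x) \<Rightarrow> F \<eta> * K (x - \<phi> \<eta>))) \<partial>(N \<Otimes>\<^sub>M lborel)) < \<infinity>" .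
  qed measurable
  have bounded_mult: "integrable (N \<Otimes>\<^sub>M lborel) (\<lambda>(\<eta>, x). F \<eta> * K (x - \<phi> \<eta>) * H x)"
    if [measurable]: "H \<in> borel_measurable borel" and H: "\<And>x. cmod (H x) \<le> R" for H R
  proof (rule Bochner_Integration.integrable_bound[OF integrable_mult_right[OF integrable_norm[OF FK], of R]])
    have "0 \<le> R" using H[of 0] norm_ge_zero[of "H 0"] by linarith
    then show "AE p in N \<Otimes>\<^sub>M lborel. norm (case p of (\<eta>, x) \<Rightarrow> F \<eta> * K (x - \<phi> \<eta>) * H x)
         \<le> norm (R * norm (case p of (\<eta>, x) \<Rightarrow> F \<eta> * K (x - \<phi> \<eta>)))"
      using H by (intro AE_I2) (auto simp: norm_mult mult.commute[of R] intro!: mult_left_mono)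
  qed measurable
  define J where "J \<eta> = (\<integral>x. K (x - \<phi> \<eta>) * cnj (G x) \<partial>lborel)" for \<eta>
  \<comment> \<open>\<open>J \<eta>\<close> pairs one translate of \<open>K\<close> with
    \<open>G\<close>. Fubini writes it as a superposition of correlations with that translate, so
    the potential hypothesis bounds it pointwise.\<close>
  have Jbd: "cmod (J \<eta>) \<le> B" for \<eta>
  proof -
    define H where "H x = cnj (K (x - \<phi> \<eta>))" for x
    have [measurable]: "H \<in> borel_measurable borel" unfolding H_def by measurable
    have "J \<eta> = cnj (\<integral>x. G x * H x \<partial>lborel)"
      unfolding J_def H_def by (simp add: mult.commute flip: Bochner_Integration.integral_cnj)
    also have "(\<integral>x. G x * H x \<partial>lborel) = (\<integral>x. (\<integral>\<eta>'. F \<eta>' * K (x - \<phi> \<eta>') * H x \<partial>N) \<partial>lborel)"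
      unfolding G_def by simp
    also have "\<dots> = (\<integral>\<eta>'. (\<integral>x. F \<eta>' * K (x - \<phi> \<eta>') * H x \<partial>lborel) \<partial>N)"
      using Kbd by (intro NL.Fubini_integral bounded_mult[of H M]) (auto simp: H_def)
    finally have eq: "J \<eta> = cnj (\<integral>\<eta>'. (\<integral>x. F \<eta>' * K (x - \<phi> \<eta>') * H x \<partial>lborel) \<partial>N)" .
    have int: "integrable N (\<lambda>\<eta>'. \<integral>x. F \<eta>' * K (x - \<phi> \<eta>') * H x \<partial>lborel)"
      using Kbd by (intro NL.integrable_fst bounded_mult[of H M]) (auto simp: H_def)
    have "ennreal (cmod (J \<eta>)) \<le> (\<integral>\<^sup>+\<eta>'. ennreal (cmod (\<integral>x. F \<eta>' * K (x - \<phi> \<eta>') * H x \<partial>lborel)) \<partial>N)"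
      unfolding eq complex_mod_cnj by (rule integral_norm_bound_ennreal[OF int])
    also have "\<dots> \<le> (\<integral>\<^sup>+\<eta>'. ennreal (cmod (F \<eta>')) * w (\<phi> \<eta>) (\<phi> \<eta>') \<partial>N)"
    proof (rule nn_integral_mono)
      fix \<eta>'
      have "(\<integral>x. F \<eta>' * K (x - \<phi> \<eta>') * H x \<partial>lborel) = F \<eta>' * cnj (\<integral>x. K (x - \<phi> \<eta>) * cnj (K (x - \<phi> \<eta>')) \<partial>lborel)"
      proof -
        have "(\<integral>x. F \<eta>' * K (x - \<phi> \<eta>') * H x \<partial>lborel) = F \<eta>' * (\<integral>x. K (x - \<phi> \<eta>') * H x \<partial>lborel)"
          by (simp add: mult.assoc)
        also have "(\<integral>x. K (x - \<phi> \<eta>') * H x \<partial>lborel) = cnj (\<integral>x. K (x - \<phi> \<eta>) * cnj (K (x - \<phi> \<eta>')) \<partial>lborel)"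
          by (simp add: H_def mult.commute flip: Bochner_Integration.integral_cnj)
        finally show ?thesis .
      qed
      then show "ennreal (cmod (\<integral>x. F \<eta>' * K (x - \<phi> \<eta>') * H x \<partial>lborel)) \<le> ennreal (cmod (F \<eta>')) * w (\<phi> \<eta>) (\<phi> \<eta>')"
        using inner[of "\<phi> \<eta>" "\<phi> \<eta>'"] by (simp add: norm_mult ennreal_mult mult_left_mono)
    qed
    also have "\<dots> \<le> ennreal B" by (rule B)
    finally show ?thesis using B(1) by simp
  qed
  have FKG: "integrable (N \<Otimes>\<^sub>M lborel) (\<lambda>(\<eta>, x). F \<eta> * K (x - \<phi> \<eta>) * cnj (G x))"
    using Gbd by (intro bounded_mult[of "\<lambda>x. cnj (G x)"]) auto
  have GG: "(\<integral>\<eta>. F \<eta> * K (x - \<phi> \<eta>) * cnj (G x) \<partial>N) = complex_of_real ((cmod (G x))^2)" for x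
    unfolding G_def[symmetric] using complex_norm_square[of "G x"] by (simp add: G_def[symmetric])
  have int2: "integrable lborel (\<lambda>x. complex_of_real ((cmod (G x))^2))"
    using NL.integrable_snd[OF FKG] unfolding GG .
  then have int3: "integrable lborel (\<lambda>x. (cmod (G x))^2)"
    by (simp only: complex_of_real_integrable_eq)
  have "(\<integral>x. (cmod (G x))^2 \<partial>lborel) = cmod (\<integral>x. complex_of_real ((cmod (G x))^2) \<partial>lborel)"
    by (simp del: of_real_power)
  also have "(\<integral>x. complex_of_real ((cmod (G x))^2) \<partial>lborel) = (\<integral>\<eta>. (\<integral>x. F \<eta> * K (x - \<phi> \<eta>) * cnj (G x) \<partial>lborel) \<partial>N)"
    unfolding GG[symmetric] by (rule NL.Fubini_integral[OF FKG])
  also have "\<dots> = (\<integral>\<eta>. F \<eta> * J \<eta> \<partial>N)"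
    unfolding J_def by (simp add: mult.assoc)
  also have "cmod \<dots> \<le> (\<integral>\<eta>. B * cmod (F \<eta>) \<partial>N)"
  proof (rule norm_lebesgue_integral_le)
    show i: "integrable N (\<lambda>\<eta>. B * cmod (F \<eta>))" using F by auto
    have [measurable]: "J \<in> borel_measurable N" unfolding J_def
      by (intro lborel.borel_measurable_lebesgue_integral) measurable
    show "integrable N (\<lambda>\<eta>. F \<eta> * J \<eta>)"
      using Jbd B(1) by (intro Bochner_Integration.integrable_bound[OF i])
        (auto simp: norm_mult mult.commute[of B] mult_left_mono)
    show "cmod (F \<eta> * J \<eta>) \<le> B * cmod (F \<eta>)" for \<eta>
      using Jbd[of \<eta>] by (simp add: norm_mult mult.commute[of B] mult_left_mono)
  qed
  finally have le: "(\<integral>x. (cmod (G x))^2 \<partial>lborel) \<le> B * S" unfolding S_def by simp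
  have "(\<integral>\<^sup>+x. ennreal ((cmod (G x))^2) \<partial>lborel) = ennreal (\<integral>x. (cmod (G x))^2 \<partial>lborel)"
    by (intro nn_integral_eq_integral int3) auto
  with le show ?thesis unfolding G_def S_def by (simp add: ennreal_leI)
qed

section \<open>An exceptional set for the maximal function\<close>

lemma emeasure_UN_le_nn_integral_count_space:
  assumes C: "countable C" and A: "\<And>i. i \<in> C \<Longrightarrow> A i \<in> sets M"
  shows "emeasure M (\<Union>i\<in>C. A i) \<le> (\<integral>\<^sup>+i. emeasure M (A i) \<partial>count_space C)"
proof -
  have m: "(\<Union>i\<in>C. A i) \<in> sets M" using C A by auto
  have "emeasure M (\<Union>i\<in>C. A i) = (\<integral>\<^sup>+x. indicator (\<Union>i\<in>C. A i) x \<partial>M)"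
    using m by simp
  also have "\<dots> \<le> (\<integral>\<^sup>+x. (\<integral>\<^sup>+i. indicator (A i) x \<partial>count_space C) \<partial>M)"
  proof (rule nn_integral_mono)
    fix x
    show "indicator (\<Union>i\<in>C. A i) x \<le> (\<integral>\<^sup>+i. indicator (A i) x \<partial>count_space C :: ennreal)"
    proof (cases "x \<in> (\<Union>i\<in>C. A i)")
      case True
      then obtain i where i: "i \<in> C" "x \<in> A i" by auto
      have "(1::ennreal) \<le> (\<integral>\<^sup>+i. indicator (A i) x \<partial>count_space C)"
        using nn_integral_ge_point[of i C "\<lambda>i. indicator (A i) x"] i by auto
      then show ?thesis using True by simp
    qed auto
  qed
  also have "\<dots> = (\<integral>\<^sup>+i. (\<integral>\<^sup>+x. indicator (A i) x \<partial>M) \<partial>count_space C)"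
    using A by (intro nn_integral_count_space_nn_integral C) auto
  also have "\<dots> = (\<integral>\<^sup>+i. emeasure M (A i) \<partial>count_space C)"
    using A by (intro nn_integral_cong) auto
  finally show ?thesis .
qed

text \<open>The balls violating the mass bound have radius at most the L1 norm over
  \<open>\<alpha>\<close>, so the Vitali lemma selects countably many disjoint ones whose fivefold
  dilates cover all their centres. A dilate has length \<open>10 * r\<close>, less than
  \<open>10 / \<alpha>\<close> times the mass of its ball, and disjointness lets these masses be
  summed. As a countable union of balls, \<open>E\<close> is Borel.\<close>

lemma maximal_exceptional_set:
  fixes f :: "real \<Rightarrow> complex"
  assumes f: "integrable lborel f" and \<alpha>: "0 < \<alpha>"
  obtains E where "E \<in> sets borel" "emeasure lborel E \<le> ennreal (10 / \<alpha> * (\<integral>x. cmod (f x) \<partial>lborel))"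
    "\<And>p r. p \<notin> E \<Longrightarrow> 0 < r \<Longrightarrow>
       (\<integral>\<^sup>+y. ennreal (cmod (f y)) * indicator (cball p r) y \<partial>lborel) \<le> ennreal (\<alpha> * r)"
proof -
  define mass where "mass p r = (\<integral>\<^sup>+y. ennreal (cmod (f y)) * indicator (cball p r) y \<partial>lborel)" for p r :: real
  define S where "S = (\<integral>x. cmod (f x) \<partial>lborel)"
  have [measurable]: "f \<in> borel_measurable borel" using f by auto
  have tot: "(\<integral>\<^sup>+x. ennreal (cmod (f x)) \<partial>lborel) = ennreal S"
    unfolding S_def using f by (intro nn_integral_eq_integral) auto
  define X where "X = {(p, r). 0 < r \<and> ennreal (\<alpha> * r) < mass p r}"
  have rb: "0 < snd i \<and> snd i \<le> S / \<alpha>" if "i \<in> X" for i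
  proof -
    obtain p r where i: "i = (p, r)" by (cases i)
    have "ennreal (\<alpha> * r) < mass p r" using that unfolding X_def i by auto
    also have "\<dots> \<le> ennreal S"
      unfolding mass_def tot[symmetric] by (intro nn_integral_mono) (auto simp: indicator_def)
    finally have "\<alpha> * r < S" using \<alpha> that unfolding X_def i by (auto simp: ennreal_less_iff)
    then show ?thesis using \<alpha> that unfolding X_def i by (auto simp: field_simps)
  qed
  obtain C where C: "countable C" "C \<subseteq> X"
    "pairwise (\<lambda>i j. disjnt (cball (fst i) (snd i)) (cball (fst j) (snd j))) C"
    "fst ` X \<subseteq> (\<Union>i\<in>C. cball (fst i) (5 * snd i))"
  proof (rule Vitali_covering_lemma_cballs[where S="fst ` X" and K=X and a=fst and r=snd and B="S / \<alpha>"])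
    show "fst ` X \<subseteq> (\<Union>i\<in>X. cball (fst i) (snd i))"
      using rb by (force simp: less_imp_le)
  qed (use rb in auto)
  define E where "E = (\<Union>i\<in>C. cball (fst i) (5 * snd i))"
  have "emeasure lborel E \<le> (\<integral>\<^sup>+i. emeasure lborel (cball (fst i) (5 * snd i)) \<partial>count_space C)"
    unfolding E_def by (intro emeasure_UN_le_nn_integral_count_space C) auto
  also have "\<dots> \<le> (\<integral>\<^sup>+i. ennreal (10 / \<alpha>) * mass (fst i) (snd i) \<partial>count_space C)"
  proof (rule nn_integral_mono)
    fix i assume "i \<in> space (count_space C)"
    then have i: "i \<in> X" using C by auto
    then have p: "0 < snd i" using rb by auto
    have "emeasure lborel (cball (fst i) (5 * snd i)) = ennreal (10 / \<alpha>) * ennreal (\<alpha> * snd i)"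
      using p \<alpha> by (simp add: cball_eq_atLeastAtMost ennreal_mult[symmetric])
    also have "\<dots> \<le> ennreal (10 / \<alpha>) * mass (fst i) (snd i)"
      using i unfolding X_def by (intro mult_left_mono) auto
    finally show "emeasure lborel (cball (fst i) (5 * snd i)) \<le> ennreal (10 / \<alpha>) * mass (fst i) (snd i)" .
  qed
  also have "\<dots> = ennreal (10 / \<alpha>) * (\<integral>\<^sup>+i. mass (fst i) (snd i) \<partial>count_space C)"
    by (intro nn_integral_cmult) auto
  also have "(\<integral>\<^sup>+i. mass (fst i) (snd i) \<partial>count_space C)
     = (\<integral>\<^sup>+i. emeasure (density lborel (\<lambda>y. ennreal (cmod (f y)))) (cball (fst i) (snd i)) \<partial>count_space C)"
    unfolding mass_def by (intro nn_integral_cong) (simp add: emeasure_density)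
  also have "\<dots> = emeasure (density lborel (\<lambda>y. ennreal (cmod (f y)))) (\<Union>i\<in>C. cball (fst i) (snd i))"
    using C(3) by (intro emeasure_UN_countable[symmetric] C(1))
      (auto simp: disjoint_family_on_def pairwise_def disjnt_def)
  also have "\<dots> \<le> ennreal S"
    unfolding tot[symmetric] using C(1)
    by (subst emeasure_density) (auto intro!: nn_integral_mono simp: indicator_def)
  finally have "emeasure lborel E \<le> ennreal (10 / \<alpha>) * ennreal S" by (simp add: mult_left_mono)
  also have "\<dots> = ennreal (10 / \<alpha> * S)" using \<alpha> by (intro ennreal_mult'[symmetric]) simp
  finally have 1: "emeasure lborel E \<le> ennreal (10 / \<alpha> * S)" .
  have 2: "mass p r \<le> ennreal (\<alpha> * r)" if "p \<notin> E" "0 < r" for p r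
  proof (rule ccontr)
    assume "\<not> ?thesis"
    then have "(p, r) \<in> X" using that unfolding X_def by auto
    then have "p \<in> fst ` X" by force
    from subsetD[OF C(4) this] show False using that unfolding E_def by auto
  qed
  have 3: "E \<in> sets borel" unfolding E_def using C(1) by auto
  show thesis using that[OF 3 1[unfolded S_def] 2[unfolded mass_def]] .
qed

section \<open>The weak type estimate\<close>

context singular_phase begin

text \<open>The first term comes from mass near the observation point, \<open>2 * C_W\<close> times
  the factor 4 lost in recentring balls; the second from far mass, 8 times the same 4.\<close>

definition C_L2 :: real where "C_L2 = 8 * C_W + 32 * C_avg * C_tot"

text \<open>The 10 is the measure of the exceptional set; 2 and 4 are the Chebyshev factors at level
  \<open>\<alpha> / 2\<close> for the L1 error and for the L2 part.\<close>

definition C_weak :: real where "C_weak = 10 + 2 * C_smooth + 4 * C_L2"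

lemma constants_pos: "0 < C_avg" "0 < C_tot" "0 < C_smooth" "0 < C_L2" "0 < C_weak"
proof -
  show 1: "0 < C_avg" "0 < C_tot" "0 < C_smooth"
    using C_W_pos C_corr_pos c0 by (simp_all add: C_avg_def C_tot_def C_smooth_def add_pos_pos)
  then show 2: "0 < C_L2" using C_W_pos by (simp add: C_L2_def add_pos_pos)
  show "0 < C_weak" using 1 2 by (simp add: C_weak_def add_pos_pos)
qed

text \<open>A point mass at \<open>y\<close> is spread over an interval of length \<open>step (D y)\<close>, where \<open>D y\<close> is the distance of \<open>y\<close> to
  the set where the maximal function is small. This length is chosen so that the spreading is not felt by the
  kernel at distances at least \<open>D y\<close>, while the spread mass has bounded potential.\<close>

lemma spread_potential_le:
  fixes f :: "real \<Rightarrow> complex" and P :: "real set"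
  defines "D \<equiv> \<lambda>y. infdist y P"
  assumes f[measurable]: "f \<in> borel_measurable borel" and \<alpha>: "0 < \<alpha>" and P: "P \<noteq> {}"
    and mass: "\<And>p r. p \<in> P \<Longrightarrow> 0 < r \<Longrightarrow>
       (\<integral>\<^sup>+y. ennreal (cmod (f y)) * indicator (cball p r) y \<partial>lborel) \<le> ennreal (\<alpha> * r)"
    and supp: "\<And>y. b < D y \<Longrightarrow> f y = 0"
  shows "(\<integral>\<^sup>+y. ennreal (cmod (f y)) * (\<integral>\<^sup>+u. W \<bar>x - y + step (D y) * u\<bar> * indicator {0..1} u \<partial>lborel) \<partial>lborel)
    \<le> ennreal (C_L2 * \<alpha>)"
proof -
  have [measurable]: "W \<in> borel_measurable borel" by (rule borel_measurable_antimono_ennreal[OF W_antimono])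
  \<comment> \<open>A ball about \<open>x\<close> of radius \<open>r \<ge> \<delta>\<close> can be
    recentred: some point of \<open>P\<close> lies within \<open>D x + r \<le> 3 * r\<close>, so its
    ball of radius \<open>4 * r\<close> contains the original one. This carries the mass bound from
    \<open>P\<close> to arbitrary \<open>x\<close>.\<close>
  define \<delta> where "\<delta> = D x / 2"
  have \<delta>0: "0 \<le> \<delta>" unfolding \<delta>_def D_def by (simp add: infdist_nonneg)
  define F where "F y = ennreal (cmod (f y))" for y
  have [measurable]: "F \<in> borel_measurable borel" unfolding F_def by measurable
  have mass4: "(\<integral>\<^sup>+y. F y * indicator (cball x r) y \<partial>lborel) \<le> ennreal (4 * \<alpha> * r)" if r: "0 < r" "\<delta> \<le> r" for r
  proof -
    have "infdist x P < D x + r" using r unfolding D_def by simp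
    then obtain p where p: "p \<in> P" "dist x p < D x + r"
      using P by (auto simp: infdist_def cINF_less_iff split: if_splits)
    then have "dist x p \<le> 3 * r" using r unfolding \<delta>_def by auto
    then have "cball x r \<subseteq> cball p (4 * r)" by (intro subsetI) (auto simp: dist_real_def)
    then have "(\<integral>\<^sup>+y. F y * indicator (cball x r) y \<partial>lborel) \<le> (\<integral>\<^sup>+y. F y * indicator (cball p (4 * r)) y \<partial>lborel)"
      by (intro nn_integral_mono) (auto simp: indicator_def)
    also have "\<dots> \<le> ennreal (\<alpha> * (4 * r))" unfolding F_def using p r by (intro mass) auto
    finally show ?thesis by (simp add: mult_ac)
  qed
  \<comment> \<open>For \<open>y\<close> closer than \<open>\<delta>\<close> the distance
    \<open>D y\<close> is at least \<open>\<delta>\<close>, since \<open>D\<close> is 1-Lipschitz,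
    so the averaged weight is at most \<open>2 * C_W / \<delta>\<close> regardless of position. For
    the other \<open>y\<close> the averaged weight is no worse than \<open>W\<close> at half the
    distance.\<close>
  define near where "near y = ennreal (2 * C_W / \<delta>) * (F y * indicator (cball x \<delta>) y)" for y
  define far where "far y = F y * (if \<delta> \<le> \<bar>x - y\<bar> \<and> y \<noteq> x then W (\<bar>x - y\<bar> / 2) else 0)" for y
  have [measurable]: "cball x \<delta> \<in> sets borel" by (intro borel_closed closed_cball)
  have [measurable]: "near \<in> borel_measurable borel" "far \<in> borel_measurable borel"
    unfolding near_def far_def by measurable
  have "(\<integral>\<^sup>+y. F y * (\<integral>\<^sup>+u. W \<bar>x - y + step (D y) * u\<bar> * indicator {0..1} u \<partial>lborel) \<partial>lborel)
      \<le> (\<integral>\<^sup>+y. near y + ennreal C_avg * far y \<partial>lborel)"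
  proof (rule nn_integral_mono_AE)
    have "AE y in lborel. y \<noteq> x" by (rule AE_lborel_singleton)
    then show "AE y in lborel. F y * (\<integral>\<^sup>+u. W \<bar>x - y + step (D y) * u\<bar> * indicator {0..1} u \<partial>lborel)
        \<le> near y + ennreal C_avg * far y"
    proof eventually_elim
      case (elim y)
      define A where "A = (\<integral>\<^sup>+u. W \<bar>x - y + step (D y) * u\<bar> * indicator {0..1} u \<partial>lborel)"
      show ?case unfolding A_def[symmetric]
      proof (cases "b < D y")
        case True
        then show "F y * A \<le> near y + ennreal C_avg * far y" using supp by (simp add: F_def)
      next
        case False
        have D0: "0 \<le> D y" "D y \<le> b" using False by (auto simp: D_def infdist_nonneg)
        show "F y * A \<le> near y + ennreal C_avg * far y"
        proof (cases "\<delta> \<le> \<bar>x - y\<bar>")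
          case True
          have "F y * A \<le> F y * (ennreal C_avg * W (\<bar>x - y\<bar> / 2))"
            unfolding A_def by (intro mult_left_mono average_W_le_W D0) auto
          also have "\<dots> = ennreal C_avg * far y" using True elim by (simp add: far_def mult_ac)
          finally show ?thesis by (rule add_increasing[OF zero_le])
        next
          case close: False
          then have \<delta>: "0 < \<delta>" by (auto intro: ccontr)
          have "D x \<le> D y + \<bar>x - y\<bar>" using infdist_triangle[of x P y] by (simp add: D_def dist_real_def)
          then have Dy: "\<delta> \<le> D y" using close unfolding \<delta>_def by auto
          then have Dp: "0 < D y" using \<delta> by auto
          have "A \<le> ennreal (2 * C_W / D y)"
            unfolding A_def using average_W_le[OF Dp D0(2)] Dp D0 by (simp add: step_def)
          also have "\<dots> \<le> ennreal (2 * C_W / \<delta>)"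
            using Dy \<delta> C_W_pos by (intro ennreal_leI divide_left_mono) auto
          finally have "F y * A \<le> F y * ennreal (2 * C_W / \<delta>)" by (intro mult_left_mono) auto
          also have "\<dots> = near y" using close by (simp add: near_def dist_real_def mult_ac)
          finally show ?thesis by (rule add_increasing2[OF zero_le])
        qed
      qed
    qed
  qed
  also have "\<dots> = (\<integral>\<^sup>+y. near y \<partial>lborel) + ennreal C_avg * (\<integral>\<^sup>+y. far y \<partial>lborel)"
    by (subst nn_integral_add) (auto simp: nn_integral_cmult)
  also have "\<dots> \<le> ennreal (8 * C_W * \<alpha>) + ennreal (32 * C_avg * C_tot * \<alpha>)"
  proof (rule add_mono)
    show "(\<integral>\<^sup>+y. near y \<partial>lborel) \<le> ennreal (8 * C_W * \<alpha>)"
    proof (cases "\<delta> = 0")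
      \<comment> \<open>Division by zero gives 0, so \<open>near\<close> vanishes identically;
        indeed no \<open>y\<close> is closer than \<open>\<delta> = 0\<close>.\<close>
      case True
      then show ?thesis by (simp add: near_def)
    next
      case False
      then have \<delta>: "0 < \<delta>" using \<delta>0 by auto
      have "(\<integral>\<^sup>+y. near y \<partial>lborel) = ennreal (2 * C_W / \<delta>) * (\<integral>\<^sup>+y. F y * indicator (cball x \<delta>) y \<partial>lborel)"
        unfolding near_def by (subst nn_integral_cmult) auto
      also have "\<dots> \<le> ennreal (2 * C_W / \<delta>) * ennreal (4 * \<alpha> * \<delta>)"
        using \<delta> by (intro mult_left_mono mass4) auto
      also have "\<dots> = ennreal (8 * C_W * \<alpha>)"
        using \<delta> \<alpha> C_W_pos by (simp add: ennreal_mult[symmetric])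
      finally show ?thesis .
    qed
    have "(\<integral>\<^sup>+y. far y \<partial>lborel) \<le> ennreal (8 * (4 * \<alpha>)) * (\<integral>\<^sup>+r. W r * indicator {0..} r \<partial>lborel)"
      unfolding far_def using \<alpha> mass4 by (intro nn_integral_antimono_weight_le W_antimono) auto
    also have "\<dots> \<le> ennreal (8 * (4 * \<alpha>)) * ennreal C_tot"
      by (intro mult_left_mono nn_integral_W_total) auto
    finally have "ennreal C_avg * (\<integral>\<^sup>+y. far y \<partial>lborel) \<le> ennreal C_avg * (ennreal (8 * (4 * \<alpha>)) * ennreal C_tot)"
      by (intro mult_left_mono) auto
    also have "\<dots> = ennreal (32 * C_avg * C_tot * \<alpha>)"
      using \<alpha> constants_pos by (simp add: ennreal_mult[symmetric] mult_ac)
    finally show "ennreal C_avg * (\<integral>\<^sup>+y. far y \<partial>lborel) \<le> ennreal (32 * C_avg * C_tot * \<alpha>)" .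
  qed
  also have "\<dots> = ennreal (8 * C_W * \<alpha> + 32 * C_avg * C_tot * \<alpha>)"
    using \<alpha> constants_pos C_W_pos by (intro ennreal_plus[symmetric]) auto
  also have "\<dots> = ennreal (C_L2 * \<alpha>)"
    by (simp add: C_L2_def algebra_simps)
  finally show ?thesis unfolding F_def .
qed


lemma weak_type_kern:
  fixes f :: "real \<Rightarrow> complex"
  assumes \<epsilon>: "0 < \<epsilon>" and f: "integrable lborel f" and \<alpha>: "0 < \<alpha>"
  shows "emeasure lborel {x. \<alpha> < cmod (\<integral>y. f y * kern \<epsilon> (x - y) \<partial>lborel)}
     \<le> ennreal (C_weak / \<alpha> * (\<integral>x. cmod (f x) \<partial>lborel))"
proof -
  have [measurable]: "f \<in> borel_measurable borel" using f by auto
  note [measurable] = kern_measurable[OF \<epsilon>]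
  define S where "S = (\<integral>x. cmod (f x) \<partial>lborel)"
  have S0: "0 \<le> S" unfolding S_def by simp
  obtain E where [measurable]: "E \<in> sets borel" and Em: "emeasure lborel E \<le> ennreal (10 / \<alpha> * S)"
    and Eout: "\<And>p r. p \<notin> E \<Longrightarrow> 0 < r \<Longrightarrow>
       (\<integral>\<^sup>+y. ennreal (cmod (f y)) * indicator (cball p r) y \<partial>lborel) \<le> ennreal (\<alpha> * r)"
    using maximal_exceptional_set[OF f \<alpha>] unfolding S_def by blast
  \<comment> \<open>The finite measure of \<open>E\<close> leaves its complement nonempty, which
    keeps \<open>infdist\<close> away from its default value 0.\<close>
  have "E \<noteq> UNIV" using Em by (auto simp: top_unique)
  then have P: "- E \<noteq> {}" by auto
  define D where "D y = infdist y (- E)" for y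
  have Dm[measurable]: "D \<in> borel_measurable borel" unfolding D_def
    by (intro borel_measurable_continuous_onI continuous_intros)
  have D0: "0 \<le> D y" for y unfolding D_def by (rule infdist_nonneg)
  \<comment> \<open>Mass with \<open>D y > b\<close> is out of reach of the kernel from every point
    outside \<open>E\<close>, because \<open>kern\<close> vanishes beyond \<open>b\<close>. Dropping
    it changes nothing there.\<close>
  define f1 where "f1 y = (if D y \<le> b then f y else 0)" for y
  have [measurable]: "f1 \<in> borel_measurable borel" unfolding f1_def by measurable
  have f1_le: "cmod (f1 y) \<le> cmod (f y)" for y unfolding f1_def by auto
  have f1: "integrable lborel f1"
    by (rule Bochner_Integration.integrable_bound[OF f]) (auto simp: f1_le)
  define S1 where "S1 = (\<integral>x. cmod (f1 x) \<partial>lborel)"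
  have S1: "0 \<le> S1" "S1 \<le> S" unfolding S1_def S_def using f1 f f1_le by (auto intro!: integral_mono)
  \<comment> \<open>\<open>F\<close> carries the mass and \<open>\<phi>\<close> its position: for
    fixed \<open>y\<close> the parameter \<open>u\<close> moves uniformly over an interval of length
    \<open>step (D y)\<close> ending at \<open>y\<close>.\<close>
  define F where "F = (\<lambda>(y, u). f1 y * indicator {0..1::real} u)"
  define \<phi> where "\<phi> = (\<lambda>(y, u). y - step (D y) * u)"
  have [measurable]: "F \<in> borel_measurable (lborel \<Otimes>\<^sub>M lborel)" "\<phi> \<in> borel_measurable (lborel \<Otimes>\<^sub>M lborel)"
    unfolding F_def \<phi>_def by measurable
  have Fnn: "(\<integral>\<^sup>+\<eta>. ennreal (cmod (F \<eta>)) \<partial>(lborel \<Otimes>\<^sub>M lborel)) = ennreal S1"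
  proof -
    have "(\<integral>\<^sup>+\<eta>. ennreal (cmod (F \<eta>)) \<partial>(lborel \<Otimes>\<^sub>M lborel))
      = (\<integral>\<^sup>+y. (\<integral>\<^sup>+u. ennreal (cmod (f1 y)) * indicator {0..1::real} u \<partial>lborel) \<partial>lborel)"
      by (subst lborel.nn_integral_fst[symmetric])
         (auto simp: F_def norm_mult indicator_def intro!: nn_integral_cong)
    also have "\<dots> = (\<integral>\<^sup>+y. ennreal (cmod (f1 y)) \<partial>lborel)"
      by (simp add: nn_integral_cmult_indicator)
    also have "\<dots> = ennreal S1"
      unfolding S1_def using f1 by (intro nn_integral_eq_integral) auto
    finally show ?thesis .
  qed
  have Fint: "integrable (lborel \<Otimes>\<^sub>M lborel) F"
    by (rule integrableI_bounded) (auto simp: Fnn)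
  have F1: "(\<integral>\<eta>. cmod (F \<eta>) \<partial>(lborel \<Otimes>\<^sub>M lborel)) = S1"
    using Fnn S1 nn_integral_eq_integral[of "lborel \<Otimes>\<^sub>M lborel" "\<lambda>\<eta>. cmod (F \<eta>)"] Fint by simp
  define G2 where "G2 x = (\<integral>\<eta>. F \<eta> * kern \<epsilon> (x - \<phi> \<eta>) \<partial>(lborel \<Otimes>\<^sub>M lborel))" for x
  define G where "G x = (\<integral>y. f y * kern \<epsilon> (x - y) \<partial>lborel)" for x
  have sf: "sigma_finite_measure (lborel \<Otimes>\<^sub>M lborel :: (real \<times> real) measure)"
    unfolding lborel_prod by (rule sigma_finite_lborel)
  interpret LL: sigma_finite_measure "lborel \<Otimes>\<^sub>M lborel :: (real \<times> real) measure" by (rule sf)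
  interpret LP: pair_sigma_finite "lborel \<Otimes>\<^sub>M lborel :: (real \<times> real) measure" "lborel :: real measure" ..
  have [measurable]: "G2 \<in> borel_measurable borel" "G \<in> borel_measurable borel"
    unfolding G2_def G_def by measurable
  have L2: "(\<integral>\<^sup>+x. ennreal ((cmod (G2 x))^2) \<partial>lborel) \<le> ennreal (C_L2 * \<alpha> * S1)"
    unfolding G2_def F1[symmetric]
  \<comment> \<open>The cut-off enters through \<open>M\<close> and the finiteness of the kernel's
    mass, neither of which appears in the resulting bound.\<close>
  proof (rule nn_integral_superposition_L2[OF sf _ _ Fint, where M="1 / \<epsilon>" and w="\<lambda>p q. W \<bar>p - q\<bar>"])
    show "(\<integral>\<^sup>+x. ennreal (cmod (kern \<epsilon> x)) \<partial>lborel) < \<infinity>"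
      using nn_integral_kern_le[OF \<epsilon>] by (auto simp: less_top[symmetric] top_unique)
    show "0 \<le> C_L2 * \<alpha>" using constants_pos \<alpha> by simp
    fix \<eta>
    have [measurable]: "W \<in> borel_measurable borel" by (rule borel_measurable_antimono_ennreal[OF W_antimono])
    have "(\<integral>\<^sup>+\<eta>'. ennreal (cmod (F \<eta>')) * W \<bar>\<phi> \<eta> - \<phi> \<eta>'\<bar> \<partial>(lborel \<Otimes>\<^sub>M lborel))
       = (\<integral>\<^sup>+y. (\<integral>\<^sup>+u. ennreal (cmod (f1 y)) * (W \<bar>\<phi> \<eta> - y + step (D y) * u\<bar> * indicator {0..1} u) \<partial>lborel) \<partial>lborel)"
      by (subst lborel.nn_integral_fst[symmetric])
         (auto simp: F_def \<phi>_def norm_mult indicator_def algebra_simps intro!: nn_integral_cong)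
    also have "\<dots> = (\<integral>\<^sup>+y. ennreal (cmod (f1 y)) * (\<integral>\<^sup>+u. W \<bar>\<phi> \<eta> - y + step (D y) * u\<bar> * indicator {0..1} u \<partial>lborel) \<partial>lborel)"
      by (subst nn_integral_cmult) auto
    also have "\<dots> \<le> ennreal (C_L2 * \<alpha>)"
      unfolding D_def
    proof (rule spread_potential_le[OF _ \<alpha> P])
      show "f1 y = 0" if "b < infdist y (- E)" for y using that by (simp add: f1_def D_def)
      fix p r assume pr: "p \<in> - E" "(0::real) < r"
      have "(\<integral>\<^sup>+y. ennreal (cmod (f1 y)) * indicator (cball p r) y \<partial>lborel)
         \<le> (\<integral>\<^sup>+y. ennreal (cmod (f y)) * indicator (cball p r) y \<partial>lborel)"
        by (intro nn_integral_mono mult_right_mono ennreal_leI f1_le) auto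
      also have "\<dots> \<le> ennreal (\<alpha> * r)" using Eout pr by auto
      finally show "(\<integral>\<^sup>+y. ennreal (cmod (f1 y)) * indicator (cball p r) y \<partial>lborel) \<le> ennreal (\<alpha> * r)" .
    qed measurable
    finally show "(\<integral>\<^sup>+\<eta>'. ennreal (cmod (F \<eta>')) * W \<bar>\<phi> \<eta> - \<phi> \<eta>'\<bar> \<partial>(lborel \<Otimes>\<^sub>M lborel)) \<le> ennreal (C_L2 * \<alpha>)" .
  qed (use kern_translates_inner[OF \<epsilon>] cmod_kern_le[OF \<epsilon>] in auto)
  have Gdiff: "ennreal (cmod (G x - G2 x)) \<le> (\<integral>\<^sup>+\<eta>. ennreal (cmod (F \<eta>)) * ennreal (cmod (kern \<epsilon> (x - fst \<eta>) - kern \<epsilon> (x - \<phi> \<eta>))) \<partial>(lborel \<Otimes>\<^sub>M lborel))"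
    if x: "x \<notin> E" for x
  proof -
    have Fi: "integrable (lborel \<Otimes>\<^sub>M lborel) (\<lambda>\<eta>. F \<eta> * kern \<epsilon> (x - h \<eta>))"
      if [measurable]: "h \<in> borel_measurable (lborel \<Otimes>\<^sub>M lborel)" for h
    proof (rule Bochner_Integration.integrable_bound[OF integrable_mult_right[OF Fint, of "complex_of_real (1 / \<epsilon>)"]])
      show "AE \<eta> in lborel \<Otimes>\<^sub>M lborel. cmod (F \<eta> * kern \<epsilon> (x - h \<eta>)) \<le> cmod (complex_of_real (1 / \<epsilon>) * F \<eta>)"
      proof (rule AE_I2)
        fix \<eta>
        have "cmod (F \<eta>) * cmod (kern \<epsilon> (x - h \<eta>)) \<le> cmod (F \<eta>) * (1 / \<epsilon>)"
          by (intro mult_left_mono cmod_kern_le \<epsilon>) auto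
        then show "cmod (F \<eta> * kern \<epsilon> (x - h \<eta>)) \<le> cmod (complex_of_real (1 / \<epsilon>) * F \<eta>)"
          using \<epsilon> by (simp add: norm_mult norm_divide)
      qed
    qed measurable
    have Fi1: "integrable (lborel \<Otimes>\<^sub>M lborel) (\<lambda>\<eta>. F \<eta> * kern \<epsilon> (x - fst \<eta>))"
      by (rule Fi) measurable
    have Fi2: "integrable (lborel \<Otimes>\<^sub>M lborel) (\<lambda>\<eta>. F \<eta> * kern \<epsilon> (x - \<phi> \<eta>))"
      by (rule Fi) measurable
    have eqf: "f1 y * kern \<epsilon> (x - y) = f y * kern \<epsilon> (x - y)" for y
    proof (cases "D y \<le> b")
      case False
      have "D y \<le> \<bar>y - x\<bar>" using infdist_le[of x "- E" y] x by (simp add: D_def dist_real_def)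
      then have "kern \<epsilon> (x - y) = 0" using False \<epsilon> by (auto simp: kern_def)
      then show ?thesis by simp
    qed (simp add: f1_def)
    have "(\<integral>\<eta>. F \<eta> * kern \<epsilon> (x - fst \<eta>) \<partial>(lborel \<Otimes>\<^sub>M lborel))
       = (\<integral>y. (\<integral>u. F (y, u) * kern \<epsilon> (x - y) \<partial>lborel) \<partial>lborel)"
      using lborel_pair.integral_fst'[OF Fi1] by (simp only: fst_conv)
    also have "\<dots> = (\<integral>y. f1 y * kern \<epsilon> (x - y) \<partial>lborel)"
    proof (intro Bochner_Integration.integral_cong refl)
      fix y
      have "(\<integral>u. F (y, u) * kern \<epsilon> (x - y) \<partial>lborel) = (\<integral>u. indicator {0..1::real} u *\<^sub>R (f1 y * kern \<epsilon> (x - y)) \<partial>lborel)"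
        by (intro Bochner_Integration.integral_cong) (auto simp: F_def indicator_def)
      then show "(\<integral>u. F (y, u) * kern \<epsilon> (x - y) \<partial>lborel) = f1 y * kern \<epsilon> (x - y)" by simp
    qed
    also have "\<dots> = G x" unfolding G_def eqf ..
    finally have eqG: "G x - G2 x = (\<integral>\<eta>. F \<eta> * kern \<epsilon> (x - fst \<eta>) - F \<eta> * kern \<epsilon> (x - \<phi> \<eta>) \<partial>(lborel \<Otimes>\<^sub>M lborel))"
      unfolding G2_def by (simp only: Bochner_Integration.integral_diff[OF Fi1 Fi2])
    have "ennreal (cmod (G x - G2 x)) \<le> (\<integral>\<^sup>+\<eta>. ennreal (cmod (F \<eta> * kern \<epsilon> (x - fst \<eta>) - F \<eta> * kern \<epsilon> (x - \<phi> \<eta>))) \<partial>(lborel \<Otimes>\<^sub>M lborel))"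
      unfolding eqG by (rule integral_norm_bound_ennreal[OF Bochner_Integration.integrable_diff[OF Fi1 Fi2]])
    also have "\<dots> = (\<integral>\<^sup>+\<eta>. ennreal (cmod (F \<eta>)) * ennreal (cmod (kern \<epsilon> (x - fst \<eta>) - kern \<epsilon> (x - \<phi> \<eta>))) \<partial>(lborel \<Otimes>\<^sub>M lborel))"
    proof (rule nn_integral_cong)
      fix \<eta>
      have "F \<eta> * kern \<epsilon> (x - fst \<eta>) - F \<eta> * kern \<epsilon> (x - \<phi> \<eta>) = F \<eta> * (kern \<epsilon> (x - fst \<eta>) - kern \<epsilon> (x - \<phi> \<eta>))"
        by (rule right_diff_distrib[symmetric])
      then show "ennreal (cmod (F \<eta> * kern \<epsilon> (x - fst \<eta>) - F \<eta> * kern \<epsilon> (x - \<phi> \<eta>)))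
        = ennreal (cmod (F \<eta>)) * ennreal (cmod (kern \<epsilon> (x - fst \<eta>) - kern \<epsilon> (x - \<phi> \<eta>)))"
        by (simp only: norm_mult ennreal_mult[OF norm_ge_zero norm_ge_zero])
    qed
    finally show ?thesis .
  qed
  have L1: "(\<integral>\<^sup>+x. ennreal (cmod (G x - G2 x)) * indicator (- E) x \<partial>lborel) \<le> ennreal (C_smooth * S1)"
  proof -
    have "(\<integral>\<^sup>+x. ennreal (cmod (G x - G2 x)) * indicator (- E) x \<partial>lborel)
      \<le> (\<integral>\<^sup>+x. (\<integral>\<^sup>+\<eta>. ennreal (cmod (F \<eta>)) * ennreal (cmod (kern \<epsilon> (x - fst \<eta>) - kern \<epsilon> (x - \<phi> \<eta>))) * indicator (- E) x \<partial>(lborel \<Otimes>\<^sub>M lborel)) \<partial>lborel)"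
      using Gdiff by (intro nn_integral_mono) (auto simp: indicator_def)
    also have "\<dots> = (\<integral>\<^sup>+\<eta>. (\<integral>\<^sup>+x. ennreal (cmod (F \<eta>)) * ennreal (cmod (kern \<epsilon> (x - fst \<eta>) - kern \<epsilon> (x - \<phi> \<eta>))) * indicator (- E) x \<partial>lborel) \<partial>(lborel \<Otimes>\<^sub>M lborel))"
      by (intro LP.Fubini') measurable
    also have "\<dots> \<le> (\<integral>\<^sup>+\<eta>. ennreal (cmod (F \<eta>)) * ennreal C_smooth \<partial>(lborel \<Otimes>\<^sub>M lborel))"
    proof (rule nn_integral_mono)
      fix \<eta> :: "real \<times> real"
      obtain y u where \<eta>: "\<eta> = (y, u)" by (cases \<eta>)
      have inner: "(\<integral>\<^sup>+x. ennreal (cmod (kern \<epsilon> (x - fst \<eta>) - kern \<epsilon> (x - \<phi> \<eta>))) * indicator (- E) x \<partial>lborel) \<le> ennreal C_smooth"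
        if F: "F \<eta> \<noteq> 0"
      proof -
        have u: "0 \<le> u" "u \<le> 1" and Db: "D y \<le> b"
          using F unfolding F_def \<eta> by (auto simp: f1_def indicator_def split: if_splits)
        define v where "v = step (D y) * u"
        have v: "0 \<le> v" "v \<le> step (D y)" unfolding v_def using u step_bounds(1)[of "D y"] by (auto simp: mult_left_le)
        have "(\<integral>\<^sup>+x. ennreal (cmod (kern \<epsilon> (x - fst \<eta>) - kern \<epsilon> (x - \<phi> \<eta>))) * indicator (- E) x \<partial>lborel)
          = (\<integral>\<^sup>+t. ennreal (cmod (kern \<epsilon> t - kern \<epsilon> (t + v))) * indicator (- E) (y + t) \<partial>lborel)"
          by (subst nn_integral_real_affine[where c=1 and t=y]) (auto simp: \<eta> \<phi>_def v_def)
        also have "\<dots> \<le> (\<integral>\<^sup>+t. ennreal (cmod (kern \<epsilon> (t + v) - kern \<epsilon> t)) * indicator {t. D y \<le> \<bar>t\<bar>} t \<partial>lborel)"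
        proof (intro nn_integral_mono)
          fix t
          \<comment> \<open>Staying outside \<open>E\<close> means staying at distance at least
            \<open>D y\<close> from \<open>y\<close>; this is the region in which
            \<open>kern_smoothness\<close> applies.\<close>
          have "D y \<le> \<bar>t\<bar>" if "y + t \<notin> E"
            using infdist_le[of "y + t" "- E" y] that by (simp add: D_def dist_real_def)
          then show "ennreal (cmod (kern \<epsilon> t - kern \<epsilon> (t + v))) * indicator (- E) (y + t)
            \<le> ennreal (cmod (kern \<epsilon> (t + v) - kern \<epsilon> t)) * indicator {t. D y \<le> \<bar>t\<bar>} t"
            by (auto simp: indicator_def norm_minus_commute)
        qed
        also have "\<dots> \<le> ennreal C_smooth"
        proof (cases "D y = 0")
          case True
          then have "v = 0" using v by (simp add: step_def)
          then show ?thesis by simp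
        next
          case False
          then have Dp: "0 < D y" using D0[of y] by simp
          then have "v \<le> 1 / g (D y)" using v Db by (simp add: step_def)
          then show ?thesis using kern_smoothness[OF \<epsilon> Dp Db v(1)] by simp
        qed
        finally show ?thesis .
      qed
      have "(\<integral>\<^sup>+x. ennreal (cmod (F \<eta>)) * ennreal (cmod (kern \<epsilon> (x - fst \<eta>) - kern \<epsilon> (x - \<phi> \<eta>))) * indicator (- E) x \<partial>lborel)
        = ennreal (cmod (F \<eta>)) * (\<integral>\<^sup>+x. ennreal (cmod (kern \<epsilon> (x - fst \<eta>) - kern \<epsilon> (x - \<phi> \<eta>))) * indicator (- E) x \<partial>lborel)"
        by (subst nn_integral_cmult[symmetric]) (auto simp: mult.assoc)
      also have "\<dots> \<le> ennreal (cmod (F \<eta>)) * ennreal C_smooth"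
        using inner by (cases "F \<eta> = 0") (auto intro: mult_left_mono)
      finally show "(\<integral>\<^sup>+x. ennreal (cmod (F \<eta>)) * ennreal (cmod (kern \<epsilon> (x - fst \<eta>) - kern \<epsilon> (x - \<phi> \<eta>))) * indicator (- E) x \<partial>lborel)
        \<le> ennreal (cmod (F \<eta>)) * ennreal C_smooth" .
    qed
    also have "\<dots> = ennreal (C_smooth * S1)"
      using constants_pos S1 ennreal_mult[of S1 C_smooth] by (subst nn_integral_multc) (auto simp: Fnn mult.commute)
    finally show ?thesis .
  qed
  define X1 where "X1 = {x \<in> - E. 1 \<le> ennreal (2 / \<alpha>) * ennreal (cmod (G x - G2 x))}"
  define X2 where "X2 = {x \<in> UNIV. 1 \<le> ennreal (4 / \<alpha>^2) * ennreal ((cmod (G2 x))^2)}"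
  have m: "X1 \<in> sets lborel" "X2 \<in> sets lborel" unfolding X1_def X2_def by measurable
  have "{x. \<alpha> < cmod (G x)} \<subseteq> E \<union> (X1 \<union> X2)"
  proof
    fix x assume "x \<in> {x. \<alpha> < cmod (G x)}"
    then have x: "\<alpha> < cmod (G x)" by simp
    have "cmod (G x) \<le> cmod (G x - G2 x) + cmod (G2 x)" using norm_triangle_ineq[of "G x - G2 x" "G2 x"] by simp
    then consider "\<alpha> / 2 \<le> cmod (G x - G2 x)" | "\<alpha> / 2 \<le> cmod (G2 x)" using x by linarith
    then show "x \<in> E \<union> (X1 \<union> X2)"
    proof cases
      case 1
      then have "1 \<le> 2 / \<alpha> * cmod (G x - G2 x)" using \<alpha> by (simp add: field_simps)
      then have "1 \<le> ennreal (2 / \<alpha>) * ennreal (cmod (G x - G2 x))"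
        using \<alpha> by (simp add: ennreal_mult[symmetric])
      then show ?thesis unfolding X1_def by auto
    next
      case 2
      then have "(\<alpha> / 2)^2 \<le> (cmod (G2 x))^2" using \<alpha> by (intro power_mono) auto
      then have "1 \<le> 4 / \<alpha>^2 * (cmod (G2 x))^2" using \<alpha> by (simp add: field_simps power2_eq_square)
      then have "1 \<le> ennreal (4 / \<alpha>^2) * ennreal ((cmod (G2 x))^2)"
        using \<alpha> by (subst ennreal_mult[symmetric]) auto
      then show ?thesis unfolding X2_def by auto
    qed
  qed
  then have "emeasure lborel {x. \<alpha> < cmod (G x)} \<le> emeasure lborel (E \<union> (X1 \<union> X2))"
    using m by (intro emeasure_mono) auto
  also have "\<dots> \<le> emeasure lborel E + (emeasure lborel X1 + emeasure lborel X2)"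
    using m by (intro order_trans[OF emeasure_subadditive] add_left_mono emeasure_subadditive) auto
  also have "\<dots> \<le> ennreal (10 / \<alpha> * S) + (ennreal (2 / \<alpha> * (C_smooth * S)) + ennreal (4 / \<alpha>^2 * (C_L2 * \<alpha> * S)))"
  proof (intro add_mono Em)
    have "emeasure lborel X1 \<le> ennreal (2 / \<alpha>) * (\<integral>\<^sup>+x. ennreal (cmod (G x - G2 x)) * indicator (- E) x \<partial>lborel)"
      unfolding X1_def by (intro nn_integral_Markov_inequality) auto
    also have "\<dots> \<le> ennreal (2 / \<alpha>) * ennreal (C_smooth * S)"
      using S1 constants_pos by (intro mult_left_mono order_trans[OF L1] ennreal_leI) auto
    also have "\<dots> = ennreal (2 / \<alpha> * (C_smooth * S))" using \<alpha> by (intro ennreal_mult'[symmetric]) simp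
    finally show "emeasure lborel X1 \<le> ennreal (2 / \<alpha> * (C_smooth * S))" .
    have "emeasure lborel X2 \<le> ennreal (4 / \<alpha>^2) * (\<integral>\<^sup>+x. ennreal ((cmod (G2 x))^2) * indicator UNIV x \<partial>lborel)"
      unfolding X2_def by (intro nn_integral_Markov_inequality) auto
    also have "\<dots> \<le> ennreal (4 / \<alpha>^2) * ennreal (C_L2 * \<alpha> * S)"
      using S1 constants_pos \<alpha> by (intro mult_left_mono) (auto intro!: order_trans[OF L2] ennreal_leI)
    also have "\<dots> = ennreal (4 / \<alpha>^2 * (C_L2 * \<alpha> * S))" using \<alpha> by (intro ennreal_mult'[symmetric]) simp
    finally show "emeasure lborel X2 \<le> ennreal (4 / \<alpha>^2 * (C_L2 * \<alpha> * S))" .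
  qed
  also have "\<dots> = ennreal (10 / \<alpha> * S + (2 / \<alpha> * (C_smooth * S) + 4 / \<alpha>^2 * (C_L2 * \<alpha> * S)))"
    using \<alpha> S0 constants_pos by (simp add: ennreal_plus)
  also have "10 / \<alpha> * S + (2 / \<alpha> * (C_smooth * S) + 4 / \<alpha>^2 * (C_L2 * \<alpha> * S)) = C_weak / \<alpha> * S"
    using \<alpha> by (simp add: C_weak_def field_simps power2_eq_square)
  finally show ?thesis unfolding G_def S_def .
qed

end

section \<open>Removing the truncation\<close>

text \<open>A sequence of cut-offs supplies the candidate limit. Letting the smaller cut-off tend to
  0 along it turns the Cauchy estimate into the rate \<open>R\<close> for all cut-offs.\<close>

lemma tendsto_at_right_0_of_Cauchy:
  fixes T :: "real \<Rightarrow> complex"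
  assumes \<delta>: "0 < \<delta>" and R: "(R \<longlongrightarrow> 0) (at_right 0)"
    and le: "\<And>p r. 0 < p \<Longrightarrow> p \<le> r \<Longrightarrow> r \<le> \<delta> \<Longrightarrow> cmod (T p - T r) \<le> R r"
  shows "\<exists>L. (T \<longlongrightarrow> L) (at_right 0)"
proof -
  define s where "s n = \<delta> / real (Suc n)" for n
  have s: "0 < s n" "s n \<le> \<delta>" for n using \<delta> by (auto simp: s_def field_simps)
  have s_anti: "s m \<le> s n" if "n \<le> m" for m n using \<delta> that by (auto simp: s_def intro!: divide_left_mono)
  have s0: "s \<longlonglongrightarrow> 0" unfolding s_def by (rule LIMSEQ_Suc[OF lim_const_over_n]) 
  have fs: "filterlim s (at_right 0) sequentially"
    using s0 s(1) by (auto simp: filterlim_at less_imp_neq[THEN not_sym] intro!: always_eventually)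
  have Rs: "(\<lambda>n. R (s n)) \<longlonglongrightarrow> 0" by (rule filterlim_compose[OF R fs])
  have "Cauchy (\<lambda>n. T (s n))"
  proof (rule CauchyI')
    fix e :: real assume "0 < e"
    then have "eventually (\<lambda>n. R (s n) < e) sequentially" by (rule order_tendstoD(2)[OF Rs])
    then obtain M where M: "\<And>n. M \<le> n \<Longrightarrow> R (s n) < e" by (auto simp: eventually_sequentially)
    show "\<exists>M. \<forall>m\<ge>M. \<forall>n>m. dist (T (s m)) (T (s n)) < e"
    proof (intro exI allI impI)
      fix m n assume "M \<le> m" "m < n"
      then show "dist (T (s m)) (T (s n)) < e"
        using le[of "s n" "s m"] s(1)[of n] s(2)[of m] s_anti[of m n] M[of m]
        by (simp add: dist_norm norm_minus_commute)
    qed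
  qed
  then obtain L where L: "(\<lambda>n. T (s n)) \<longlonglongrightarrow> L" by (auto simp: Cauchy_convergent_iff convergent_def)
  have "cmod (T r - L) \<le> R r" if r: "0 < r" "r \<le> \<delta>" for r
  proof (rule tendsto_upperbound)
    show "(\<lambda>n. cmod (T r - T (s n))) \<longlonglongrightarrow> cmod (T r - L)" by (intro tendsto_intros L)
    have "eventually (\<lambda>n. s n < r) sequentially" by (rule order_tendstoD(2)[OF s0 r(1)])
    then show "eventually (\<lambda>n. cmod (T r - T (s n)) \<le> R r) sequentially"
      by eventually_elim (use le[of "s _" r] s r in \<open>auto simp: norm_minus_commute\<close>)
  qed simp
  moreover have "eventually (\<lambda>r. 0 < r \<and> r \<le> \<delta>) (at_right 0)"
    using \<delta> by (auto simp: eventually_at_right intro!: exI[of _ \<delta>])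
  ultimately have "eventually (\<lambda>r. norm (T r - L) \<le> R r) (at_right 0)"
    by (auto elim: eventually_mono)
  then have "((\<lambda>r. T r - L) \<longlongrightarrow> 0) (at_right 0)" by (rule Lim_null_comparison[OF _ R])
  then show ?thesis by (auto simp: LIM_zero_iff)
qed

section \<open>Convergence and uniform weak bounds for the truncated operators\<close>

context singular_phase begin

lemma oscillation_reciprocal:
  assumes p: "0 < p" "p \<le> r" "r \<le> b"
  shows "cmod (integral {p..r} (\<lambda>t. exp (\<i> * complex_of_real (\<gamma> t)) * complex_of_real (1 / t)))
     \<le> (2 + 2 / (c0 * (a - 1))) / (c0 * b powr a * g b) * r powr (a - 1)"
proof -
  define M where "M = 1 / (c0 * g r * r powr a)"
  have r: "0 < r" "r \<le> b" using p by auto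
  have gr: "0 < g r" by (rule g_pos[OF r])
  have M0: "0 < M" unfolding M_def using c0 r gr by simp
  have "cmod (integral {p..r} (\<lambda>t. exp (\<i> * complex_of_real (\<gamma> t)) * complex_of_real (1 / t)))
     \<le> 2 * ((1 / r) / g r) + 2 * (M * r powr (a - 1) / (a - 1) - M * p powr (a - 1) / (a - 1))"
  proof (rule van_der_Corput[where \<phi>=g and \<phi>'=g2 and h'="\<lambda>t. - (1 / t^2)" and B'="\<lambda>t. M * t powr (a - 2)"])
    show "p \<le> r" by fact
    fix t assume t: "t \<in> {p..r}"
    then have t0: "0 < t" "t \<le> b" "t \<le> r" using p by auto
    show "(\<gamma> has_real_derivative g t) (at t within {p..r})" "(g has_real_derivative g2 t) (at t within {p..r})"
      using d\<gamma>[OF t0(1,2)] dg[OF t0(1,2)] by (auto intro: has_field_derivative_at_within)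
    show "((\<lambda>t. 1 / t) has_real_derivative - (1 / t^2)) (at t within {p..r})"
      using t0 by (auto intro!: derivative_eq_intros simp: power2_eq_square)
    show "((\<lambda>t. M * t powr (a - 1) / (a - 1)) has_real_derivative M * t powr (a - 2)) (at t within {p..r})"
      using t0 a by (auto intro!: derivative_eq_intros has_field_derivative_powr)
    show "0 < g t" by (rule g_pos[OF t0(1,2)])
    \<comment> \<open>A positive derivative would make \<open>g\<close> smaller just to the left of
      \<open>t\<close>, against \<open>g_anti\<close>. Moving left keeps the point inside
      \<open>(0, b]\<close>, also when \<open>t = b\<close>.\<close>
    show "g2 t \<le> 0"
    proof (rule ccontr)
      assume "\<not> g2 t \<le> 0"
      then have "g2 t > 0" by simp
      from DERIV_pos_inc_left[OF dg[OF t0(1,2)] this] obtain d where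
        d: "0 < d" "\<And>h. 0 < h \<Longrightarrow> h < d \<Longrightarrow> g (t - h) < g t" by blast
      define h where "h = min (d / 2) (t / 2)"
      have "0 < h" "h < d" "h < t" using d(1) t0 by (auto simp: h_def)
      with d(2)[of h] g_anti[of "t - h" t] t0 show False by simp
    qed
    show "0 \<le> 1 / t" "- (1 / t^2) \<le> 0" using t0 by auto
    have "- (- (1 / t^2)) / g t = 1 / t^2 * (1 / g t)" by simp
    also have "\<dots> \<le> 1 / t^2 * ((t / r) powr a / (c0 * g r))"
      using t0 r by (intro mult_left_mono inverse_g_le) auto
    also have "\<dots> = M * t powr (a - 2)"
      using t0 r by (simp add: M_def powr_divide powr_diff powr_numeral field_simps)
    finally show "- (- (1 / t^2)) / g t \<le> M * t powr (a - 2)" .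
  next
    show "continuous_on {p..r} g2" by (rule continuous_on_subset[OF cg2]) (use p in auto)
    show "continuous_on {p..r} (\<lambda>t. - (1 / t^2))" using p by (intro continuous_intros) auto
  qed
  also have "\<dots> \<le> 2 * ((1 / r) / g r) + 2 * (M * r powr (a - 1) / (a - 1))"
    using M0 a by simp
  also have "\<dots> = (2 + 2 / (c0 * (a - 1))) * (1 / r * (1 / g r))"
  proof -
    have M: "M * r powr (a - 1) = (1 / r * (1 / g r)) / c0"
      using r by (simp add: M_def powr_diff)
    have "2 * X + 2 * (X / c0 / (a - 1)) = (2 + 2 / (c0 * (a - 1))) * X" for X
      by (simp add: distrib_right)
    from this[of "1 / r * (1 / g r)"] show ?thesis unfolding M by simp
  qed
  also have "\<dots> \<le> (2 + 2 / (c0 * (a - 1))) * (1 / r * ((r / b) powr a / (c0 * g b)))"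
    using c0 a r by (intro mult_left_mono inverse_g_le) auto
  also have "\<dots> = (2 + 2 / (c0 * (a - 1))) / (c0 * b powr a * g b) * r powr (a - 1)"
    using r b by (simp add: powr_divide powr_diff)
  finally show ?thesis .
qed

text \<open>Write \<open>f (x - t)\<close> as \<open>f x\<close> plus an increment. The constant
  part converges by oscillation at rate \<open>r powr (a - 1)\<close>; the increment is O(t) by
  differentiability at \<open>x\<close>, which cancels the singular factor
  \<open>1 / t\<close>.\<close>

lemma T1_trunc_converges:
  fixes f :: "real \<Rightarrow> complex"
  assumes c\<gamma>: "continuous_on {0<..1} \<gamma>" and cf: "continuous_on UNIV f" and df: "f differentiable (at x)"
  shows "\<exists>L. (T1_trunc \<gamma> f x \<longlongrightarrow> L) (at_right 0)"
proof -
  define e where "e t = exp (\<i> * complex_of_real (\<gamma> t))" for t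
  have ce: "continuous_on {0<..1} e" unfolding e_def by (intro continuous_intros c\<gamma>)
  obtain D where D: "(f has_derivative D) (at x)" using df by (auto simp: differentiable_def)
  have bl: "bounded_linear D" using D by (rule has_derivative_bounded_linear)
  obtain K where K: "0 < K" "\<And>v. norm (D v) \<le> norm v * K" using bounded_linear.pos_bounded[OF bl] by auto
  obtain d where d: "0 < d" "\<And>y. norm (y - x) < d \<Longrightarrow> norm (f y - f x - D (y - x)) \<le> 1 * norm (y - x)"
    using D unfolding has_derivative_at_alt by (metis zero_less_one)
  have Lip: "cmod (f (x - t) - f x) \<le> (1 + K) * t" if t: "0 < t" "t < d" for t
  proof -
    have "cmod (f (x - t) - f x) \<le> cmod (f (x - t) - f x - D (- t)) + cmod (D (- t))"
      using norm_triangle_ineq[of "f (x - t) - f x - D (- t)" "D (- t)"] by simp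
    also have "\<dots> \<le> 1 * norm (- t) + norm (- t) * K"
      using d(2)[of "x - t"] K(2)[of "- t"] t by (intro add_mono) auto
    finally show ?thesis using t by (simp add: algebra_simps)
  qed
  define \<delta> where "\<delta> = min b (d / 2)"
  have \<delta>: "0 < \<delta>" "\<delta> \<le> b" "\<delta> < d" using b d(1) by (auto simp: \<delta>_def)
  define Q where "Q = (2 + 2 / (c0 * (a - 1))) / (c0 * b powr a * g b)"
  define R where "R r = cmod (f x) * (Q * r powr (a - 1)) + (1 + K) * r" for r
  have "(R \<longlongrightarrow> cmod (f x) * (Q * 0 powr (a - 1)) + (1 + K) * 0) (at_right 0)"
    unfolding R_def using a
    by (intro tendsto_intros tendsto_powr') (auto intro: eventually_mono[OF eventually_at_right_less])
  then have R0: "(R \<longlongrightarrow> 0) (at_right 0)" by simp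
  have cF: "continuous_on {0<..1} (\<lambda>t. e t * f (x - t) / complex_of_real t)"
    by (intro continuous_intros ce continuous_on_compose2[OF cf, where f="\<lambda>t. x - t"]) auto
  show ?thesis
  proof (rule tendsto_at_right_0_of_Cauchy[OF \<delta>(1) R0])
    fix p r assume p: "0 < p" "p \<le> r" "r \<le> \<delta>"
    have r1: "r \<le> 1" "r \<le> b" using p \<delta> b by auto
    have int: "(\<lambda>t. e t * f (x - t) / complex_of_real t) integrable_on {u..v}" if "p \<le> u" "v \<le> 1" for u v
      using that p by (intro integrable_continuous_interval continuous_on_subset[OF cF]) auto
    have "integral {p..1} (\<lambda>t. e t * f (x - t) / complex_of_real t)
      = integral {p..r} (\<lambda>t. e t * f (x - t) / complex_of_real t) + integral {r..1} (\<lambda>t. e t * f (x - t) / complex_of_real t)"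
      using Henstock_Kurzweil_Integration.integral_combine[OF p(2) r1(1) int[OF order_refl order_refl]] by simp
    then have eq: "T1_trunc \<gamma> f x p - T1_trunc \<gamma> f x r = integral {p..r} (\<lambda>t. e t * f (x - t) / complex_of_real t)"
      unfolding T1_trunc_def e_def by simp
    have ce': "continuous_on {p..r} e" using p r1 by (intro continuous_on_subset[OF ce]) auto
    have i1: "(\<lambda>t. e t * complex_of_real (1 / t)) integrable_on {p..r}"
      using p by (intro integrable_continuous_interval continuous_intros ce') auto
    have i2: "(\<lambda>t. e t * ((f (x - t) - f x) / complex_of_real t)) integrable_on {p..r}"
      using p by (intro integrable_continuous_interval continuous_intros ce' continuous_on_compose2[OF cf, where f="\<lambda>t. x - t"]) auto
    have "integral {p..r} (\<lambda>t. e t * f (x - t) / complex_of_real t)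
      = integral {p..r} (\<lambda>t. f x * (e t * complex_of_real (1 / t)) + e t * ((f (x - t) - f x) / complex_of_real t))"
      by (intro Henstock_Kurzweil_Integration.integral_cong) (simp add: diff_divide_distrib algebra_simps)
    also have "\<dots> = f x * integral {p..r} (\<lambda>t. e t * complex_of_real (1 / t))
         + integral {p..r} (\<lambda>t. e t * ((f (x - t) - f x) / complex_of_real t))"
      using i1 i2 by (simp add: Henstock_Kurzweil_Integration.integral_add integrable_on_mult_right del: of_real_divide)
    also have "cmod \<dots> \<le> cmod (f x) * (Q * r powr (a - 1)) + (1 + K) * r"
    proof (rule order_trans[OF norm_triangle_ineq add_mono])
      show "cmod (f x * integral {p..r} (\<lambda>t. e t * complex_of_real (1 / t))) \<le> cmod (f x) * (Q * r powr (a - 1))"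
        unfolding norm_mult Q_def e_def
        using p r1 by (intro mult_left_mono oscillation_reciprocal) auto
      have "cmod (integral {p..r} (\<lambda>t. e t * ((f (x - t) - f x) / complex_of_real t))) \<le> integral {p..r} (\<lambda>t. 1 + K)"
      proof (rule Henstock_Kurzweil_Integration.integral_norm_bound_integral[OF i2])
        fix t assume "t \<in> {p..r}"
        then have t: "0 < t" "t < d" using p \<delta> by auto
        show "cmod (e t * ((f (x - t) - f x) / complex_of_real t)) \<le> 1 + K"
          using Lip[OF t] t by (simp add: e_def norm_mult norm_divide divide_le_eq)
      qed (rule integrable_const_ivl)
      also have "\<dots> = (1 + K) * (r - p)" using p by simp
      also have "\<dots> \<le> (1 + K) * r" using p K by (intro mult_left_mono) auto
      finally show "cmod (integral {p..r} (\<lambda>t. e t * ((f (x - t) - f x) / complex_of_real t))) \<le> (1 + K) * r" .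
    qed
    finally show "cmod (T1_trunc \<gamma> f x p - T1_trunc \<gamma> f x r) \<le> R r" unfolding eq R_def .
  qed
qed

lemma T1_trunc_eq_convolution:
  fixes f k :: "real \<Rightarrow> complex"
  assumes c\<gamma>: "continuous_on {0<..1} \<gamma>" and cf: "continuous_on UNIV f" and f: "integrable lborel f"
    and \<epsilon>: "0 < \<epsilon>" "\<epsilon> \<le> b"
    and k_def: "k = (\<lambda>t. if b < t \<and> t \<le> 1 then exp (\<i> * complex_of_real (\<gamma> t)) / complex_of_real t else 0)"
  shows "k \<in> borel_measurable borel"
    and "T1_trunc \<gamma> f x \<epsilon> = (\<integral>y. f y * kern \<epsilon> (x - y) \<partial>lborel) + (\<integral>y. f y * k (x - y) \<partial>lborel)"
proof -
  have [measurable]: "f \<in> borel_measurable borel" using f by auto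
  have "(\<lambda>t. indicator {b<..1} t *\<^sub>R (exp (\<i> * complex_of_real (\<gamma> t)) / complex_of_real t)) \<in> borel_measurable borel"
    using b by (intro borel_measurable_continuous_on_indicator continuous_intros continuous_on_subset[OF c\<gamma>]) auto
  also have "(\<lambda>t. indicator {b<..1} t *\<^sub>R (exp (\<i> * complex_of_real (\<gamma> t)) / complex_of_real t)) = k"
    by (auto simp: k_def fun_eq_iff indicator_def)
  finally show km[measurable]: "k \<in> borel_measurable borel" .
  have [measurable]: "kern \<epsilon> \<in> borel_measurable borel" by (rule kern_measurable[OF \<epsilon>(1)])
  have bounded_mult: "integrable lborel (\<lambda>y. f y * h (x - y))"
    if [measurable]: "h \<in> borel_measurable borel" and h: "\<And>t. cmod (h t) \<le> B" for h B
  proof (rule Bochner_Integration.integrable_bound[OF integrable_mult_right[OF f, of "complex_of_real B"]])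
    have "0 \<le> B" using h[of 0] norm_ge_zero[of "h 0"] by linarith
    then show "AE y in lborel. cmod (f y * h (x - y)) \<le> cmod (complex_of_real B * f y)"
      using h by (intro AE_I2) (auto simp: norm_mult mult.commute[of B] mult_left_mono)
  qed measurable
  have kb: "cmod (k t) \<le> 1 / b" for t
    using b by (auto simp: k_def norm_divide frac_le)
  define F where "F t = exp (\<i> * complex_of_real (\<gamma> t)) * f (x - t) / complex_of_real t" for t
  have "continuous_on {\<epsilon>..1} F" unfolding F_def using \<epsilon>
    by (intro continuous_intros continuous_on_subset[OF c\<gamma>] continuous_on_compose2[OF cf, where f="\<lambda>t. x - t"]) auto
  then have "set_integrable lborel {\<epsilon>..1} F" by (rule borel_integrable_atLeastAtMost')
  from set_borel_integral_eq_integral(2)[OF this]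
  have "T1_trunc \<gamma> f x \<epsilon> = (\<integral>t. indicator {\<epsilon>..1} t *\<^sub>R F t \<partial>lborel)"
    by (simp add: set_lebesgue_integral_def T1_trunc_def F_def[abs_def])
  also have "\<dots> = (\<integral>t. f (x - t) * kern \<epsilon> t + f (x - t) * k t \<partial>lborel)"
    using \<epsilon> b by (intro Bochner_Integration.integral_cong) (auto simp: F_def kern_def k_def indicator_def)
  also have "\<dots> = (\<integral>y. f y * kern \<epsilon> (x - y) + f y * k (x - y) \<partial>lborel)"
    by (subst lborel_integral_real_affine[where c="-1" and t=x]) auto
  also have "\<dots> = (\<integral>y. f y * kern \<epsilon> (x - y) \<partial>lborel) + (\<integral>y. f y * k (x - y) \<partial>lborel)"
    using bounded_mult[of "kern \<epsilon>" "1 / \<epsilon>"] bounded_mult[of k "1 / b"] cmod_kern_le[OF \<epsilon>(1)] kb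
    by (intro Bochner_Integration.integral_add) auto
  finally show "T1_trunc \<gamma> f x \<epsilon> = (\<integral>y. f y * kern \<epsilon> (x - y) \<partial>lborel) + (\<integral>y. f y * k (x - y) \<partial>lborel)" .
qed

lemma nn_integral_convolution_le:
  fixes f k :: "real \<Rightarrow> complex"
  assumes f: "integrable lborel f" and k[measurable]: "k \<in> borel_measurable borel"
    and kB: "(\<integral>\<^sup>+t. ennreal (cmod (k t)) \<partial>lborel) \<le> ennreal B" and B: "0 \<le> B"
  shows "(\<integral>\<^sup>+x. ennreal (cmod (\<integral>y. f y * k (x - y) \<partial>lborel)) \<partial>lborel) \<le> ennreal (B * (\<integral>x. cmod (f x) \<partial>lborel))"
proof -
  have [measurable]: "f \<in> borel_measurable borel" using f by auto
  have "(\<integral>\<^sup>+x. ennreal (cmod (\<integral>y. f y * k (x - y) \<partial>lborel)) \<partial>lborel)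
     \<le> (\<integral>\<^sup>+x. (\<integral>\<^sup>+y. ennreal (cmod (f y)) * ennreal (cmod (k (x - y))) \<partial>lborel) \<partial>lborel)"
  proof (rule nn_integral_mono)
    fix x
    show "ennreal (cmod (\<integral>y. f y * k (x - y) \<partial>lborel)) \<le> (\<integral>\<^sup>+y. ennreal (cmod (f y)) * ennreal (cmod (k (x - y))) \<partial>lborel)"
    \<comment> \<open>If the convolution integral does not exist, its value is 0 by convention and
      the bound is trivial.\<close>
    proof (cases "integrable lborel (\<lambda>y. f y * k (x - y))")
      case True
      then show ?thesis using integral_norm_bound_ennreal[OF True] by (simp add: norm_mult ennreal_mult)
    qed (simp add: not_integrable_integral_eq)
  qed
  also have "\<dots> = (\<integral>\<^sup>+y. (\<integral>\<^sup>+x. ennreal (cmod (f y)) * ennreal (cmod (k (x - y))) \<partial>lborel) \<partial>lborel)"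
    by (intro lborel_pair.Fubini') measurable
  also have "\<dots> = (\<integral>\<^sup>+y. ennreal (cmod (f y)) * (\<integral>\<^sup>+t. ennreal (cmod (k t)) \<partial>lborel) \<partial>lborel)"
    by (subst nn_integral_cmult) (auto simp: nn_integral_lborel_translate[where h="\<lambda>t. ennreal (cmod (k t))"])
  also have "\<dots> \<le> (\<integral>\<^sup>+y. ennreal (cmod (f y)) * ennreal B \<partial>lborel)"
    by (intro nn_integral_mono mult_left_mono kB) auto
  also have "\<dots> = ennreal (\<integral>x. cmod (f x) \<partial>lborel) * ennreal B"
    using f by (subst nn_integral_multc) (auto simp: nn_integral_eq_integral)
  also have "\<dots> = ennreal (B * (\<integral>x. cmod (f x) \<partial>lborel))"
    using B by (simp add: ennreal_mult' mult.commute)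
  finally show ?thesis .
qed

text \<open>The level is halved between the two kernels. On \<open>(b, 1]\<close> the kernel is at
  most \<open>1 / b\<close>, so Young's inequality and Chebyshev give the summand
  \<open>2 / b\<close>.\<close>

lemma weak_type_T1_trunc:
  fixes f :: "real \<Rightarrow> complex"
  assumes c\<gamma>: "continuous_on {0<..1} \<gamma>" and cf: "continuous_on UNIV f" and f: "integrable lborel f"
    and \<epsilon>: "0 < \<epsilon>" "\<epsilon> \<le> b" and \<alpha>: "0 < \<alpha>"
  shows "(\<lambda>x. T1_trunc \<gamma> f x \<epsilon>) \<in> borel_measurable borel"
    and "emeasure lborel {x. \<alpha> < cmod (T1_trunc \<gamma> f x \<epsilon>)} \<le> ennreal ((2 * C_weak + 2 / b) / \<alpha> * (\<integral>x. cmod (f x) \<partial>lborel))"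
proof -
  define k where "k t = (if b < t \<and> t \<le> 1 then exp (\<i> * complex_of_real (\<gamma> t)) / complex_of_real t else 0)" for t
  define S where "S = (\<integral>x. cmod (f x) \<partial>lborel)"
  have S0: "0 \<le> S" unfolding S_def by simp
  define G where "G x = (\<integral>y. f y * kern \<epsilon> (x - y) \<partial>lborel)" for x
  define H where "H x = (\<integral>y. f y * k (x - y) \<partial>lborel)" for x
  have k_eq: "k = (\<lambda>t. if b < t \<and> t \<le> 1 then exp (\<i> * complex_of_real (\<gamma> t)) / complex_of_real t else 0)"
    by (simp add: k_def fun_eq_iff)
  note conv = T1_trunc_eq_convolution[OF c\<gamma> cf f \<epsilon> k_eq]
  have T: "T1_trunc \<gamma> f x \<epsilon> = G x + H x" for x unfolding G_def H_def by (rule conv)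
  have [measurable]: "k \<in> borel_measurable borel" by (rule conv)
  have [measurable]: "f \<in> borel_measurable borel" using f by auto
  have [measurable]: "kern \<epsilon> \<in> borel_measurable borel" by (rule kern_measurable[OF \<epsilon>(1)])
  have [measurable]: "G \<in> borel_measurable borel" "H \<in> borel_measurable borel" unfolding G_def H_def by measurable
  show "(\<lambda>x. T1_trunc \<gamma> f x \<epsilon>) \<in> borel_measurable borel" unfolding T by measurable
  have kB: "(\<integral>\<^sup>+t. ennreal (cmod (k t)) \<partial>lborel) \<le> ennreal (1 / b)"
  proof -
    have "(\<integral>\<^sup>+t. ennreal (cmod (k t)) \<partial>lborel) \<le> (\<integral>\<^sup>+t. ennreal (1 / b) * indicator {0..1::real} t \<partial>lborel)"
      using b by (intro nn_integral_mono) (auto simp: k_def norm_divide indicator_def frac_le intro!: ennreal_leI)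
    also have "\<dots> = ennreal (1 / b)" by (simp add: nn_integral_cmult_indicator)
    finally show ?thesis .
  qed
  define X1 where "X1 = {x. \<alpha> / 2 < cmod (G x)}"
  define X2 where "X2 = {x \<in> UNIV. 1 \<le> ennreal (2 / \<alpha>) * ennreal (cmod (H x))}"
  have m: "X1 \<in> sets lborel" "X2 \<in> sets lborel" unfolding X1_def X2_def by measurable
  have "{x. \<alpha> < cmod (T1_trunc \<gamma> f x \<epsilon>)} \<subseteq> X1 \<union> X2"
  proof
    fix x assume "x \<in> {x. \<alpha> < cmod (T1_trunc \<gamma> f x \<epsilon>)}"
    then have "\<alpha> < cmod (G x) + cmod (H x)" using norm_triangle_ineq[of "G x" "H x"] unfolding T by simp
    then consider "\<alpha> / 2 < cmod (G x)" | "\<alpha> / 2 \<le> cmod (H x)" by linarith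
    then show "x \<in> X1 \<union> X2"
    proof cases
      case 2
      then have "1 \<le> 2 / \<alpha> * cmod (H x)" using \<alpha> by (simp add: field_simps)
      then have "1 \<le> ennreal (2 / \<alpha>) * ennreal (cmod (H x))"
        using \<alpha> by (simp add: ennreal_mult[symmetric])
      then show ?thesis unfolding X2_def by auto
    qed (auto simp: X1_def)
  qed
  then have "emeasure lborel {x. \<alpha> < cmod (T1_trunc \<gamma> f x \<epsilon>)} \<le> emeasure lborel (X1 \<union> X2)"
    using m by (intro emeasure_mono) auto
  also have "\<dots> \<le> emeasure lborel X1 + emeasure lborel X2"
    using m by (intro emeasure_subadditive)
  also have "\<dots> \<le> ennreal (C_weak / (\<alpha> / 2) * S) + ennreal (2 / \<alpha> * (1 / b * S))"
  proof (rule add_mono)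
    show "emeasure lborel X1 \<le> ennreal (C_weak / (\<alpha> / 2) * S)"
      unfolding X1_def G_def S_def using \<alpha> by (intro weak_type_kern \<epsilon> f) simp
    have "emeasure lborel X2 \<le> ennreal (2 / \<alpha>) * (\<integral>\<^sup>+x. ennreal (cmod (H x)) * indicator UNIV x \<partial>lborel)"
      unfolding X2_def by (intro nn_integral_Markov_inequality) auto
    also have "\<dots> \<le> ennreal (2 / \<alpha>) * ennreal (1 / b * S)"
      using b nn_integral_convolution_le[OF f _ kB] unfolding H_def S_def by (intro mult_left_mono) auto
    also have "\<dots> = ennreal (2 / \<alpha> * (1 / b * S))" using \<alpha> by (intro ennreal_mult'[symmetric]) simp
    finally show "emeasure lborel X2 \<le> ennreal (2 / \<alpha> * (1 / b * S))" .
  qed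
  also have "\<dots> = ennreal (C_weak / (\<alpha> / 2) * S + 2 / \<alpha> * (1 / b * S))"
    using \<alpha> S0 constants_pos b by (intro ennreal_plus[symmetric]) auto
  also have "C_weak / (\<alpha> / 2) * S + 2 / \<alpha> * (1 / b * S) = (2 * C_weak + 2 / b) / \<alpha> * S"
    using \<alpha> b by (simp add: field_simps)
  finally show "emeasure lborel {x. \<alpha> < cmod (T1_trunc \<gamma> f x \<epsilon>)} \<le> ennreal ((2 * C_weak + 2 / b) / \<alpha> * (\<integral>x. cmod (f x) \<partial>lborel))"
    unfolding S_def .
qed

text \<open>Where the limit exceeds \<open>\<alpha>\<close> strictly, so do all late truncations.
  The sets \<open>X N\<close> therefore increase to a superset, and each lies in the level set of a
  single truncation, with a bound independent of \<open>N\<close>.\<close>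

lemma weak_type_T1:
  fixes f :: "real \<Rightarrow> complex"
  assumes c\<gamma>: "continuous_on {0<..1} \<gamma>" and df: "\<And>x. f differentiable (at x)" and f: "integrable lborel f" and \<alpha>: "0 < \<alpha>"
  shows "{x. \<alpha> < cmod (T1 \<gamma> f x)} \<in> sets borel"
    and "emeasure lborel {x. \<alpha> < cmod (T1 \<gamma> f x)} \<le> ennreal ((2 * C_weak + 2 / b) / \<alpha> * (\<integral>x. cmod (f x) \<partial>lborel))"
proof -
  have cf: "continuous_on UNIV f" using df by (simp add: continuous_on_eq_continuous_at differentiable_imp_continuous_within)
  define s where "s n = b / real (Suc n)" for n
  have s: "0 < s n" "s n \<le> b" for n using b by (auto simp: s_def field_simps)
  have s0: "s \<longlonglongrightarrow> 0" unfolding s_def by (rule LIMSEQ_Suc[OF lim_const_over_n])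
  have fs: "filterlim s (at_right 0) sequentially"
    using s0 s(1) by (auto simp: filterlim_at less_imp_neq[THEN not_sym] intro!: always_eventually)
  have lim: "(\<lambda>n. T1_trunc \<gamma> f x (s n)) \<longlonglongrightarrow> T1 \<gamma> f x" for x
  proof -
    obtain L where L: "(T1_trunc \<gamma> f x \<longlongrightarrow> L) (at_right 0)" using T1_trunc_converges[OF c\<gamma> cf df] by blast
    then have "T1 \<gamma> f x = L" unfolding T1_def by (intro tendsto_Lim) auto
    then show ?thesis using filterlim_compose[OF L fs] by simp
  qed
  note Tm[measurable] = weak_type_T1_trunc(1)[OF c\<gamma> cf f s \<alpha>]
  have [measurable]: "T1 \<gamma> f \<in> borel_measurable borel"
    by (rule borel_measurable_LIMSEQ_metric[OF Tm lim])
  show "{x. \<alpha> < cmod (T1 \<gamma> f x)} \<in> sets borel" by measurable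
  define X where "X N = {x. \<forall>n\<ge>N. \<alpha> < cmod (T1_trunc \<gamma> f x (s n))}" for N
  have Xm: "X N \<in> sets lborel" for N unfolding X_def by measurable
  have "{x. \<alpha> < cmod (T1 \<gamma> f x)} \<subseteq> (\<Union>N. X N)"
  proof
    fix x assume "x \<in> {x. \<alpha> < cmod (T1 \<gamma> f x)}"
    then have "eventually (\<lambda>n. \<alpha> < cmod (T1_trunc \<gamma> f x (s n))) sequentially"
      by (intro order_tendstoD(1)[OF tendsto_norm[OF lim]]) auto
    then show "x \<in> (\<Union>N. X N)" unfolding X_def eventually_sequentially by auto
  qed
  then have "emeasure lborel {x. \<alpha> < cmod (T1 \<gamma> f x)} \<le> emeasure lborel (\<Union>N. X N)"
    using Xm by (intro emeasure_mono) auto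
  also have "\<dots> = (SUP N. emeasure lborel (X N))"
    using Xm by (intro SUP_emeasure_incseq[symmetric]) (auto simp: incseq_def X_def)
  also have "\<dots> \<le> ennreal ((2 * C_weak + 2 / b) / \<alpha> * (\<integral>x. cmod (f x) \<partial>lborel))"
  proof (rule SUP_least)
    fix N
    have "emeasure lborel (X N) \<le> emeasure lborel {x. \<alpha> < cmod (T1_trunc \<gamma> f x (s N))}"
      by (intro emeasure_mono) (auto simp: X_def)
    also have "\<dots> \<le> ennreal ((2 * C_weak + 2 / b) / \<alpha> * (\<integral>x. cmod (f x) \<partial>lborel))"
      by (rule weak_type_T1_trunc(2)[OF c\<gamma> cf f s \<alpha>])
    finally show "emeasure lborel (X N) \<le> ennreal ((2 * C_weak + 2 / b) / \<alpha> * (\<integral>x. cmod (f x) \<partial>lborel))" .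
  qed
  finally show "emeasure lborel {x. \<alpha> < cmod (T1 \<gamma> f x)} \<le> ennreal ((2 * C_weak + 2 / b) / \<alpha> * (\<integral>x. cmod (f x) \<partial>lborel))" .
qed

end

section \<open>The hypotheses on the phase\<close>

lemma geometric_growth:
  fixes g :: "real \<Rightarrow> real"
  assumes q: "1 < q" and A: "0 < A"
    and step: "\<And>t. 0 < t \<Longrightarrow> q * t \<le> c \<Longrightarrow> A * g (q * t) \<le> g t"
    and t: "0 < t" "t \<le> c"
  shows "A ^ n * g t \<le> g (t / q ^ n)"
proof (induction n)
  case (Suc n)
  have "q * (t / q ^ Suc n) = t / q ^ n" using q by simp
  moreover have "t / q ^ n \<le> c"
    using t q one_le_power[of q n] by (intro order_trans[OF _ t(2)]) (simp add: divide_le_eq mult_le_cancel_left1)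
  ultimately have "A * g (t / q ^ n) \<le> g (t / q ^ Suc n)"
    using step[of "t / q ^ Suc n"] t q by simp
  moreover have "A * (A ^ n * g t) \<le> A * g (t / q ^ n)" using Suc A by (intro mult_left_mono) auto
  ultimately show ?case by (simp add: mult.assoc)
qed simp

text \<open>With \<open>n\<close> the integer part of \<open>log q (t / u)\<close>, the point
  \<open>u\<close> lies between \<open>t / q ^ (n + 1)\<close> and \<open>t / q ^ n\<close>.
  Monotonicity bridges the remainder, and the rounding loses one factor \<open>A\<close>; this is
  the origin of \<open>c0 = 1 / A\<close>.\<close>

lemma power_growth:
  fixes g :: "real \<Rightarrow> real"
  assumes q: "1 < q" and A: "q < A" and b0: "0 < b0"
    and pos: "\<And>t. 0 < t \<Longrightarrow> t \<le> b0 \<Longrightarrow> 0 < g t"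
    and anti: "\<And>s t. 0 < s \<Longrightarrow> s \<le> t \<Longrightarrow> t \<le> b0 \<Longrightarrow> g t \<le> g s"
    and step: "\<And>t. 0 < t \<Longrightarrow> q * t \<le> b0 \<Longrightarrow> A * g (q * t) \<le> g t"
    and u: "0 < u" "u \<le> t" "t \<le> b0"
  shows "1 / A * (t / u) powr log q A * g t \<le> g u"
proof -
  define n where "n = nat \<lfloor>log q (t / u)\<rfloor>"
  have tu: "1 \<le> t / u" using u by simp
  have L0: "0 \<le> log q (t / u)" using q tu by simp
  have nL: "real n \<le> log q (t / u)" "log q (t / u) < real n + 1"
    unfolding n_def using L0 by linarith+
  have "q powr real n \<le> q powr log q (t / u)" using nL q by (intro powr_mono) auto
  then have "q ^ n \<le> t / u" using q tu u by (simp add: powr_realpow)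
  then have ut: "u \<le> t / q ^ n" using q u by (simp add: field_simps)
  have "(t / u) powr log q A = (q powr log q (t / u)) powr log q A" using q u by simp
  also have "\<dots> = (q powr log q A) powr log q (t / u)" by (simp add: powr_powr mult.commute)
  also have "\<dots> = A powr log q (t / u)" using q A by simp
  also have "\<dots> \<le> A powr (real n + 1)" using nL q A by (intro powr_mono) auto
  also have "\<dots> = A * A ^ n" using q A by (simp add: powr_add powr_realpow)
  finally have "1 / A * (t / u) powr log q A * g t \<le> 1 / A * (A * A ^ n) * g t"
    using q A pos[of t] u by (intro mult_right_mono mult_left_mono) auto
  also have "\<dots> = A ^ n * g t" using q A by simp
  also have "\<dots> \<le> g (t / q ^ n)"
    using q A step u by (intro geometric_growth[where c=b0]) auto
  also have "\<dots> \<le> g u"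
    using ut u q one_le_power[of q n]
    by (intro anti) (auto simp: divide_le_eq mult_le_cancel_left1 intro: order_trans)
  finally show ?thesis .
qed

lemma singular_phase_exists:
  fixes \<gamma> g g2 :: "real \<Rightarrow> real"
  assumes d\<gamma>: "\<And>t. 0 < t \<Longrightarrow> t < 1 \<Longrightarrow> (\<gamma> has_real_derivative g t) (at t)"
    and dg: "\<And>t. 0 < t \<Longrightarrow> t < 1 \<Longrightarrow> (g has_real_derivative g2 t) (at t)"
    and cg2: "continuous_on {0<..<1} g2"
    and g2: "monotone_either {0<..1} g2"
    and pos: "\<And>t. 0 < t \<Longrightarrow> t \<le> 1 \<Longrightarrow> 0 < g t"
    and anti: "\<And>s t. 0 < s \<Longrightarrow> s < t \<Longrightarrow> t \<le> 1 \<Longrightarrow> g t < g s"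
    and t0: "0 < t0" and q: "1 < q" and A: "q < A"
    and step: "\<And>t. 0 < t \<Longrightarrow> t < t0 \<Longrightarrow> q * t \<le> 1 \<Longrightarrow> A * g (q * t) \<le> g t"
  shows "\<exists>a b c0 c1. singular_phase \<gamma> g g2 a b c0 c1"
proof -
  have anti': "g t \<le> g s" if "0 < s" "s \<le> t" "t \<le> 1" for s t
    using anti[of s t] that by (cases "s = t") auto
  \<comment> \<open>Small enough that the doubling hypothesis applies throughout and that
    \<open>q * t\<close> stays inside the open interval, where two-sided derivatives exist.\<close>
  define b0 where "b0 = min t0 1 / (2 * q)"
  have b0: "0 < b0" "b0 < t0" "q * b0 < 1" "b0 < 1"
  proof -
    show "0 < b0" using t0 q by (simp add: b0_def)
    have "q * b0 = min t0 1 / 2" using q by (simp add: b0_def)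
    then have *: "q * b0 < t0" "q * b0 < 1" using t0 by auto
    then show "q * b0 < 1" by simp
    have "b0 < q * b0" using \<open>0 < b0\<close> q by simp
    then show "b0 < t0" "b0 < 1" using * by auto
  qed
  define a where "a = log q A"
  have a: "1 < a" unfolding a_def using q A by (simp add: less_log_iff)
  have growth0: "1 / A * (t / u) powr a * g t \<le> g u" if "0 < u" "u \<le> t" "t \<le> b0" for u t
    unfolding a_def
  proof (rule power_growth[OF q A b0(1)])
    fix s :: real assume s: "0 < s" "q * s \<le> b0"
    have "1 * s \<le> q * s" using s q by (intro mult_right_mono) auto
    then have "s < t0" "q * s \<le> 1" using s b0 by linarith+
    then show "A * g (q * s) \<le> g s" using s by (intro step)
  qed (use that pos anti' b0 in auto)
  \<comment> \<open>By \<open>growth0\<close>, \<open>t * g t\<close> is at least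
    \<open>(b0 / t) powr (a - 1) * (b0 * g b0) / A\<close>. \<open>K\<close> is the size required of
    the power, and \<open>b\<close> the scale at which it is reached.\<close>
  define K where "K = max 1 (A / (b0 * g b0))"
  have K: "1 \<le> K" "A / (b0 * g b0) \<le> K" unfolding K_def by auto
  define b where "b = b0 * K powr (- 1 / (a - 1))"
  have Kle: "K powr (- 1 / (a - 1)) \<le> 1"
  proof -
    have "K powr (- 1 / (a - 1)) \<le> K powr 0" using K a by (intro powr_mono) auto
    then show ?thesis using K by simp
  qed
  have b: "0 < b" "b \<le> b0" unfolding b_def using b0 K Kle by (auto simp: mult_le_cancel_left1)
  have tg: "1 \<le> t * g t" if t: "0 < t" "t \<le> b" for t
  proof -
    have tb: "t \<le> b0" using t b by simp
    have gb: "0 < g b0" using pos b0 by auto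
    have "K powr (1 / (a - 1)) \<le> b0 / t"
    proof -
      have "b0 / b = K powr (1 / (a - 1))" unfolding b_def using b0 K by (simp add: powr_minus_divide)
      moreover have "b0 / b \<le> b0 / t" using t b b0 by (intro divide_left_mono) auto
      ultimately show ?thesis by simp
    qed
    then have "(K powr (1 / (a - 1))) powr (a - 1) \<le> (b0 / t) powr (a - 1)"
      using a by (intro powr_mono2) auto
    then have "K \<le> (b0 / t) powr (a - 1)" using a K by (simp add: powr_powr)
    then have "A / (b0 * g b0) \<le> (b0 / t) powr (a - 1)" using K by simp
    then have "A \<le> (b0 / t) powr (a - 1) * (b0 * g b0)" using b0 gb by (simp add: field_simps)
    also have "\<dots> = t * ((b0 / t) powr a * g b0)"
      using t b0 by (simp add: powr_diff)
    finally have "1 \<le> t * (1 / A * (b0 / t) powr a * g b0)" using q A by (simp add: field_simps)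
    also have "\<dots> \<le> t * g t" using t tb by (intro mult_left_mono growth0) auto
    finally show ?thesis .
  qed
  have g2_mono: "g2 s \<le> g2 t" if "0 < s" "s \<le> t" "t \<le> 1" for s t
  proof -
    \<comment> \<open>The direction of monotonicity of \<open>g2\<close> is forced: were it
      decreasing, it would be bounded below by \<open>g2 1\<close>, so \<open>g\<close> would stay
      bounded by \<open>m\<close> near 0, contradicting \<open>1 \<le> t * g t\<close>.\<close>
    have "\<not> (\<forall>s\<in>{0<..1}. \<forall>t\<in>{0<..1}. s \<le> t \<longrightarrow> g2 t \<le> g2 s)"
    proof
      assume dec: "\<forall>s\<in>{0<..1}. \<forall>t\<in>{0<..1}. s \<le> t \<longrightarrow> g2 t \<le> g2 s"
      define m where "m = g b0 + \<bar>g2 1\<bar>"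
      have m: "0 < m" unfolding m_def using pos[of b0] b0 by auto
      define t where "t = min (b / 2) (1 / (2 * m))"
      have t: "0 < t" "t < b" "t \<le> 1 / (2 * m)" using b m by (auto simp: t_def)
      then have tb: "t < b0" using b by auto
      have "\<exists>z>t. z < b0 \<and> g b0 - g t = (b0 - t) * g2 z"
        using t b0 by (intro MVT2 tb dg) auto
      then obtain z where z: "t < z" "z < b0" "g b0 - g t = (b0 - t) * g2 z" by blast
      have "g2 1 \<le> g2 z" using dec z t b0 by auto
      then have "- \<bar>g2 1\<bar> \<le> g2 z" by linarith
      then have "(b0 - t) * - \<bar>g2 1\<bar> \<le> (b0 - t) * g2 z" using tb by (intro mult_left_mono) auto
      moreover have "(b0 - t) * \<bar>g2 1\<bar> \<le> 1 * \<bar>g2 1\<bar>" using t b0 by (intro mult_right_mono) auto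
      ultimately have "g t \<le> m" using z(3) unfolding m_def by simp
      then have "t * g t \<le> 1 / (2 * m) * m" using t m pos[of t] tb b0 by (intro mult_mono) auto
      then show False using tg[of t] t m by simp
    qed
    then show ?thesis using g2 that unfolding monotone_either_def by auto
  qed
  \<comment> \<open>The two entries of the minimum serve a long shift, where \<open>g\<close> has
    already lost the fraction \<open>1 - 1 / A\<close> of its value, and a short shift, where that
    loss is spread over the length \<open>(q - 1) * t\<close>.\<close>
  define c1 where "c1 = (1 - 1 / A) * min 1 (1 / (q - 1))"
  have A1: "0 < 1 - 1 / A" "1 < A" using q A by auto
  have c1: "0 < c1" "c1 \<le> (1 - 1 / A) * 1" "c1 \<le> (1 - 1 / A) * (1 / (q - 1))"
  proof -
    show "0 < c1" unfolding c1_def using A1 q by simp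
    show "c1 \<le> (1 - 1 / A) * 1" unfolding c1_def using A1 by (intro mult_left_mono min.cobounded1) simp
    show "c1 \<le> (1 - 1 / A) * (1 / (q - 1))" unfolding c1_def using A1 by (intro mult_left_mono min.cobounded2) simp
  qed
  have gap: "c1 * g t * z / (t + z) \<le> g t - g (t + z)" if tz: "0 < t" "0 < z" "t + z \<le> b" for t z
  proof -
    have t: "t < b" "t < b0" "t < t0" using tz b b0 by auto
    have qt: "q * t \<le> q * b0" using t q by simp
    have gt: "0 < g t" using pos tz t b0 by auto
    have tz1: "t + z < 1" using tz b b0 by auto
    have "A * g (q * t) \<le> g t" using tz t qt b0 by (intro step) auto
    then have gq: "(1 - 1 / A) * g t \<le> g t - g (q * t)" using A1 by (simp add: field_simps)
    show ?thesis
    proof (cases "q * t \<le> t + z")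
      case True
      have "c1 * g t * z / (t + z) = c1 * g t * (z / (t + z))" by simp
      also have "\<dots> \<le> (1 - 1 / A) * g t * 1"
        using c1 gt tz A1 by (intro mult_mono) auto
      also have "\<dots> \<le> g t - g (q * t)" using gq by simp
      also have "\<dots> \<le> g t - g (t + z)" using anti'[of "q * t" "t + z"] True tz q tz1 by simp
      finally show ?thesis .
    next
      case False
      have "\<exists>x>t. x < t + z \<and> g (t + z) - g t = (t + z - t) * g2 x"
        using tz tz1 by (intro MVT2 dg) auto
      then obtain x where x: "t < x" "x < t + z" "g (t + z) - g t = z * g2 x" by auto
      have "\<exists>y>t + z. y < q * t \<and> g (q * t) - g (t + z) = (q * t - (t + z)) * g2 y"
        using tz False qt b0 by (intro MVT2 dg) auto
      then obtain y where y: "t + z < y" "y < q * t" "g (q * t) - g (t + z) = (q * t - (t + z)) * g2 y" by auto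
      \<comment> \<open>Convexity of \<open>g\<close>: its descent on \<open>[t, t + z]\<close> is
        at least as steep as on the rest of \<open>[t, q * t]\<close>, hence at least as steep as
        the average descent that (a.4) guarantees.\<close>
      have "g2 x \<le> g2 y" using x y tz qt b0 by (intro g2_mono) auto
      then have "(q * t - (t + z)) * g2 x \<le> g (q * t) - g (t + z)"
        unfolding y(3) using False by (intro mult_left_mono) auto
      then have "g t - g (q * t) \<le> (q - 1) * t * (- g2 x)" using x(3) by (simp add: algebra_simps)
      then have "(1 - 1 / A) * g t \<le> (q - 1) * t * (- g2 x)" using gq by simp
      then have s: "(1 - 1 / A) / (q - 1) * g t / t \<le> - g2 x"
        using q tz by (simp add: field_simps)
      have "c1 * g t * z / (t + z) \<le> (1 - 1 / A) / (q - 1) * g t * z / t"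
        using c1 gt tz A1 q by (intro frac_le mult_right_mono) auto
      also have "\<dots> = z * ((1 - 1 / A) / (q - 1) * g t / t)" by simp
      also have "\<dots> \<le> z * (- g2 x)" using tz s by (intro mult_left_mono) auto
      also have "\<dots> = g t - g (t + z)" using x(3) by simp
      finally show ?thesis .
    qed
  qed
  have "singular_phase \<gamma> g g2 a b (1 / A) c1"
  proof
    show "continuous_on {0<..b} g2" by (rule continuous_on_subset[OF cg2]) (use b b0 in auto)
  qed (use a b b0 A1 c1 d\<gamma> dg g2_mono pos anti' growth0 gap tg in auto)
  then show ?thesis by blast
qed

section \<open>Reduction of the theorem to the phase estimates\<close>

lemma has_real_derivative_interior:
  assumes "(f has_real_derivative D) (at t within {0<..1})" "0 < t" "t < 1"
  shows "(f has_real_derivative D) (at t)"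
  using has_field_derivative_subset[OF assms(1), of "{0<..<1}"] assms(2,3)
  by (simp add: at_within_open[OF _ open_greaterThanLessThan] subset_iff)

lemma smooth_compact_support_imp:
  assumes "smooth_compact_support f"
  shows "f differentiable (at x)" and "integrable lborel f"
proof -
  have d: "f differentiable (at x)" for x
    using assms by (auto simp: smooth_compact_support_def vderiv_iter_def dest!: spec[of _ "0::nat"])
  then show "f differentiable (at x)" .
  have c: "continuous_on S f" for S
    using d by (simp add: continuous_at_imp_continuous_on differentiable_imp_continuous_within)
  have "compact (closure {x. f x \<noteq> 0})" using assms by (simp add: smooth_compact_support_def)
  then have "integrable lborel (\<lambda>x. indicator (closure {x. f x \<noteq> 0}) x *\<^sub>R f x)"
    by (rule borel_integrable_compact[OF _ c])
  also have "(\<lambda>x. indicator (closure {x. f x \<noteq> 0}) x *\<^sub>R f x) = f"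
    using closure_subset[of "{x. f x \<noteq> 0}"] by (auto simp: indicator_def fun_eq_iff)
  finally show "integrable lborel f" .
qed

theorem mainTheorem1:
  fixes \<gamma> \<gamma>1 \<gamma>2 \<gamma>3 \<psi> \<psi>1 \<psi>2 :: "real \<Rightarrow> real"
    and t0 s0 C :: real
  assumes
    \<comment> \<open>gamma in C^3((0,1]) with derivatives gamma1, gamma2, gamma3\<close>
    g1: "\<And>t. t \<in> {0<..1} \<Longrightarrow> (\<gamma> has_real_derivative \<gamma>1 t) (at t within {0<..1})"
    and g2: "\<And>t. t \<in> {0<..1} \<Longrightarrow> (\<gamma>1 has_real_derivative \<gamma>2 t) (at t within {0<..1})"
    and g3: "\<And>t. t \<in> {0<..1} \<Longrightarrow> (\<gamma>2 has_real_derivative \<gamma>3 t) (at t within {0<..1})"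
    and g3c: "continuous_on {0<..1} \<gamma>3"
    and glim: "filterlim (\<lambda>t. \<bar>\<gamma> t\<bar>) at_top (at_right 0)"
    \<comment> \<open>psi in C^2([0,1]) with derivatives psi1, psi2\<close>
    and p1: "\<And>t. t \<in> {0..1} \<Longrightarrow> (\<psi> has_real_derivative \<psi>1 t) (at t within {0..1})"
    and p2: "\<And>t. t \<in> {0..1} \<Longrightarrow> (\<psi>1 has_real_derivative \<psi>2 t) (at t within {0..1})"
    and p2c: "continuous_on {0..1} \<psi>2"
    and ppos: "\<And>t. t \<in> {0<..1} \<Longrightarrow> \<psi> t > 0"
    and plim: "(\<psi> \<longlongrightarrow> 0) (at_right 0)"
    \<comment> \<open>constants\<close>
    and t0: "t0 > 0" and s0: "s0 > 0" and C: "C > 0"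
    \<comment> \<open>(a.1)\<close>
    and a1_g: "monotone_either {0<..1} \<gamma>"
    and a1_p: "monotone_either {0..1} \<psi>"
    and a1_g1: "monotone_either {0<..1} \<gamma>1"
    and a1_g2: "monotone_either {0<..1} \<gamma>2"
    and a1_p1: "monotone_either {0..1} \<psi>1"
    and a1_g1pos: "\<And>t. t \<in> {0<..1} \<Longrightarrow> \<gamma>1 t > 0"
    and a1_g1dec: "\<And>s t. 0 < s \<Longrightarrow> s < t \<Longrightarrow> t \<le> 1 \<Longrightarrow> \<gamma>1 t < \<gamma>1 s"
    \<comment> \<open>(a.2)\<close>
    and a2: "\<And>t. 0 < t \<Longrightarrow> t < t0 \<Longrightarrow> t \<le> 1 \<Longrightarrow>
               \<bar>\<psi>1 t / \<psi> t\<bar> \<le> 1/2 * \<bar>\<gamma>3 t / \<gamma>2 t\<bar>"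
    \<comment> \<open>(a.3), with the inverse of gamma1 taken on (0,1]\<close>
    and a3: "\<And>s. s > s0 \<Longrightarrow> s \<ge> \<gamma>1 1 \<Longrightarrow>
               \<bar>\<gamma>2 (the_inv_into {0<..1} \<gamma>1 (2 * s))\<bar>
                 \<le> C * \<bar>\<gamma>2 (the_inv_into {0<..1} \<gamma>1 s)\<bar>"
    \<comment> \<open>(a.4)\<close>
    and a4: "\<exists>\<epsilon> A. \<epsilon> > 0 \<and> A > 1 + \<epsilon> \<and>
               (\<forall>t. 0 < t \<and> t < t0 \<and> (1 + \<epsilon>) * t \<le> 1 \<longrightarrow> \<gamma>1 t \<ge> A * \<gamma>1 ((1 + \<epsilon>) * t))"
    \<comment> \<open>(a.5)\<close>
    and a5: "\<exists>lam. 1/2 < lam \<and> lam < 1 \<and>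
               (\<forall>t. 0 < t \<and> t < t0 \<and> t \<le> 1 \<longrightarrow> \<bar>\<gamma>2 t\<bar> \<le> C * \<gamma>1 t powr (2 * lam))"
  shows "\<exists>A. \<forall>f \<alpha>. smooth_compact_support f \<and> \<alpha> > 0 \<longrightarrow>
            (\<forall>x. \<exists>L. (T1_trunc \<gamma> f x \<longlongrightarrow> L) (at_right 0)) \<and>
            {x. \<alpha> < cmod (T1 \<gamma> f x)} \<in> sets lebesgue \<and>
            emeasure lebesgue {x. \<alpha> < cmod (T1 \<gamma> f x)}
              \<le> ennreal (A / \<alpha> * (\<integral>x. cmod (f x) \<partial>lborel))"
proof -
  obtain e A where eA: "e > 0" "A > 1 + e"
    and step: "\<And>t. 0 < t \<Longrightarrow> t < t0 \<Longrightarrow> (1 + e) * t \<le> 1 \<Longrightarrow> A * \<gamma>1 ((1 + e) * t) \<le> \<gamma>1 t"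
    using a4 by blast
  have cont: "continuous_on {0<..1} \<gamma>" "continuous_on {0<..1} \<gamma>2"
    using g1 g3 by (metis DERIV_continuous continuous_on_eq_continuous_within)+
  have "\<exists>a b c0 c1. singular_phase \<gamma> \<gamma>1 \<gamma>2 a b c0 c1"
  proof (rule singular_phase_exists[where g=\<gamma>1 and q="1 + e" and A=A, OF _ _ _ a1_g2 _ a1_g1dec t0 _ eA(2) step])
    show "(\<gamma> has_real_derivative \<gamma>1 t) (at t)" "(\<gamma>1 has_real_derivative \<gamma>2 t) (at t)"
      if "0 < t" "t < 1" for t
      using that g1[of t] g2[of t] by (auto intro: has_real_derivative_interior)
    show "continuous_on {0<..<1} \<gamma>2" by (rule continuous_on_subset[OF cont(2)]) auto
  qed (use a1_g1pos eA in auto)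
  then obtain a b c0 c1 where "singular_phase \<gamma> \<gamma>1 \<gamma>2 a b c0 c1" by blast
  then interpret singular_phase \<gamma> \<gamma>1 \<gamma>2 a b c0 c1 .
  show ?thesis
  \<comment> \<open>This constant is built from the locale parameters alone, so it is fixed before
    \<open>f\<close> and \<open>\<alpha>\<close> are chosen.\<close>
  proof (rule exI[of _ "2 * C_weak + 2 / b"], intro allI impI conjI)
    fix f :: "real \<Rightarrow> complex" and \<alpha> :: real
    assume "smooth_compact_support f \<and> \<alpha> > 0"
    then have df: "\<And>x. f differentiable (at x)" and f: "integrable lborel f" and \<alpha>: "0 < \<alpha>"
      using smooth_compact_support_imp by auto
    have cf: "continuous_on UNIV f"
      using df by (simp add: continuous_at_imp_continuous_on differentiable_imp_continuous_within)
    show "\<exists>L. (T1_trunc \<gamma> f x \<longlongrightarrow> L) (at_right 0)" for x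
      by (rule T1_trunc_converges[OF cont(1) cf df])
    have m: "{x. \<alpha> < cmod (T1 \<gamma> f x)} \<in> sets lborel"
      using weak_type_T1(1)[OF cont(1) df f \<alpha>] by simp
    then show "{x. \<alpha> < cmod (T1 \<gamma> f x)} \<in> sets lebesgue" by (rule sets_completionI_sets)
    show "emeasure lebesgue {x. \<alpha> < cmod (T1 \<gamma> f x)}
        \<le> ennreal ((2 * C_weak + 2 / b) / \<alpha> * (\<integral>x. cmod (f x) \<partial>lborel))"
      using weak_type_T1(2)[OF cont(1) df f \<alpha>] m by simp
  qed
qed

end
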